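(* (a) Let $d\geq2$ be an integer and let $d/(2^d-1)\leq p<\infty$. For every second-countable locally compact abelian group $G$ with Haar measure $\mu$ and every measurable function $f\colon G\to[0,\infty)$ one has \[ [f]_{\mathrm{U}^{d,p}(G)} \leq \|f\|_{\mathrm{L}^{2^d p/(d+p)}(G)}. \] (b) Let $d\geq2$ be an integer and let $d/(2^d-1)<p<\infty$. There exist $\varepsilon_0>0$ and a function $\psi\colon(0,\infty)\to[0,\infty)$ with $\lim_{\varepsilon\to0+}\psi(\varepsilon)=0$, both depending only on $d$ and $p$, such that the following holds. Let $0<\varepsilon\leq\varepsilon_0$, let $G$ be a second-countable locally compact abelian group with Haar measure $\mu$, and let $f\in \mathrm{L}^{2^d p/(d+p)}(G)$ be nonnegative, not equal to zero $\mu$-a.e., and such that \[ [f]_{\mathrm{U}^{d,p}(G)} \geq (1-\varepsilon)\, \|f\|_{\mathrm{L}^{2^d p/(d+p)}(G)}. \] Then there exist a compact open subgroup $H$ of $G$ and an element $x_0\in G$ such that \[ \Bigl\| f - \frac{\|f\|_{\mathrm{L}^{2^d p/(d+p)}(G)}}{\mu(H)^{(d+p)/(2^d p)}}\,\mathbf{1}_{x_0+H} \Bigr\|_{\mathrm{L}^{2^d p/(d+p)}(G)} \leq \psi(\varepsilon)\, \|f\|_{\mathrm{L}^{2^d p/(d+p)}(G)}. \]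
   Context: For an integer $d\geq1$ and a measurable $f\colon G\to[0,\infty)$ on a second-countable locally compact abelian group $(G,+)$ with Haar measure $\mu$, define \[ R_d f(h_1,\ldots,h_d) := \int_G \prod_{(\omega_1,\ldots,\omega_d)\in\{0,1\}^d} f\bigl(x+\omega_1h_1+\cdots+\omega_dh_d\bigr)\,d\mu(x)\in[0,\infty], \] and, for $p\in(0,\infty)$, \[ [f]_{\mathrm{U}^{d,p}(G)} := \|R_d f\|_{\mathrm{L}^p(G^d)}^{1/2^d} = \Bigl(\int_{G^d}(R_df)^p\,d\mu^d\Bigr)^{1/(2^dp)}\in[0,\infty], \] where $\mu^d$ is the product measure on $G^d$. $\mathbf{1}_E$ denotes the indicator function of a set $E$. *)

theory Defs
  imports "HOL-Analysis.Analysis" "HOL-Algebra.Coset" "HOL-Algebra.FiniteProduct"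
begin

section \<open>Locally compact abelian groups and Haar measure\<close>

text \<open>Groups are the carrier-based ones of HOL-Algebra, hence written multiplicatively: the
  element \<open>x + \<omega>\<^sub>1 h\<^sub>1 + \<dots> + \<omega>\<^sub>d h\<^sub>d\<close> appears as \<open>x \<otimes> (\<Otimes>i\<in>{..<d}. h i [^] \<omega> i)\<close>,
  and the translate \<open>x + A\<close> as \<open>x <# A\<close>. As usual, locally compact groups are Hausdorff.\<close>

locale lca_group = comm_group G for G (structure) +
  fixes T :: "'a topology"
  assumes topspace_eq: "topspace T = carrier G"
    and continuous_mult: "continuous_map (prod_topology T T) T (\<lambda>(x, y). x \<otimes> y)"
    and continuous_inv: "continuous_map T T (\<lambda>x. inv x)"
    and Hausdorff: "Hausdorff_space T"
    and locally_compact: "locally_compact_space T"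

text \<open>A Haar measure is a nonzero translation-invariant Radon measure on the Borel sets.\<close>

definition haar_measure ::
    "('a, 'b) monoid_scheme \<Rightarrow> 'a topology \<Rightarrow> 'a measure \<Rightarrow> bool" where
  "haar_measure G T \<mu> \<longleftrightarrow>
     sets \<mu> = sets (sigma (topspace T) {U. openin T U}) \<and>
     emeasure \<mu> (space \<mu>) \<noteq> 0 \<and>
     (\<forall>x\<in>carrier G. \<forall>A\<in>sets \<mu>. emeasure \<mu> (x <#\<^bsub>G\<^esub> A) = emeasure \<mu> A) \<and>
     (\<forall>K. compactin T K \<longrightarrow> emeasure \<mu> K < \<infinity>) \<and>
     (\<forall>A\<in>sets \<mu>. emeasure \<mu> A = (INF U\<in>{U. openin T U \<and> A \<subseteq> U}. emeasure \<mu> U)) \<and>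
     (\<forall>U. openin T U \<longrightarrow> emeasure \<mu> U = (SUP K\<in>{K. compactin T K \<and> K \<subseteq> U}. emeasure \<mu> K))"

definition sc_lca_haar ::
    "('a, 'b) monoid_scheme \<Rightarrow> 'a topology \<Rightarrow> 'a measure \<Rightarrow> bool" where
  "sc_lca_haar G T \<mu> \<longleftrightarrow> lca_group G T \<and> second_countable T \<and> haar_measure G T \<mu>"


section \<open>Norms\<close>

text \<open>Powers of extended nonnegative reals, meant for exponents \<open>a > 0\<close> only
  (so that \<open>0\<close> is mapped to \<open>0\<close> and \<open>\<infinity>\<close> to \<open>\<infinity>\<close>).\<close>

definition enn_powr :: "ennreal \<Rightarrow> real \<Rightarrow> ennreal" where
  "enn_powr x a = (if x = \<infinity> then \<infinity> else ennreal (enn2real x powr a))"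

definition Lp_enorm :: "'a measure \<Rightarrow> real \<Rightarrow> ('a \<Rightarrow> ennreal) \<Rightarrow> ennreal" where
  "Lp_enorm M p F = enn_powr (\<integral>\<^sup>+x. enn_powr (F x) p \<partial>M) (1 / p)"

definition Lp_norm :: "'a measure \<Rightarrow> real \<Rightarrow> ('a \<Rightarrow> real) \<Rightarrow> ennreal" where
  "Lp_norm M p f = Lp_enorm M p (\<lambda>x. ennreal \<bar>f x\<bar>)"

text \<open>Tuples \<open>(h\<^sub>1, \<dots>, h\<^sub>d)\<close> and \<open>(\<omega>\<^sub>1, \<dots>, \<omega>\<^sub>d)\<close> are extensional functions on \<open>{..<d}\<close>.\<close>

definition gowers_R ::
    "('a, 'b) monoid_scheme \<Rightarrow> 'a measure \<Rightarrow> nat \<Rightarrow> ('a \<Rightarrow> real) \<Rightarrow> (nat \<Rightarrow> 'a) \<Rightarrow> ennreal" where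
  "gowers_R G \<mu> d f h =
     (\<integral>\<^sup>+x. (\<Prod>\<omega>\<in>{..<d} \<rightarrow>\<^sub>E {0, 1::nat}.
        ennreal (f (x \<otimes>\<^bsub>G\<^esub> (\<Otimes>\<^bsub>G\<^esub>i\<in>{..<d}. h i [^]\<^bsub>G\<^esub> \<omega> i)))) \<partial>\<mu>)"

definition U_norm ::
    "('a, 'b) monoid_scheme \<Rightarrow> 'a measure \<Rightarrow> nat \<Rightarrow> real \<Rightarrow> ('a \<Rightarrow> real) \<Rightarrow> ennreal" where
  "U_norm G \<mu> d p f =
     enn_powr (Lp_enorm (\<Pi>\<^sub>M i\<in>{..<d}. \<mu>) p (gowers_R G \<mu> d f)) (1 / 2 ^ d)"

abbreviation crit_exp :: "nat \<Rightarrow> real \<Rightarrow> real" where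
  "crit_exp d p \<equiv> 2 ^ d * p / (real d + p)"


section \<open>Stability\<close>

text \<open>\<open>stability_on TYPE('a) d p \<epsilon>\<^sub>0 \<psi>\<close>: near-extremizers are close to multiples of indicators of
  cosets, quantitatively with \<open>\<epsilon>\<^sub>0\<close> and \<open>\<psi>\<close>, for all groups with carrier in the type \<open>'a\<close>.
  HOL cannot quantify over \<open>'a\<close> inside a formula. However, a second-countable Hausdorff space
  has at most the cardinality of the continuum, so every second-countable locally compact
  abelian group is isomorphic to one with carrier a set of reals. Constants \<open>\<epsilon>\<^sub>0\<close>, \<open>\<psi>\<close>
  serving all groups can therefore be quantified over at the type \<open>real\<close>, which does not
  mention \<open>'a\<close>, and any such pair then has to serve every type \<open>'a\<close> as well.\<close>

definition stability_on ::
    "'a itself \<Rightarrow> nat \<Rightarrow> real \<Rightarrow> real \<Rightarrow> (real \<Rightarrow> real) \<Rightarrow> bool" where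
  "stability_on _ d p \<epsilon>\<^sub>0 \<psi> \<longleftrightarrow>
     (\<forall>\<epsilon> (G :: 'a monoid) T \<mu> f.
        0 < \<epsilon> \<and> \<epsilon> \<le> \<epsilon>\<^sub>0 \<and> sc_lca_haar G T \<mu> \<and>
        f \<in> borel_measurable \<mu> \<and> (\<forall>x\<in>carrier G. 0 \<le> f x) \<and>
        Lp_norm \<mu> (crit_exp d p) f < \<infinity> \<and>
        \<not> (AE x in \<mu>. f x = 0) \<and>
        U_norm G \<mu> d p f \<ge> ennreal (1 - \<epsilon>) * Lp_norm \<mu> (crit_exp d p) f
        \<longrightarrow>
        (\<exists>H x\<^sub>0. subgroup H G \<and> openin T H \<and> compactin T H \<and> x\<^sub>0 \<in> carrier G \<and>
           Lp_norm \<mu> (crit_exp d p)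
             (\<lambda>x. f x - enn2real (Lp_norm \<mu> (crit_exp d p) f)
                        / measure \<mu> H powr ((real d + p) / (2 ^ d * p))
                        * indicator (x\<^sub>0 <#\<^bsub>G\<^esub> H) x)
           \<le> ennreal (\<psi> \<epsilon>) * Lp_norm \<mu> (crit_exp d p) f))"

end

theory Submission
  imports Defs
begin

text \<open>Write \<open>q\<close> for the critical exponent and \<open>g = f\<^sup>q\<close>. Integrating the cube integral \<open>R\<^sub>d f\<close> over one
  coordinate \<open>h\<^sub>i\<close> gives the square of a cube integral of dimension \<open>d - 1\<close>. For \<open>p < 1\<close>, reverse
  Hoelder duality with a product of powers of these lower-dimensional cube integrals as weight,
  together with the Loomis-Whitney inequality, reduces the pair \<open>(d, p)\<close> to \<open>(d - 1, s)\<close> with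
  \<open>s = 2 p (d - 1) / (d - p)\<close> and the same \<open>q\<close>. For \<open>p \<ge> 1\<close>, slicing \<open>R\<^sub>d f\<close> along one \<open>h\<^sub>i\<close> and using
  the inequality in dimension \<open>d - 1\<close> for the functions \<open>x \<mapsto> f (x) f (x + h\<^sub>i)\<close> leaves Young's
  inequality for the autocorrelation of a power of \<open>g\<close>, with some exponent \<open>r\<close>; here \<open>r > 1\<close> as soon
  as \<open>q > 1\<close>.

  For the stability let \<open>\<integral>g = 1\<close>. Near-equality in Young's inequality forces the Bhattacharyya
  coefficient of \<open>g\<close> and its translate by \<open>h\<close> to be close to 1 for most \<open>h\<close> with respect to the
  autocorrelation of \<open>g\<close>. Thus, after a translation, \<open>g\<close> is \<open>L\<^sup>1\<close>-close to its translates by most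
  elements with respect to the density \<open>g\<close>. The \<open>L\<^sup>1\<close> distance between \<open>g\<close> and its translates has a
  gap in its values, so the elements below the gap form a subgroup \<open>H\<close>, and averaging over \<open>H\<close>
  shows that \<open>g\<close> is close to the normalised indicator of \<open>H\<close>. By regularity of the Haar measure,
  \<open>H\<close> is open and compact.\<close>

section \<open>Powers and Hoelder-type inequalities in extended nonnegative reals\<close>

text \<open>Slicing starts in dimension 0, so its first step is Young's inequality with exponent
  \<open>r = p\<close>. This confines it to \<open>p \<ge> 1\<close>, and smaller \<open>p\<close>
  need a different descent. That descent cannot get stuck: it preserves \<open>q\<close>, and in
  dimension 1 the condition \<open>q \<ge> 1\<close> reads \<open>p \<ge> 1\<close>. Here the
  threshold \<open>d / (2 ^ d - 1)\<close> enters, being equivalent to \<open>q \<ge> 1\<close>. In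
  both regimes the last slice is kept as a Young functional instead of being estimated. The result
  is a chain: Gowers norm, power of the Young functional of \<open>g\<close>, power of
  \<open>\<integral>g\<close>, all of the same homogeneity. A near-extremizer is therefore nearly
  extremal for the Young step, and stability has to be proved for that step alone. If
  \<open>q = 1\<close> the descent ends with \<open>r = 1\<close>, where Young's inequality is
  Fubini's identity and carries no information; hence the strict inequality in the stability
  statement. All structural estimates are \<open>L\<^sup>1\<close> estimates for the probability
  density \<open>g\<close>; superadditivity of \<open>x \<mapsto> x\<^sup>q\<close> brings them back
  to \<open>f\<close> in \<open>L\<^sup>q\<close>.\<close>

lemma enn_powr_ennreal: "0 \<le> x \<Longrightarrow> enn_powr (ennreal x) a = ennreal (x powr a)"
  by (simp add: enn_powr_def)

lemma enn_powr_top [simp]: "enn_powr top_class.top a = top_class.top"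
  by (simp add: enn_powr_def)

lemma enn_powr_0 [simp]: "enn_powr 0 a = 0"
  by (simp add: enn_powr_def)

lemma enn_powr_1 [simp]: "enn_powr 1 a = 1"
  by (simp add: enn_powr_def)

lemma enn_powr_one [simp]: "enn_powr x 1 = x"
  by (cases x) (auto simp: enn_powr_ennreal)

lemma enn_powr_eq_0_iff [simp]: "enn_powr x a = 0 \<longleftrightarrow> x = 0"
  by (cases x) (auto simp: enn_powr_ennreal ennreal_eq_0_iff)

lemma enn_powr_eq_top_iff [simp]: "enn_powr x a = top_class.top \<longleftrightarrow> x = top_class.top"
  by (cases x) (auto simp: enn_powr_ennreal)

text \<open>Valid for every real \<open>a\<close>: 0 and infinity are fixed points of
  \<open>enn_powr\<close>, and 0 times infinity is 0 on both sides. The same convention makes the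
  laws for iterated powers and sums of exponents unconditional, so exponents can be rewritten freely
  below.\<close>

lemma enn_powr_mult:
  "enn_powr (x * y) a = enn_powr x a * enn_powr y a"
proof (cases "x = \<infinity> \<or> y = \<infinity>")
  case True
  then show ?thesis
    by (cases "x = 0 \<or> y = 0") (auto simp: ennreal_mult_top ennreal_top_mult)
next
  case False
  then obtain r s where "0 \<le> r" "x = ennreal r" "0 \<le> s" "y = ennreal s"
    by (cases x; cases y) auto
  then show ?thesis
    by (simp add: enn_powr_ennreal powr_mult flip: ennreal_mult)
qed

lemma enn_powr_prod: "enn_powr (\<Prod>i\<in>I. f i) a = (\<Prod>i\<in>I. enn_powr (f i) a)"
  by (induction I rule: infinite_finite_induct) (auto simp: enn_powr_mult)

lemma enn_powr_powr: "enn_powr (enn_powr x a) b = enn_powr x (a * b)"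
  by (cases x) (auto simp: enn_powr_ennreal powr_powr)

lemma enn_powr_add: "enn_powr x (a + b) = enn_powr x a * enn_powr x b"
  by (cases x) (auto simp: enn_powr_ennreal powr_add ennreal_mult)

lemma enn_powr_of_nat: "0 < n \<Longrightarrow> enn_powr x (real n) = x ^ n"
proof (cases x)
  case (real r)
  then show "0 < n \<Longrightarrow> enn_powr x (real n) = x ^ n"
    by (cases "r = 0") (simp_all add: enn_powr_ennreal ennreal_power powr_realpow)
qed simp

lemma enn_powr_2: "enn_powr x 2 = x\<^sup>2"
  using enn_powr_of_nat[of 2 x] by simp

lemma enn_powr_mono: "0 \<le> a \<Longrightarrow> x \<le> y \<Longrightarrow> enn_powr x a \<le> enn_powr y a"
proof (cases "y = \<infinity>")
  case False
  assume "0 \<le> a" "x \<le> y"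
  with False obtain r s where "0 \<le> r" "x = ennreal r" "0 \<le> s" "y = ennreal s"
    by (cases x; cases y) (auto simp: top_unique)
  then show ?thesis
    using \<open>x \<le> y\<close> \<open>0 \<le> a\<close> by (auto simp: enn_powr_ennreal intro!: ennreal_leI powr_mono2)
qed simp

lemma borel_measurable_enn_powr [measurable]:
  assumes [measurable]: "f \<in> borel_measurable M"
  shows "(\<lambda>x. enn_powr (f x) a) \<in> borel_measurable M"
  unfolding enn_powr_def infinity_ennreal_def by measurable

lemma enn_powr_AM_GM:
  assumes "0 < u" "u < 1"
  shows "enn_powr x u * enn_powr y (1 - u) \<le> ennreal u * x + ennreal (1 - u) * y"
proof (cases "x = \<infinity> \<or> y = \<infinity>")
  case True
  then show ?thesis using assms by (auto simp: ennreal_mult_top)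
next
  case False
  then obtain r s where *: "0 \<le> r" "x = ennreal r" "0 \<le> s" "y = ennreal s"
    by (cases x; cases y) auto
  have "r powr u * s powr (1 - u) \<le> u * r + (1 - u) * s"
    using Youngs_inequality_0[of u "1 - u" r s] assms * by (cases "r = 0 \<or> s = 0") auto
  with * assms show ?thesis
    by (simp add: enn_powr_ennreal flip: ennreal_mult ennreal_plus)
qed

text \<open>Normalise both integrals to 1 and integrate the weighted AM-GM inequality. Weights
  \<open>u\<close> and \<open>1 - u\<close> on the integrands, instead of conjugate norms, keep the
  interpolations below readable as identities between exponents.\<close>

lemma Hoelder_nn_integral:
  assumes [measurable]: "F \<in> borel_measurable M" "G \<in> borel_measurable M"
    and u: "0 < u" "u < 1"
  shows "(\<integral>\<^sup>+x. enn_powr (F x) u * enn_powr (G x) (1 - u) \<partial>M)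
    \<le> enn_powr (\<integral>\<^sup>+x. F x \<partial>M) u * enn_powr (\<integral>\<^sup>+x. G x \<partial>M) (1 - u)" (is "?L \<le> ?R")
proof -
  define A where "A = (\<integral>\<^sup>+x. F x \<partial>M)"
  define B where "B = (\<integral>\<^sup>+x. G x \<partial>M)"
  consider "A = 0 \<or> B = 0" | "A \<noteq> 0" "B \<noteq> 0" "A = \<infinity> \<or> B = \<infinity>"
    | "A \<noteq> 0" "B \<noteq> 0" "A \<noteq> \<infinity>" "B \<noteq> \<infinity>" by blast
  then show ?thesis
  proof cases
    case 1
    then have "(AE x in M. F x = 0) \<or> (AE x in M. G x = 0)"
      by (auto simp: A_def B_def nn_integral_0_iff_AE)
    then have "AE x in M. enn_powr (F x) u * enn_powr (G x) (1 - u) = 0"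
      by auto
    then have "?L = 0"
      by (subst nn_integral_0_iff_AE) auto
    then show ?thesis by simp
  next
    case 2
    then have "?R = \<infinity>"
      by (auto simp: A_def[symmetric] B_def[symmetric] ennreal_mult_eq_top_iff)
    then show ?thesis by simp
  next
    case 3
    then obtain a b where ab: "A = ennreal a" "B = ennreal b" "0 < a" "0 < b"
      by (cases A; cases B) (auto simp: less_le)
    \<comment> \<open>\<open>C\<close> is the claimed right-hand side; the remaining factor
      integrates to \<open>u + (1 - u) = 1\<close>.\<close>
    define C where "C = ennreal (a powr u * b powr (1 - u))"
    have pt: "enn_powr x u * enn_powr y (1 - u)
        \<le> C * (ennreal (u / a) * x + ennreal ((1 - u) / b) * y)" for x y
    proof -
      have "enn_powr x u * enn_powr y (1 - u)
        = C * (enn_powr (ennreal (1 / a) * x) u * enn_powr (ennreal (1 / b) * y) (1 - u))"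
      proof -
        have "C * (ennreal ((1 / a) powr u) * ennreal ((1 / b) powr (1 - u))) = 1"
          using ab by (simp add: C_def powr_divide flip: ennreal_mult)
        then have "enn_powr x u * enn_powr y (1 - u) = C * (ennreal ((1 / a) powr u)
            * ennreal ((1 / b) powr (1 - u))) * (enn_powr x u * enn_powr y (1 - u))"
          by simp
        also have "\<dots> = C * (ennreal ((1 / a) powr u) * enn_powr x u
            * (ennreal ((1 / b) powr (1 - u)) * enn_powr y (1 - u)))"
          by (simp only: mult_ac)
        finally show ?thesis
          using ab by (simp only: enn_powr_mult enn_powr_ennreal divide_nonneg_pos zero_le_one less_imp_le)
      qed
      also have "\<dots> \<le> C * (ennreal u * (ennreal (1 / a) * x) + ennreal (1 - u) * (ennreal (1 / b) * y))"
        by (intro mult_left_mono enn_powr_AM_GM u) auto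
      also have "\<dots> = C * (ennreal (u / a) * x + ennreal ((1 - u) / b) * y)"
      proof -
        have "ennreal u * (ennreal (1 / a) * x) = ennreal (u / a) * x"
          using ab u by (subst mult.assoc[symmetric], subst ennreal_mult[symmetric]) auto
        moreover have "ennreal (1 - u) * (ennreal (1 / b) * y) = ennreal ((1 - u) / b) * y"
          using ab u by (subst mult.assoc[symmetric], subst ennreal_mult[symmetric]) auto
        ultimately show ?thesis by simp
      qed
      finally show ?thesis .
    qed
    have "?L \<le> (\<integral>\<^sup>+x. C * (ennreal (u / a) * F x + ennreal ((1 - u) / b) * G x) \<partial>M)"
      by (intro nn_integral_mono pt)
    also have "\<dots> = C * (ennreal (u / a) * A + ennreal ((1 - u) / b) * B)"
      by (simp add: nn_integral_cmult nn_integral_add A_def B_def)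
    also have "\<dots> = C"
      using ab u by (simp flip: ennreal_mult ennreal_plus)
    also have "\<dots> = ?R"
      using ab by (simp add: A_def[symmetric] B_def[symmetric] C_def enn_powr_ennreal ennreal_mult)
    finally show ?thesis .
  qed
qed

text \<open>One factor is split off with weight \<open>1 / (n + 1)\<close>; the other
  \<open>n\<close> are regrouped as a product of \<open>n\<close>-th roots raised to
  \<open>n / (n + 1)\<close>, to which the induction hypothesis applies.\<close>

lemma Hoelder_nn_integral_prod:
  assumes "finite J" "J \<noteq> {}" "\<And>j. j \<in> J \<Longrightarrow> F j \<in> borel_measurable M"
  shows "(\<integral>\<^sup>+x. (\<Prod>j\<in>J. enn_powr (F j x) (1 / card J)) \<partial>M)
    \<le> (\<Prod>j\<in>J. enn_powr (\<integral>\<^sup>+x. F j x \<partial>M) (1 / card J))"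
  using assms
proof (induction J rule: finite_ne_induct)
  case (singleton j)
  then show ?case by simp
next
  case (insert k J)
  define n where "n = real (card J)"
  have n: "0 < n" using insert by (simp add: n_def card_gt_0_iff)
  have card: "real (card (insert k J)) = n + 1"
    using insert by (simp add: n_def)
  have eq: "1 - 1 / (n + 1) = n / (n + 1)" "1 / n * (n / (n + 1)) = 1 / (n + 1)"
    using n by (auto simp: field_simps)
  have [measurable]: "F k \<in> borel_measurable M" "\<And>j. j \<in> J \<Longrightarrow> F j \<in> borel_measurable M"
    using insert by auto
  have "(\<integral>\<^sup>+x. (\<Prod>j\<in>insert k J. enn_powr (F j x) (1 / card (insert k J))) \<partial>M)
     = (\<integral>\<^sup>+x. enn_powr (F k x) (1 / (n + 1)) *
         enn_powr (\<Prod>j\<in>J. enn_powr (F j x) (1 / n)) (1 - 1 / (n + 1)) \<partial>M)"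
    unfolding card enn_powr_prod enn_powr_powr eq using insert by simp
  also have "\<dots> \<le> enn_powr (\<integral>\<^sup>+x. F k x \<partial>M) (1 / (n + 1)) *
      enn_powr (\<integral>\<^sup>+x. (\<Prod>j\<in>J. enn_powr (F j x) (1 / n)) \<partial>M) (1 - 1 / (n + 1))"
    using n by (intro Hoelder_nn_integral) auto
  also have "\<dots> \<le> enn_powr (\<integral>\<^sup>+x. F k x \<partial>M) (1 / (n + 1)) *
      enn_powr (\<Prod>j\<in>J. enn_powr (\<integral>\<^sup>+x. F j x \<partial>M) (1 / n)) (1 - 1 / (n + 1))"
    using insert n by (intro mult_left_mono enn_powr_mono) (auto simp: n_def)
  also have "\<dots> = (\<Prod>j\<in>insert k J. enn_powr (\<integral>\<^sup>+x. F j x \<partial>M) (1 / card (insert k J)))"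
    unfolding card enn_powr_prod enn_powr_powr eq using insert by simp
  finally show ?case .
qed

section \<open>Loomis-Whitney and reverse duality on finite products\<close>

context product_sigma_finite
begin

text \<open>Induction on the dimension. With the new coordinate \<open>y\<close> frozen, Hoelder in
  the old coordinates separates \<open>f k\<close>, which does not see \<open>y\<close>, from the
  slices of the other functions, and these obey the inequality one dimension lower. What remains is
  a product of \<open>n\<close> functions of \<open>y\<close> with exponents \<open>1 / n\<close>,
  the case of \<open>Hoelder_nn_integral_prod\<close>.\<close>

lemma Loomis_Whitney:
  assumes "finite I" "2 \<le> card I"
    and "\<And>i. i \<in> I \<Longrightarrow> f i \<in> borel_measurable (Pi\<^sub>M (I - {i}) M)"
  shows "(\<integral>\<^sup>+h. (\<Prod>i\<in>I. enn_powr (f i (restrict h (I - {i}))) (1 / (card I - 1))) \<partial>Pi\<^sub>M I M)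
    \<le> (\<Prod>i\<in>I. enn_powr (\<integral>\<^sup>+h. f i h \<partial>Pi\<^sub>M (I - {i}) M) (1 / (card I - 1)))"
  using assms
proof (induction I arbitrary: f rule: finite_induct)
  case empty
  then show ?case by simp
next
  case (insert k I)
  define n where "n = card I"
  have n: "1 \<le> n" "card (insert k I) - 1 = n" "I \<noteq> {}"
    using insert by (auto simp: n_def)
  have [simp]: "insert k I - {k} = I" using insert by auto
  have diff: "insert k I - {i} = insert k (I - {i})" if "i \<in> I" for i
    using insert that by auto
  have fk [measurable]: "f k \<in> borel_measurable (Pi\<^sub>M I M)"
    using insert.prems(2)[of k] by simp
  have fi [measurable]: "f i \<in> borel_measurable (Pi\<^sub>M (insert k (I - {i})) M)" if "i \<in> I" for i
    using insert.prems(2)[of i] that diff by auto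
  have fi' [measurable]: "(\<lambda>h. f i (h(k := y))) \<in> borel_measurable (Pi\<^sub>M (I - {i}) M)"
    if "i \<in> I" "y \<in> space (M k)" for i y
  proof -
    have "(\<lambda>h. h(k := y)) \<in> Pi\<^sub>M (I - {i}) M \<rightarrow>\<^sub>M Pi\<^sub>M (insert k (I - {i})) M"
      using that by (intro measurable_fun_upd[where J = "I - {i}"]) auto
    then show ?thesis using fi[OF that(1)] by (rule measurable_compose)
  qed
  have fi2 [measurable]: "(\<lambda>(y, h). f i (h(k := y))) \<in> borel_measurable (M k \<Otimes>\<^sub>M Pi\<^sub>M (I - {i}) M)"
    if "i \<in> I" for i
  proof -
    have "(\<lambda>yh. (snd yh)(k := fst yh)) \<in> M k \<Otimes>\<^sub>M Pi\<^sub>M (I - {i}) M \<rightarrow>\<^sub>M Pi\<^sub>M (insert k (I - {i})) M"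
      by (intro measurable_fun_upd[where J = "I - {i}"]) auto
    from measurable_compose[OF this fi[OF that]] show ?thesis by (simp add: case_prod_unfold)
  qed
  let ?G = "\<lambda>i y. \<integral>\<^sup>+h. f i (h(k := y)) \<partial>Pi\<^sub>M (I - {i}) M"
  have G: "?G i \<in> borel_measurable (M k)" if "i \<in> I" for i
  proof -
    interpret s: sigma_finite_measure "Pi\<^sub>M (I - {i}) M"
      using insert by (intro sigma_finite) auto
    show ?thesis using fi2[OF that] by (rule s.borel_measurable_nn_integral)
  qed
  have rm: "(\<lambda>h. restrict h (I - {i})) \<in> Pi\<^sub>M I M \<rightarrow>\<^sub>M Pi\<^sub>M (I - {i}) M" for i
    by (intro measurable_restrict_subset) auto
  have inner: "(\<integral>\<^sup>+h. enn_powr (f k h) (1 / n) *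
        (\<Prod>i\<in>I. enn_powr (f i ((restrict h (I - {i}))(k := y))) (1 / n)) \<partial>Pi\<^sub>M I M)
     \<le> enn_powr (\<integral>\<^sup>+h. f k h \<partial>Pi\<^sub>M I M) (1 / n) * (\<Prod>i\<in>I. enn_powr (?G i y) (1 / n))"
    if y: "y \<in> space (M k)" for y
  \<comment> \<open>The induction hypothesis starts at two coordinates. For a single old coordinate
    both sides agree, since the other function is then integrated over the empty product.\<close>
  proof (cases "n = 1")
    case True
    then obtain j where "I = {j}" by (auto simp: n_def card_1_singleton_iff)
    then show ?thesis
      using True fk by (simp add: nn_integral_multc nn_integral_empty restrict_def)
  next
    case False
    then have n2: "2 \<le> n" using n by simp
    have eq: "1 / real (n - 1) * (1 - 1 / real n) = 1 / real n"
      using n2 by (simp add: field_simps of_nat_diff)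
    have m [measurable]: "(\<lambda>h. f i ((restrict h (I - {i}))(k := y))) \<in> borel_measurable (Pi\<^sub>M I M)"
      if "i \<in> I" for i
      using measurable_compose[OF rm fi'[OF that y]] .
    have "(\<integral>\<^sup>+h. enn_powr (f k h) (1 / n) *
        (\<Prod>i\<in>I. enn_powr (f i ((restrict h (I - {i}))(k := y))) (1 / n)) \<partial>Pi\<^sub>M I M)
      = (\<integral>\<^sup>+h. enn_powr (f k h) (1 / n) *
        enn_powr (\<Prod>i\<in>I. enn_powr (f i ((restrict h (I - {i}))(k := y))) (1 / real (n - 1))) (1 - 1 / n) \<partial>Pi\<^sub>M I M)"
      by (simp only: enn_powr_prod enn_powr_powr eq)
    also have "\<dots> \<le> enn_powr (\<integral>\<^sup>+h. f k h \<partial>Pi\<^sub>M I M) (1 / n) * enn_powr (\<integral>\<^sup>+h. (\<Prod>i\<in>I.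
         enn_powr (f i ((restrict h (I - {i}))(k := y))) (1 / real (n - 1))) \<partial>Pi\<^sub>M I M) (1 - 1 / n)"
      using n2 by (intro Hoelder_nn_integral) auto
    also have "\<dots> \<le> enn_powr (\<integral>\<^sup>+h. f k h \<partial>Pi\<^sub>M I M) (1 / n) *
        enn_powr (\<Prod>i\<in>I. enn_powr (?G i y) (1 / real (n - 1))) (1 - 1 / n)"
      using n2 fi'[OF _ y]
      by (intro mult_left_mono enn_powr_mono insert.IH[where f = "\<lambda>i h. f i (h(k := y))", folded n_def]) auto
    also have "\<dots> = enn_powr (\<integral>\<^sup>+h. f k h \<partial>Pi\<^sub>M I M) (1 / n) * (\<Prod>i\<in>I. enn_powr (?G i y) (1 / n))"
      by (simp only: enn_powr_prod enn_powr_powr eq)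
    finally show ?thesis .
  qed
  have meas: "(\<lambda>h. \<Prod>i\<in>insert k I. enn_powr (f i (restrict h (insert k I - {i}))) (1 / n))
      \<in> borel_measurable (Pi\<^sub>M (insert k I) M)"
  proof (intro borel_measurable_prod_ennreal borel_measurable_enn_powr)
    fix i assume "i \<in> insert k I"
    from insert.prems(2)[OF this]
    show "(\<lambda>h. f i (restrict h (insert k I - {i}))) \<in> borel_measurable (Pi\<^sub>M (insert k I) M)"
      by (rule measurable_compose[rotated]) (intro measurable_restrict_subset, auto)
  qed
  have "(\<integral>\<^sup>+h. (\<Prod>i\<in>insert k I. enn_powr (f i (restrict h (insert k I - {i}))) (1 / n)) \<partial>Pi\<^sub>M (insert k I) M)
     = (\<integral>\<^sup>+y. (\<integral>\<^sup>+h. (\<Prod>i\<in>insert k I. enn_powr (f i (restrict (h(k := y)) (insert k I - {i}))) (1 / n))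
          \<partial>Pi\<^sub>M I M) \<partial>M k)"
    using insert.hyps meas by (intro product_nn_integral_insert_rev) auto
  also have "\<dots> = (\<integral>\<^sup>+y. (\<integral>\<^sup>+h. enn_powr (f k h) (1 / n) *
        (\<Prod>i\<in>I. enn_powr (f i ((restrict h (I - {i}))(k := y))) (1 / n)) \<partial>Pi\<^sub>M I M) \<partial>M k)"
  proof (intro nn_integral_cong)
    fix y h assume y: "y \<in> space (M k)" and h: "h \<in> space (Pi\<^sub>M I M)"
    have "restrict (h(k := y)) I = h"
      using h insert.hyps by (auto simp: space_PiM PiE_def extensional_def restrict_def fun_eq_iff)
    moreover have "restrict (h(k := y)) (insert k I - {i}) = (restrict h (I - {i}))(k := y)" if "i \<in> I" for i
      using that insert.hyps by (auto simp: restrict_def fun_eq_iff)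
    ultimately show "(\<Prod>i\<in>insert k I. enn_powr (f i (restrict (h(k := y)) (insert k I - {i}))) (1 / n))
        = enn_powr (f k h) (1 / n) * (\<Prod>i\<in>I. enn_powr (f i ((restrict h (I - {i}))(k := y))) (1 / n))"
      using insert.hyps by simp
  qed
  also have "\<dots> \<le> (\<integral>\<^sup>+y. enn_powr (\<integral>\<^sup>+h. f k h \<partial>Pi\<^sub>M I M) (1 / n) * (\<Prod>i\<in>I. enn_powr (?G i y) (1 / n)) \<partial>M k)"
    by (intro nn_integral_mono inner)
  also have "\<dots> = enn_powr (\<integral>\<^sup>+h. f k h \<partial>Pi\<^sub>M I M) (1 / n) * (\<integral>\<^sup>+y. (\<Prod>i\<in>I. enn_powr (?G i y) (1 / n)) \<partial>M k)"
    using G by (intro nn_integral_cmult) auto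
  also have "\<dots> \<le> enn_powr (\<integral>\<^sup>+h. f k h \<partial>Pi\<^sub>M I M) (1 / n) * (\<Prod>i\<in>I. enn_powr (\<integral>\<^sup>+y. ?G i y \<partial>M k) (1 / n))"
    using G insert.hyps n unfolding n_def by (intro mult_left_mono Hoelder_nn_integral_prod) auto
  also have "(\<Prod>i\<in>I. enn_powr (\<integral>\<^sup>+y. ?G i y \<partial>M k) (1 / n))
      = (\<Prod>i\<in>I. enn_powr (\<integral>\<^sup>+h. f i h \<partial>Pi\<^sub>M (insert k I - {i}) M) (1 / n))"
  proof (intro prod.cong refl arg_cong2[where f = enn_powr])
    fix i assume i: "i \<in> I"
    show "(\<integral>\<^sup>+y. ?G i y \<partial>M k) = (\<integral>\<^sup>+h. f i h \<partial>Pi\<^sub>M (insert k I - {i}) M)"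
      unfolding diff[OF i] using insert.hyps fi[OF i]
      by (intro product_nn_integral_insert_rev[symmetric]) auto
  qed
  finally show ?case
    using insert.hyps unfolding n(2) by simp
qed

lemma nn_integral_PiM_coordinate:
  assumes "finite I" "i \<in> I" "F \<in> borel_measurable (Pi\<^sub>M I M)"
  shows "(\<integral>\<^sup>+h. F h \<partial>Pi\<^sub>M I M) = (\<integral>\<^sup>+h. \<integral>\<^sup>+y. F (h(i := y)) \<partial>M i \<partial>Pi\<^sub>M (I - {i}) M)"
  using product_nn_integral_insert[of "I - {i}" i F] assms by (simp add: insert_absorb)

text \<open>For \<open>p < 1\<close> duality runs backwards: the \<open>L\<^sup>p\<close> quasi-norm of \<open>R\<close> is bounded by \<open>\<integral>R/W\<close> for any
  weight \<open>W\<close>. Here \<open>W\<close> is the product of the \<open>P\<^sub>i\<^sup>a\<close>, with \<open>a = 2 (1 - p) / (d - p)\<close> chosen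
  such that Hoelder (for \<open>\<integral>R/W\<close>) and Loomis-Whitney (for the weight) lead to the same integrals.\<close>

lemma nn_integral_powr_le_marginals:
  fixes p :: real
  defines "d \<equiv> \<lambda>I. real (card I)"
  assumes I: "finite I" "2 \<le> card I" and p: "0 < p" "p < 1"
    and R [measurable]: "R \<in> borel_measurable (Pi\<^sub>M I M)"
    and P: "\<And>i. i \<in> I \<Longrightarrow> P i \<in> borel_measurable (Pi\<^sub>M (I - {i}) M)"
    and le: "\<And>i h. i \<in> I \<Longrightarrow> h \<in> space (Pi\<^sub>M (I - {i}) M) \<Longrightarrow> (\<integral>\<^sup>+y. R (h(i := y)) \<partial>M i) \<le> (P i h)\<^sup>2"
    and s: "s = 2 * p * (d I - 1) / (d I - p)"
  shows "(\<integral>\<^sup>+h. enn_powr (R h) p \<partial>Pi\<^sub>M I M)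
    \<le> (\<Prod>i\<in>I. enn_powr (\<integral>\<^sup>+h. enn_powr (P i h) s \<partial>Pi\<^sub>M (I - {i}) M) ((d I - p) / (d I * (d I - 1))))"
proof -
  define e where "e = d I"
  define a where "a = 2 * (1 - p) / (e - p)"
  define P' where "P' = (\<lambda>i h. P i (restrict h (I - {i})))"
  define Z where "Z = (\<lambda>i. \<integral>\<^sup>+h. enn_powr (P i h) s \<partial>Pi\<^sub>M (I - {i}) M)"
  have e: "2 \<le> e" "real (card I) = e" "real (card I - 1) = e - 1"
    using I by (auto simp: e_def d_def of_nat_diff)
  have s_eq: "s = 2 * p * (e - 1) / (e - p)" "0 < s"
    using s p e by (auto simp: e_def)
  \<comment> \<open>Dividing the marginal bound \<open>(P i h)\<^sup>2\<close> by the weight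
    \<open>P\<^sub>i\<close> to the power \<open>a * e\<close> thus leaves exactly the power
    \<open>s\<close>.\<close>
  have ae: "2 = a * e + s"
  proof -
    have "a * e + s = 2 * ((1 - p) * e + p * (e - 1)) / (e - p)"
      by (simp add: a_def s_eq algebra_simps flip: add_divide_distrib)
    also have "(1 - p) * e + p * (e - 1) = e - p" by (simp add: algebra_simps)
    finally show ?thesis using p e by (simp add: divide_eq_eq)
  qed
  \<comment> \<open>The Loomis-Whitney integrand, raised to \<open>1 - p\<close>, thus cancels the
    weight that sits in the denominator raised to \<open>p\<close>.\<close>
  have sa: "s * (1 / (e - 1)) * (1 - p) = a * p"
  proof -
    have "s * (1 / (e - 1)) = 2 * p / (e - p)"
      using e by (simp add: s_eq)
    then show ?thesis by (simp add: a_def)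
  qed
  have P'm [measurable]: "P' i \<in> borel_measurable (Pi\<^sub>M I M)" if "i \<in> I" for i
    unfolding P'_def using P[OF that]
    by (rule measurable_compose[rotated]) (intro measurable_restrict_subset, auto)
  have upd: "P' i (h(i := y)) = P i h" if "h \<in> space (Pi\<^sub>M (I - {i}) M)" for i h y
  proof -
    have "restrict (h(i := y)) (I - {i}) = h"
      using that by (auto simp: space_PiM PiE_def extensional_def restrict_def fun_eq_iff)
    then show ?thesis by (simp add: P'_def)
  qed
  \<comment> \<open>A vanishing \<open>P i\<close> makes the integral of \<open>R\<close> along
    coordinate \<open>i\<close> vanish. This handles the points where \<open>R\<close> would be
    divided by 0.\<close>
  have AE0: "AE h in Pi\<^sub>M I M. P' i h = 0 \<longrightarrow> R h = 0" if i: "i \<in> I" for i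
  proof -
    have "(\<integral>\<^sup>+h. (if P' i h = 0 then R h else 0) \<partial>Pi\<^sub>M I M)
      = (\<integral>\<^sup>+h. \<integral>\<^sup>+y. (if P' i (h(i := y)) = 0 then R (h(i := y)) else 0) \<partial>M i \<partial>Pi\<^sub>M (I - {i}) M)"
      using i I P'm[OF i] by (intro nn_integral_PiM_coordinate) auto
    also have "\<dots> = (\<integral>\<^sup>+h. (if P i h = 0 then \<integral>\<^sup>+y. R (h(i := y)) \<partial>M i else 0) \<partial>Pi\<^sub>M (I - {i}) M)"
      by (intro nn_integral_cong) (simp add: upd)
    also have "\<dots> \<le> (\<integral>\<^sup>+h. 0 \<partial>Pi\<^sub>M (I - {i}) M)"
      using le[OF i] by (intro nn_integral_mono) (fastforce split: if_splits)
    finally have "(\<integral>\<^sup>+h. (if P' i h = 0 then R h else 0) \<partial>Pi\<^sub>M I M) = 0" by simp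
    then have "AE h in Pi\<^sub>M I M. (if P' i h = 0 then R h else 0) = 0"
      using P'm[OF i] by (subst (asm) nn_integral_0_iff_AE) auto
    then show ?thesis by (auto elim: eventually_mono)
  qed
  \<comment> \<open>A null set of the product without coordinate \<open>i\<close> has a null
    cylinder, even when the whole measure in coordinate \<open>i\<close> is infinite.\<close>
  have AE_lift: "AE h in Pi\<^sub>M I M. P' i h \<in> A"
    if i: "i \<in> I" and A: "A \<in> sets borel" and ae: "AE h in Pi\<^sub>M (I - {i}) M. P i h \<in> A" for i A
  proof -
    note [measurable] = P[OF i] P'm[OF i] A
    have "(\<integral>\<^sup>+h. indicator (- A) (P' i h) \<partial>Pi\<^sub>M I M)
      = (\<integral>\<^sup>+h. \<integral>\<^sup>+y. indicator (- A) (P' i (h(i := y))) \<partial>M i \<partial>Pi\<^sub>M (I - {i}) M)"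
      using i I by (intro nn_integral_PiM_coordinate) auto
    also have "\<dots> = (\<integral>\<^sup>+h. indicator (- A) (P i h) * emeasure (M i) (space (M i)) \<partial>Pi\<^sub>M (I - {i}) M)"
      by (intro nn_integral_cong) (simp add: upd)
    also have "\<dots> = (\<integral>\<^sup>+h. 0 \<partial>Pi\<^sub>M (I - {i}) M)"
      using ae by (intro nn_integral_cong_AE) (auto elim!: eventually_mono simp: indicator_def)
    finally have "(\<integral>\<^sup>+h. indicator (- A) (P' i h) \<partial>Pi\<^sub>M I M) = 0" by simp
    then have "AE h in Pi\<^sub>M I M. indicator (- A) (P' i h) = (0::ennreal)"
      by (subst (asm) nn_integral_0_iff_AE) auto
    then show ?thesis by (rule eventually_mono) (auto simp: indicator_def split: if_splits)
  qed
  show ?thesis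
  proof (cases "\<exists>i\<in>I. Z i = 0")
    case True
    then obtain i where i: "i \<in> I" "Z i = 0" by blast
    then have "AE h in Pi\<^sub>M (I - {i}) M. P i h \<in> {0}"
      using P[OF i(1)] by (auto simp: Z_def nn_integral_0_iff_AE)
    from AE_lift[OF i(1) _ this] AE0[OF i(1)] have "AE h in Pi\<^sub>M I M. enn_powr (R h) p = 0"
      by auto
    then have "(\<integral>\<^sup>+h. enn_powr (R h) p \<partial>Pi\<^sub>M I M) = 0"
      by (subst nn_integral_0_iff_AE) auto
    then show ?thesis by simp
  next
    case nz: False
    show ?thesis
    proof (cases "\<exists>i\<in>I. Z i = \<infinity>")
      case True
      then obtain i where i: "i \<in> I" "Z i = \<infinity>" by blast
      have "(\<Prod>i\<in>I. enn_powr (Z i) ((e - p) / (e * (e - 1)))) = \<infinity>"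
        using i I nz by (subst prod.remove[of _ i]) (auto simp: ennreal_top_mult)
      then show ?thesis by (simp add: Z_def e_def)
    next
      case fin: False
      have "AE h in Pi\<^sub>M I M. P' i h \<in> {..<\<infinity>}" if i: "i \<in> I" for i
      proof (rule AE_lift[OF i])
        have "AE h in Pi\<^sub>M (I - {i}) M. enn_powr (P i h) s \<noteq> \<infinity>"
          using fin i P[OF i] by (intro nn_integral_PInf_AE) (auto simp: Z_def)
        then show "AE h in Pi\<^sub>M (I - {i}) M. P i h \<in> {..<\<infinity>}"
          by (auto elim!: eventually_mono simp: less_top[symmetric])
      qed simp
      then have AEfin: "AE h in Pi\<^sub>M I M. \<forall>i\<in>I. P' i h \<noteq> \<infinity> \<and> (P' i h = 0 \<longrightarrow> R h = 0)"
        using I AE0 by (intro AE_finite_allI) (auto simp: less_top[symmetric])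
      \<comment> \<open>\<open>?X\<close> is the geometric mean over \<open>i\<close> of the
        quotients \<open>?Q i\<close>, that is \<open>R\<close> divided by the full weight.
        \<open>?Y\<close> is the Loomis-Whitney integrand. Where all quotients make sense,
        \<open>R\<close> to the power \<open>p\<close> is \<open>?X\<close> to the power
        \<open>p\<close> times \<open>?Y\<close> to the power \<open>1 - p\<close>.\<close>
      let ?Q = "\<lambda>i h. R h / enn_powr (P' i h) (a * e)"
      let ?X = "\<lambda>h. \<Prod>i\<in>I. enn_powr (?Q i h) (1 / e)"
      let ?Y = "\<lambda>h. \<Prod>i\<in>I. enn_powr (enn_powr (P' i h) s) (1 / (e - 1))"
      have pt: "enn_powr (R h) p \<le> enn_powr (?X h) p * enn_powr (?Y h) (1 - p)"
        if h: "\<forall>i\<in>I. P' i h \<noteq> \<infinity> \<and> (P' i h = 0 \<longrightarrow> R h = 0)" for h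
      proof (cases "R h = 0")
        case False
        have "enn_powr (enn_powr (?Q i h) (1 / e)) p
            * enn_powr (enn_powr (enn_powr (P' i h) s) (1 / (e - 1))) (1 - p) = enn_powr (R h) (p / e)"
          if i: "i \<in> I" for i
        proof -
          let ?x = "enn_powr (P' i h) (a * e)"
          have x: "?x \<noteq> 0" "?x \<noteq> \<infinity>" using h i False by auto
          have "enn_powr (enn_powr (enn_powr (P' i h) s) (1 / (e - 1))) (1 - p) = enn_powr ?x (p / e)"
            unfolding enn_powr_powr sa using e by simp
          then have "enn_powr (enn_powr (?Q i h) (1 / e)) p
            * enn_powr (enn_powr (enn_powr (P' i h) s) (1 / (e - 1))) (1 - p)
            = enn_powr (?Q i h * ?x) (p / e)"
            by (simp add: enn_powr_powr enn_powr_mult)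
          also have "?Q i h * ?x = R h"
            using x by (simp add: ennreal_divide_times less_top[symmetric])
          finally show ?thesis .
        qed
        then have "enn_powr (?X h) p * enn_powr (?Y h) (1 - p) = (\<Prod>i\<in>I. enn_powr (R h) (p / e))"
          by (simp add: enn_powr_prod flip: prod.distrib)
        also have "\<dots> = enn_powr (enn_powr (R h) (p / e)) e"
          using I enn_powr_of_nat[of "card I"] by (simp add: e(2))
        also have "\<dots> = enn_powr (R h) p"
          using e by (simp add: enn_powr_powr)
        finally show ?thesis by simp
      qed simp
      have Q: "(\<integral>\<^sup>+h. ?Q i h \<partial>Pi\<^sub>M I M) \<le> Z i" if i: "i \<in> I" for i
      proof -
        note [measurable] = P'm[OF i]
        have "(\<integral>\<^sup>+h. ?Q i h \<partial>Pi\<^sub>M I M)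
          = (\<integral>\<^sup>+h. \<integral>\<^sup>+y. ?Q i (h(i := y)) \<partial>M i \<partial>Pi\<^sub>M (I - {i}) M)"
          using i I by (intro nn_integral_PiM_coordinate) auto
        also have "\<dots> \<le> Z i"
          unfolding Z_def
        proof (intro nn_integral_mono)
          fix h assume h: "h \<in> space (Pi\<^sub>M (I - {i}) M)"
          have [measurable]: "(\<lambda>y. R (h(i := y))) \<in> borel_measurable (M i)"
          proof -
            have "(\<lambda>y. h(i := y)) \<in> M i \<rightarrow>\<^sub>M Pi\<^sub>M I M"
              using h i by (intro measurable_fun_upd[where J = "I - {i}"]) auto
            from measurable_compose[OF this R] show ?thesis .
          qed
          let ?x = "P i h"
          have "(\<integral>\<^sup>+y. ?Q i (h(i := y)) \<partial>M i) = (\<integral>\<^sup>+y. R (h(i := y)) \<partial>M i) / enn_powr ?x (a * e)"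
            using h by (simp add: upd nn_integral_divide)
          also have "\<dots> \<le> ?x\<^sup>2 / enn_powr ?x (a * e)"
            by (intro divide_right_mono_ennreal le i h)
          also have "\<dots> \<le> enn_powr ?x s"
          \<comment> \<open>In the degenerate cases the bound survives because 0 / 0 is 0 in
            \<open>ennreal\<close> and because the right-hand side is infinite for infinite
            \<open>?x\<close>.\<close>
          proof (cases "?x = 0 \<or> ?x = \<infinity>")
            case False
            have "?x\<^sup>2 = enn_powr ?x s * enn_powr ?x (a * e)"
              unfolding enn_powr_2[symmetric] by (subst ae) (simp only: enn_powr_add mult.commute)
            with False show ?thesis
              by (simp add: ennreal_mult_divide_eq)
          qed auto
          finally show "(\<integral>\<^sup>+y. ?Q i (h(i := y)) \<partial>M i) \<le> enn_powr ?x s" .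
        qed
        finally show ?thesis .
      qed
      have Qm [measurable]: "?Q i \<in> borel_measurable (Pi\<^sub>M I M)" if "i \<in> I" for i
        using P'm[OF that] by measurable
      have "(\<integral>\<^sup>+h. enn_powr (R h) p \<partial>Pi\<^sub>M I M)
        \<le> (\<integral>\<^sup>+h. enn_powr (?X h) p * enn_powr (?Y h) (1 - p) \<partial>Pi\<^sub>M I M)"
        using AEfin by (intro nn_integral_mono_AE) (auto elim!: eventually_mono intro!: pt)
      also have "\<dots> \<le> enn_powr (\<integral>\<^sup>+h. ?X h \<partial>Pi\<^sub>M I M) p * enn_powr (\<integral>\<^sup>+h. ?Y h \<partial>Pi\<^sub>M I M) (1 - p)"
        using Qm P'm p by (intro Hoelder_nn_integral) auto
      also have "\<dots> \<le> enn_powr (\<Prod>i\<in>I. enn_powr (Z i) (1 / e)) p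
          * enn_powr (\<Prod>i\<in>I. enn_powr (Z i) (1 / (e - 1))) (1 - p)"
      proof (intro mult_mono enn_powr_mono)
        have "(\<integral>\<^sup>+h. ?X h \<partial>Pi\<^sub>M I M) \<le> (\<Prod>i\<in>I. enn_powr (\<integral>\<^sup>+h. ?Q i h \<partial>Pi\<^sub>M I M) (1 / e))"
          using Hoelder_nn_integral_prod[of I ?Q "Pi\<^sub>M I M"] I Qm unfolding e(2) by fastforce
        also have "\<dots> \<le> (\<Prod>i\<in>I. enn_powr (Z i) (1 / e))"
          using Q e by (intro prod_mono_ennreal enn_powr_mono) auto
        finally show "(\<integral>\<^sup>+h. ?X h \<partial>Pi\<^sub>M I M) \<le> (\<Prod>i\<in>I. enn_powr (Z i) (1 / e))" .
        show "(\<integral>\<^sup>+h. ?Y h \<partial>Pi\<^sub>M I M) \<le> (\<Prod>i\<in>I. enn_powr (Z i) (1 / (e - 1)))"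
          unfolding Z_def P'_def e(3)[symmetric]
          using I P by (intro Loomis_Whitney[where f = "\<lambda>i h. enn_powr (P i h) s"]) auto
      qed (use p in auto)
      also have "\<dots> = (\<Prod>i\<in>I. enn_powr (Z i) (1 / e * p + 1 / (e - 1) * (1 - p)))"
        by (simp only: enn_powr_prod enn_powr_powr enn_powr_add prod.distrib)
      also have "1 / e * p + 1 / (e - 1) * (1 - p) = (e - p) / (e * (e - 1))"
        using e by (simp add: field_simps)
      finally show ?thesis by (simp add: Z_def e_def)
    qed
  qed
qed

end

section \<open>Cube integrals and the inequality\<close>

text \<open>The measure-theoretic content of a Haar measure, free of topology. The whole inequality
  and the stability of Young's inequality live here; topology returns only to show that the subgroup
  found is open and compact.\<close>

locale invariant_measure_group = comm_group G for G (structure) +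
  fixes M :: "'a measure"
  assumes sigma_finite: "sigma_finite_measure M"
    and space_eq: "space M = carrier G"
    and mult_measurable: "(\<lambda>(x, y). x \<otimes> y) \<in> M \<Otimes>\<^sub>M M \<rightarrow>\<^sub>M M"
    and emeasure_coset: "x \<in> carrier G \<Longrightarrow> A \<in> sets M \<Longrightarrow> emeasure M (x <# A) = emeasure M A"

sublocale invariant_measure_group \<subseteq> sigma_finite_measure M
  by (rule sigma_finite)

sublocale invariant_measure_group \<subseteq> pair: pair_sigma_finite M M
  by (intro pair_sigma_finite.intro sigma_finite)

sublocale invariant_measure_group \<subseteq> prod: product_sigma_finite "\<lambda>_. M"
  by (intro product_sigma_finite.intro sigma_finite)

context invariant_measure_group
begin

lemma measurable_mult [measurable (raw)]:
  assumes "f \<in> N \<rightarrow>\<^sub>M M" "g \<in> N \<rightarrow>\<^sub>M M"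
  shows "(\<lambda>x. f x \<otimes> g x) \<in> N \<rightarrow>\<^sub>M M"
  using measurable_compose[OF measurable_Pair[OF assms] mult_measurable] by simp

lemma measurable_closed: "x \<in> carrier G \<Longrightarrow> (\<lambda>_. x) \<in> N \<rightarrow>\<^sub>M M"
  by (simp add: space_eq)

lemma measurable_pow [measurable (raw)]:
  assumes "f \<in> N \<rightarrow>\<^sub>M M"
  shows "(\<lambda>x. f x [^] (n::nat)) \<in> N \<rightarrow>\<^sub>M M"
  using assms by (induction n) (auto intro: measurable_mult measurable_closed)

lemma nn_integral_translate:
  assumes a: "a \<in> carrier G" and f [measurable]: "f \<in> borel_measurable M"
  shows "(\<integral>\<^sup>+x. f (a \<otimes> x) \<partial>M) = (\<integral>\<^sup>+x. f x \<partial>M)"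
proof -
  have m [measurable]: "(\<lambda>x. a \<otimes> x) \<in> M \<rightarrow>\<^sub>M M"
    using a by (intro measurable_mult measurable_closed) auto
  have "distr M M (\<lambda>x. a \<otimes> x) = M"
  proof (rule measure_eqI)
    fix A assume "A \<in> sets (distr M M ((\<otimes>) a))"
    then have A: "A \<in> sets M" by simp
    then have Ac: "A \<subseteq> carrier G" using sets.sets_into_space space_eq by auto
    have "(\<lambda>x. a \<otimes> x) -` A \<inter> space M = inv a <# A"
    proof (intro equalityI subsetI)
      fix x assume "x \<in> (\<lambda>x. a \<otimes> x) -` A \<inter> space M"
      then have "x = inv a \<otimes> (a \<otimes> x)" "a \<otimes> x \<in> A"
        using a by (auto simp: space_eq m_assoc[symmetric])
      then show "x \<in> inv a <# A" by (auto simp: l_coset_def)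
    next
      fix x assume "x \<in> inv a <# A"
      then show "x \<in> (\<lambda>x. a \<otimes> x) -` A \<inter> space M"
        using a Ac by (auto simp: l_coset_def space_eq m_assoc[symmetric] subset_eq)
    qed
    then show "emeasure (distr M M ((\<otimes>) a)) A = emeasure M A"
      using A a by (simp add: emeasure_distr emeasure_coset)
  qed simp
  then have "(\<integral>\<^sup>+x. f x \<partial>M) = (\<integral>\<^sup>+x. f x \<partial>distr M M (\<lambda>x. a \<otimes> x))" by simp
  also have "\<dots> = (\<integral>\<^sup>+x. f (a \<otimes> x) \<partial>M)" by (rule nn_integral_distr) auto
  finally show ?thesis ..
qed

lemma nn_integral_translate':
  assumes "a \<in> carrier G" "f \<in> borel_measurable M"
  shows "(\<integral>\<^sup>+x. f (x \<otimes> a) \<partial>M) = (\<integral>\<^sup>+x. f x \<partial>M)"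
proof -
  have "(\<integral>\<^sup>+x. f (x \<otimes> a) \<partial>M) = (\<integral>\<^sup>+x. f (a \<otimes> x) \<partial>M)"
    using assms by (intro nn_integral_cong) (simp add: space_eq m_comm)
  with nn_integral_translate[OF assms] show ?thesis by simp
qed

lemma nn_integral_swap:
  assumes "(\<lambda>(x, y). f x y) \<in> borel_measurable (M \<Otimes>\<^sub>M M)"
  shows "(\<integral>\<^sup>+y. \<integral>\<^sup>+x. f x y \<partial>M \<partial>M) = (\<integral>\<^sup>+x. \<integral>\<^sup>+y. f x y \<partial>M \<partial>M)"
  using pair.Fubini'[OF assms] .

text \<open>Fubini, then invariance in the inner integral over \<open>y\<close>. It yields both the
  squares that arise from integrating out a coordinate and the total mass of an
  autocorrelation.\<close>

lemma nn_integral_correlation: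
  assumes [measurable]: "\<Phi> \<in> borel_measurable M" "\<Psi> \<in> borel_measurable M"
  shows "(\<integral>\<^sup>+y. \<integral>\<^sup>+x. \<Phi> x * \<Psi> (x \<otimes> y) \<partial>M \<partial>M) = (\<integral>\<^sup>+x. \<Phi> x \<partial>M) * (\<integral>\<^sup>+x. \<Psi> x \<partial>M)"
proof -
  have "(\<integral>\<^sup>+y. \<integral>\<^sup>+x. \<Phi> x * \<Psi> (x \<otimes> y) \<partial>M \<partial>M) = (\<integral>\<^sup>+x. \<integral>\<^sup>+y. \<Phi> x * \<Psi> (x \<otimes> y) \<partial>M \<partial>M)"
    by (intro nn_integral_swap) measurable
  also have "\<dots> = (\<integral>\<^sup>+x. \<Phi> x * (\<integral>\<^sup>+x. \<Psi> x \<partial>M) \<partial>M)"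
  proof (intro nn_integral_cong)
    fix x assume x: "x \<in> space M"
    have [measurable]: "(\<lambda>y. \<Psi> (x \<otimes> y)) \<in> borel_measurable M"
      using x by (intro measurable_compose[OF _ assms(2)] measurable_mult measurable_closed) (auto simp: space_eq)
    show "(\<integral>\<^sup>+y. \<Phi> x * \<Psi> (x \<otimes> y) \<partial>M) = \<Phi> x * (\<integral>\<^sup>+x. \<Psi> x \<partial>M)"
      using x by (simp add: nn_integral_cmult nn_integral_translate space_eq)
  qed
  also have "\<dots> = (\<integral>\<^sup>+x. \<Phi> x \<partial>M) * (\<integral>\<^sup>+x. \<Psi> x \<partial>M)"
    by (simp add: nn_integral_multc)
  finally show ?thesis .
qed

text \<open>The index set is arbitrary rather than \<open>{..<d}\<close>, because the inductions
  remove any coordinate \<open>i\<close> and work over \<open>I - {i}\<close>.\<close>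

definition cube_integral :: "'i set \<Rightarrow> ('a \<Rightarrow> ennreal) \<Rightarrow> ('i \<Rightarrow> 'a) \<Rightarrow> ennreal" where
  "cube_integral I F h =
     (\<integral>\<^sup>+x. (\<Prod>\<omega>\<in>I \<rightarrow>\<^sub>E {0, 1::nat}. F (x \<otimes> (\<Otimes>i\<in>I. h i [^] \<omega> i))) \<partial>M)"

lemma measurable_finprod:
  assumes "finite J" "J \<subseteq> I"
  shows "(\<lambda>h. \<Otimes>i\<in>J. h i [^] (\<omega> i::nat)) \<in> Pi\<^sub>M I (\<lambda>_. M) \<rightarrow>\<^sub>M M"
  using assms
proof (induction J rule: finite_induct)
  case empty
  then show ?case by (simp add: measurable_closed)
next
  case (insert k J)
  have "(\<lambda>h. \<Otimes>i\<in>insert k J. h i [^] \<omega> i) \<in> Pi\<^sub>M I (\<lambda>_. M) \<rightarrow>\<^sub>M M \<longleftrightarrow>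
      (\<lambda>h. h k [^] \<omega> k \<otimes> (\<Otimes>i\<in>J. h i [^] \<omega> i)) \<in> Pi\<^sub>M I (\<lambda>_. M) \<rightarrow>\<^sub>M M"
  proof (intro measurable_cong)
    fix h assume "h \<in> space (Pi\<^sub>M I (\<lambda>_. M))"
    then have "h i \<in> carrier G" if "i \<in> insert k J" for i
      using that insert.prems by (auto simp: space_PiM space_eq PiE_def)
    then show "(\<Otimes>i\<in>insert k J. h i [^] \<omega> i) = h k [^] \<omega> k \<otimes> (\<Otimes>i\<in>J. h i [^] \<omega> i)"
      using insert.hyps by (intro finprod_insert) auto
  qed
  also have \<dots>
    using insert by (intro measurable_mult measurable_pow measurable_component_singleton) auto
  finally show ?case .
qed

lemma cube_integral_measurable [measurable]:
  assumes I: "finite I" and F [measurable]: "F \<in> borel_measurable M"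
  shows "cube_integral I F \<in> borel_measurable (Pi\<^sub>M I (\<lambda>_. M))"
proof -
  have [measurable]: "(\<lambda>h. \<Otimes>i\<in>I. h i [^] (\<omega> i::nat)) \<in> Pi\<^sub>M I (\<lambda>_. M) \<rightarrow>\<^sub>M M" for \<omega>
    using I by (intro measurable_finprod) auto
  show ?thesis
    unfolding cube_integral_def by measurable
qed

text \<open>The vertices with \<open>\<omega> k = 0\<close> and those with
  \<open>\<omega> k = 1\<close> form two parallel faces that differ by the shift \<open>y\<close>;
  multiplying corresponding vertices gives a cube integral of one dimension less.\<close>

lemma cube_integral_insert:
  assumes I: "finite I" "k \<notin> I" and h: "\<And>i. i \<in> I \<Longrightarrow> h i \<in> carrier G" and y: "y \<in> carrier G"
  shows "cube_integral (insert k I) F (h(k := y)) = cube_integral I (\<lambda>x. F x * F (x \<otimes> y)) h"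
  unfolding cube_integral_def
proof (intro nn_integral_cong)
  fix x assume "x \<in> space M"
  then have x: "x \<in> carrier G" by (simp add: space_eq)
  define c where "c = (\<lambda>\<omega>::_ \<Rightarrow> nat. \<Otimes>i\<in>I. h i [^] \<omega> i)"
  have c: "c \<omega> \<in> carrier G" for \<omega>
    unfolding c_def using h by (intro finprod_closed) auto
  have ins: "(\<Otimes>i\<in>insert k I. (h(k := y)) i [^] fun_upd \<omega> k n i) = y [^] n \<otimes> c \<omega>" for \<omega> and n :: nat
  proof -
    have "(\<Otimes>i\<in>insert k I. (h(k := y)) i [^] fun_upd \<omega> k n i)
      = (h(k := y)) k [^] fun_upd \<omega> k n k \<otimes> (\<Otimes>i\<in>I. (h(k := y)) i [^] fun_upd \<omega> k n i)"
      using I h y by (intro finprod_insert) auto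
    also have "(\<Otimes>i\<in>I. (h(k := y)) i [^] fun_upd \<omega> k n i) = c \<omega>"
      unfolding c_def using I h by (intro finprod_cong') auto
    finally show ?thesis by simp
  qed
  have "(\<Prod>\<omega>\<in>insert k I \<rightarrow>\<^sub>E {0, 1::nat}. F (x \<otimes> (\<Otimes>i\<in>insert k I. (h(k := y)) i [^] \<omega> i)))
    = (\<Prod>(n, \<omega>)\<in>{0, 1::nat} \<times> (I \<rightarrow>\<^sub>E {0, 1::nat}). F (x \<otimes> (y [^] n \<otimes> c \<omega>)))"
    unfolding PiE_insert_eq
    by (subst prod.reindex[OF inj_combinator[of k I "\<lambda>_. {0, 1::nat}", OF I(2)]])
      (simp only: o_def case_prod_unfold ins)
  also have "\<dots> = (\<Prod>n\<in>{0, 1::nat}. \<Prod>\<omega>\<in>I \<rightarrow>\<^sub>E {0, 1}. F (x \<otimes> (y [^] n \<otimes> c \<omega>)))"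
    by (subst prod.cartesian_product) simp
  also have "\<dots> = (\<Prod>\<omega>\<in>I \<rightarrow>\<^sub>E {0, 1::nat}. F (x \<otimes> c \<omega>)) * (\<Prod>\<omega>\<in>I \<rightarrow>\<^sub>E {0, 1::nat}. F (x \<otimes> (y \<otimes> c \<omega>)))"
    using c y by simp
  also have "\<dots> = (\<Prod>\<omega>\<in>I \<rightarrow>\<^sub>E {0, 1::nat}. F (x \<otimes> c \<omega>) * F (x \<otimes> c \<omega> \<otimes> y))"
    using c y x by (simp add: prod.distrib m_assoc m_comm[of y])
  finally show "(\<Prod>\<omega>\<in>insert k I \<rightarrow>\<^sub>E {0, 1::nat}. F (x \<otimes> (\<Otimes>i\<in>insert k I. (h(k := y)) i [^] \<omega> i)))
    = (\<Prod>\<omega>\<in>I \<rightarrow>\<^sub>E {0, 1::nat}. F (x \<otimes> (\<Otimes>i\<in>I. h i [^] \<omega> i)) * F (x \<otimes> (\<Otimes>i\<in>I. h i [^] \<omega> i) \<otimes> y))"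
    by (simp add: c_def)
qed

text \<open>As a function of \<open>y\<close> the cube integral is the autocorrelation of the face
  product \<open>\<Phi>\<close>, whose total mass is the square of the integral of
  \<open>\<Phi>\<close>.\<close>

lemma nn_integral_cube_integral:
  fixes I :: "'i set"
  assumes I: "finite I" "k \<notin> I" and h: "\<And>i. i \<in> I \<Longrightarrow> h i \<in> carrier G"
    and F [measurable]: "F \<in> borel_measurable M"
  shows "(\<integral>\<^sup>+y. cube_integral (insert k I) F (h(k := y)) \<partial>M) = (cube_integral I F h)\<^sup>2"
proof -
  define \<Phi> where "\<Phi> = (\<lambda>x. \<Prod>\<omega>\<in>I \<rightarrow>\<^sub>E {0, 1::nat}. F (x \<otimes> (\<Otimes>i\<in>I. h i [^] \<omega> i)))"
  have c: "(\<Otimes>i\<in>I. h i [^] \<omega> i) \<in> carrier G" for \<omega> :: "'i \<Rightarrow> nat"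
    using h by (intro finprod_closed) auto
  have [measurable]: "(\<lambda>x. F (x \<otimes> (\<Otimes>i\<in>I. h i [^] \<omega> i))) \<in> borel_measurable M" for \<omega> :: "'i \<Rightarrow> nat"
    using c by (intro measurable_compose[OF _ F] measurable_mult measurable_closed) auto
  have \<Phi> [measurable]: "\<Phi> \<in> borel_measurable M"
    unfolding \<Phi>_def by measurable
  have "(\<integral>\<^sup>+y. cube_integral (insert k I) F (h(k := y)) \<partial>M) = (\<integral>\<^sup>+y. \<integral>\<^sup>+x. \<Phi> x * \<Phi> (x \<otimes> y) \<partial>M \<partial>M)"
  proof (intro nn_integral_cong)
    fix y assume "y \<in> space M"
    then have y: "y \<in> carrier G" by (simp add: space_eq)
    show "cube_integral (insert k I) F (h(k := y)) = (\<integral>\<^sup>+x. \<Phi> x * \<Phi> (x \<otimes> y) \<partial>M)"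
    proof -
      have "cube_integral (insert k I) F (h(k := y)) = cube_integral I (\<lambda>x. F x * F (x \<otimes> y)) h"
        using I h y by (intro cube_integral_insert) auto
      also have "\<dots> = (\<integral>\<^sup>+x. \<Phi> x * \<Phi> (x \<otimes> y) \<partial>M)"
        unfolding cube_integral_def \<Phi>_def prod.distrib[symmetric]
      proof (rule nn_integral_cong, rule prod.cong[OF refl])
        fix x and \<omega> :: "'i \<Rightarrow> nat" assume "x \<in> space M"
        then show "F (x \<otimes> (\<Otimes>i\<in>I. h i [^] \<omega> i)) * F (x \<otimes> (\<Otimes>i\<in>I. h i [^] \<omega> i) \<otimes> y)
          = F (x \<otimes> (\<Otimes>i\<in>I. h i [^] \<omega> i)) * F (x \<otimes> y \<otimes> (\<Otimes>i\<in>I. h i [^] \<omega> i))"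
          using c[of \<omega>] y by (simp add: space_eq m_assoc m_comm[of y])
      qed
      finally show ?thesis .
    qed
  qed
  also have "\<dots> = (cube_integral I F h)\<^sup>2"
    unfolding cube_integral_def \<Phi>_def[symmetric] power2_eq_square by (intro nn_integral_correlation \<Phi>)
  finally show ?thesis .
qed

section \<open>Young's inequality and the cube integral for \<open>p \<ge> 1\<close>\<close>

text \<open>With \<open>a = 2 * r / (r + 1)\<close> and \<open>u\<close> the power
  \<open>1 / a\<close> of \<open>g\<close>, this is the \<open>r\<close>-th power of the
  \<open>L\<^sup>r\<close> norm of the autocorrelation of \<open>u\<close>. Since
  \<open>2 / a = 1 + 1 / r\<close>, Young's inequality bounds it by the power \<open>r + 1\<close>
  of \<open>\<integral>g\<close>; writing it in terms of \<open>g\<close> turns the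
  \<open>L\<^sup>a\<close> norm of \<open>u\<close> into a plain integral.\<close>

definition young_integral :: "real \<Rightarrow> ('a \<Rightarrow> ennreal) \<Rightarrow> ennreal" where
  "young_integral r g = (\<integral>\<^sup>+y. enn_powr (\<integral>\<^sup>+x. enn_powr (g x * g (x \<otimes> y)) ((r + 1) / (2 * r)) \<partial>M) r \<partial>M)"

text \<open>Cauchy-Schwarz for the Bhattacharyya coefficient of \<open>g\<close> and its translate,
  which have equal integrals by invariance.\<close>

lemma affinity_le:
  assumes y: "y \<in> carrier G" and g [measurable]: "g \<in> borel_measurable M"
  shows "(\<integral>\<^sup>+x. enn_powr (g x * g (x \<otimes> y)) (1 / 2) \<partial>M) \<le> (\<integral>\<^sup>+x. g x \<partial>M)"
proof -
  have [measurable]: "(\<lambda>x. g (x \<otimes> y)) \<in> borel_measurable M"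
    using y by (intro measurable_compose[OF _ g] measurable_mult measurable_closed) auto
  have "(\<integral>\<^sup>+x. enn_powr (g x) (1 / 2) * enn_powr (g (x \<otimes> y)) (1 - 1 / 2) \<partial>M)
      \<le> enn_powr (\<integral>\<^sup>+x. g x \<partial>M) (1 / 2) * enn_powr (\<integral>\<^sup>+x. g (x \<otimes> y) \<partial>M) (1 - 1 / 2)"
    by (intro Hoelder_nn_integral) auto
  also have "\<dots> = (\<integral>\<^sup>+x. g x \<partial>M)"
    using y by (simp add: nn_integral_translate' flip: enn_powr_add)
  finally show ?thesis by (simp add: enn_powr_mult)
qed

text \<open>Interpolates the exponent \<open>(r + 1) / (2 * r)\<close> between 1 and 1/2. The first
  factor has a known integral over \<open>y\<close>, the second is bounded pointwise in
  \<open>y\<close>. Stability later exploits that the second must be nearly maximal wherever the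
  first has its mass.\<close>

lemma young_integral_le_affinity:
  assumes r: "1 < r" and g [measurable]: "g \<in> borel_measurable M"
  shows "young_integral r g \<le> (\<integral>\<^sup>+y. (\<integral>\<^sup>+x. g x * g (x \<otimes> y) \<partial>M) *
           enn_powr (\<integral>\<^sup>+x. enn_powr (g x * g (x \<otimes> y)) (1 / 2) \<partial>M) (r - 1) \<partial>M)"
  unfolding young_integral_def
proof (intro nn_integral_mono)
  fix y assume "y \<in> space M"
  then have [measurable]: "(\<lambda>x. g (x \<otimes> y)) \<in> borel_measurable M"
    by (intro measurable_compose[OF _ g] measurable_mult measurable_closed) (auto simp: space_eq)
  have e: "(r + 1) / (2 * r) = 1 / r + 1 / 2 * (1 - 1 / r)" "1 / r * r = 1" "(1 - 1 / r) * r = r - 1"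
    using r by (auto simp: field_simps)
  have "(\<integral>\<^sup>+x. enn_powr (g x * g (x \<otimes> y)) ((r + 1) / (2 * r)) \<partial>M)
    = (\<integral>\<^sup>+x. enn_powr (g x * g (x \<otimes> y)) (1 / r) *
        enn_powr (enn_powr (g x * g (x \<otimes> y)) (1 / 2)) (1 - 1 / r) \<partial>M)"
    unfolding e(1) enn_powr_add enn_powr_powr ..
  also have "\<dots> \<le> enn_powr (\<integral>\<^sup>+x. g x * g (x \<otimes> y) \<partial>M) (1 / r) *
      enn_powr (\<integral>\<^sup>+x. enn_powr (g x * g (x \<otimes> y)) (1 / 2) \<partial>M) (1 - 1 / r)"
    using r by (intro Hoelder_nn_integral) auto
  finally have "enn_powr (\<integral>\<^sup>+x. enn_powr (g x * g (x \<otimes> y)) ((r + 1) / (2 * r)) \<partial>M) r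
    \<le> enn_powr (enn_powr (\<integral>\<^sup>+x. g x * g (x \<otimes> y) \<partial>M) (1 / r) *
      enn_powr (\<integral>\<^sup>+x. enn_powr (g x * g (x \<otimes> y)) (1 / 2) \<partial>M) (1 - 1 / r)) r"
    using r by (intro enn_powr_mono) auto
  also have "\<dots> = (\<integral>\<^sup>+x. g x * g (x \<otimes> y) \<partial>M) *
      enn_powr (\<integral>\<^sup>+x. enn_powr (g x * g (x \<otimes> y)) (1 / 2) \<partial>M) (r - 1)"
    unfolding enn_powr_mult enn_powr_powr e(2,3) by simp
  finally show "enn_powr (\<integral>\<^sup>+x. enn_powr (g x * g (x \<otimes> y)) ((r + 1) / (2 * r)) \<partial>M) r \<le> \<dots>" .
qed

lemma young_integral_le:
  assumes r: "1 \<le> r" and g [measurable]: "g \<in> borel_measurable M"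
  shows "young_integral r g \<le> enn_powr (\<integral>\<^sup>+x. g x \<partial>M) (r + 1)"
proof (cases "r = 1")
  case True
  then have "young_integral r g = enn_powr (\<integral>\<^sup>+x. g x \<partial>M) (1 + 1)"
    unfolding enn_powr_add by (simp add: young_integral_def nn_integral_correlation)
  with True show ?thesis by simp
next
  case False
  with r have r: "1 < r" by simp
  have "young_integral r g \<le> (\<integral>\<^sup>+y. (\<integral>\<^sup>+x. g x * g (x \<otimes> y) \<partial>M) *
           enn_powr (\<integral>\<^sup>+x. enn_powr (g x * g (x \<otimes> y)) (1 / 2) \<partial>M) (r - 1) \<partial>M)"
    by (intro young_integral_le_affinity r g)
  also have "\<dots> \<le> (\<integral>\<^sup>+y. (\<integral>\<^sup>+x. g x * g (x \<otimes> y) \<partial>M) * enn_powr (\<integral>\<^sup>+x. g x \<partial>M) (r - 1) \<partial>M)"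
    using r by (intro nn_integral_mono, intro mult_left_mono enn_powr_mono affinity_le g) (auto simp: space_eq)
  also have "\<dots> = (\<integral>\<^sup>+y. (\<integral>\<^sup>+x. g x * g (x \<otimes> y) \<partial>M) \<partial>M) * enn_powr (\<integral>\<^sup>+x. g x \<partial>M) (r - 1)"
    by (intro nn_integral_multc) measurable
  also have "\<dots> = enn_powr (\<integral>\<^sup>+x. g x \<partial>M) (1 + 1 + (r - 1))"
    unfolding enn_powr_add by (simp add: nn_integral_correlation)
  finally show ?thesis by (simp add: add.commute)
qed

text \<open>For a fixed value \<open>y\<close> of coordinate \<open>k\<close> the cube integral is
  one of lower dimension for the function \<open>F x * F (x \<otimes> y)\<close>, so the bound
  assumed in that dimension applies for each \<open>y\<close>; its right-hand side is the integrand
  of the Young functional.\<close>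

lemma cube_integral_le_young_step:
  fixes I :: "'i set" and p :: real
  assumes I: "finite I" "k \<notin> I" and p: "1 \<le> p" and F [measurable]: "F \<in> borel_measurable M"
    and IH: "\<And>F. F \<in> borel_measurable M \<Longrightarrow>
      (\<integral>\<^sup>+h. enn_powr (cube_integral I F h) p \<partial>Pi\<^sub>M I (\<lambda>_. M))
        \<le> enn_powr (\<integral>\<^sup>+x. enn_powr (F x) (crit_exp (card I) p) \<partial>M) (card I + p)"
  shows "(\<integral>\<^sup>+h. enn_powr (cube_integral (insert k I) F h) p \<partial>Pi\<^sub>M (insert k I) (\<lambda>_. M))
    \<le> young_integral (card I + p) (\<lambda>x. enn_powr (F x) (crit_exp (card (insert k I)) p))"
proof -
  define r where "r = card I + p"
  \<comment> \<open>The critical exponents of consecutive dimensions differ by exactly the exponent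
    inside the Young functional.\<close>
  have e: "crit_exp (card (insert k I)) p * ((r + 1) / (2 * r)) = crit_exp (card I) p"
  proof -
    have "0 < r" "real (card (insert k I)) + p = r + 1" "2 ^ card (insert k I) = 2 * (2::real) ^ card I"
      using p I by (auto simp: r_def)
    then show ?thesis unfolding r_def[symmetric] by simp
  qed
  have "(\<integral>\<^sup>+h. enn_powr (cube_integral (insert k I) F h) p \<partial>Pi\<^sub>M (insert k I) (\<lambda>_. M))
    = (\<integral>\<^sup>+y. \<integral>\<^sup>+h. enn_powr (cube_integral (insert k I) F (h(k := y))) p \<partial>Pi\<^sub>M I (\<lambda>_. M) \<partial>M)"
    using I by (intro prod.product_nn_integral_insert_rev) auto
  also have "\<dots> = (\<integral>\<^sup>+y. \<integral>\<^sup>+h. enn_powr (cube_integral I (\<lambda>x. F x * F (x \<otimes> y)) h) p \<partial>Pi\<^sub>M I (\<lambda>_. M) \<partial>M)"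
    using I by (intro nn_integral_cong arg_cong2[where f = enn_powr] cube_integral_insert)
      (auto simp: space_eq space_PiM)
  also have "\<dots> \<le> (\<integral>\<^sup>+y. enn_powr (\<integral>\<^sup>+x. enn_powr (F x * F (x \<otimes> y)) (crit_exp (card I) p) \<partial>M) r \<partial>M)"
    unfolding r_def
  proof (intro nn_integral_mono IH)
    fix y assume "y \<in> space M"
    then have [measurable]: "(\<lambda>x. F (x \<otimes> y)) \<in> borel_measurable M"
      by (intro measurable_compose[OF _ F] measurable_mult measurable_closed) (auto simp: space_eq)
    show "(\<lambda>x. F x * F (x \<otimes> y)) \<in> borel_measurable M" by measurable
  qed
  also have "\<dots> = young_integral r (\<lambda>x. enn_powr (F x) (crit_exp (card (insert k I)) p))"
    unfolding young_integral_def enn_powr_mult[symmetric] enn_powr_powr e ..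
  finally show ?thesis by (simp add: r_def)
qed

text \<open>Starts at the empty index set, where the critical exponent is 1 and both sides are the
  \<open>p\<close>-th power of \<open>\<integral>F\<close>. The first Young step then has exponent
  \<open>r = p\<close>, which is where \<open>1 \<le> p\<close> is used.\<close>

lemma cube_integral_le_norm:
  fixes I :: "'i set" and p :: real
  assumes "finite I" "1 \<le> p" "F \<in> borel_measurable M"
  shows "(\<integral>\<^sup>+h. enn_powr (cube_integral I F h) p \<partial>Pi\<^sub>M I (\<lambda>_. M))
    \<le> enn_powr (\<integral>\<^sup>+x. enn_powr (F x) (crit_exp (card I) p) \<partial>M) (card I + p)"
  using assms(1,3)
proof (induction I arbitrary: F rule: finite_induct)
  case empty
  have "cube_integral ({} :: 'i set) F (\<lambda>_. undefined) = (\<integral>\<^sup>+x. F x \<partial>M)"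
    unfolding cube_integral_def by (intro nn_integral_cong) (simp add: space_eq)
  moreover have "(\<integral>\<^sup>+h. enn_powr (cube_integral ({} :: 'i set) F h) p \<partial>Pi\<^sub>M {} (\<lambda>_. M))
    = enn_powr (cube_integral ({} :: 'i set) F (\<lambda>_. undefined)) p"
    by (rule prod.nn_integral_empty) simp
  ultimately show ?case
    using assms(2) by simp
next
  case (insert k I)
  have "(\<integral>\<^sup>+h. enn_powr (cube_integral (insert k I) F h) p \<partial>Pi\<^sub>M (insert k I) (\<lambda>_. M))
    \<le> young_integral (card I + p) (\<lambda>x. enn_powr (F x) (crit_exp (card (insert k I)) p))"
    by (intro cube_integral_le_young_step insert.IH) (use insert assms(2) in auto)
  also have "\<dots> \<le> enn_powr (\<integral>\<^sup>+x. enn_powr (F x) (crit_exp (card (insert k I)) p) \<partial>M) (card I + p + 1)"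
    using insert assms(2) by (intro young_integral_le) auto
  finally show ?case using insert by (simp add: add_ac)
qed

end

text \<open>\<open>young_reduction d p r \<theta>\<close>: the \<open>L\<^sup>p\<close> norm of a \<open>d\<close>-dimensional cube integral is controlled by the
  Young functional with exponent \<open>r\<close>, raised to the power \<open>\<theta>\<close>. While \<open>p < 1\<close> the dimension is
  lowered with the critical exponent unchanged.\<close>

inductive young_reduction :: "nat \<Rightarrow> real \<Rightarrow> real \<Rightarrow> real \<Rightarrow> bool" where
  ge1: "1 \<le> d \<Longrightarrow> 1 \<le> p \<Longrightarrow> young_reduction d p (real d - 1 + p) 1"
| lt1: "1 \<le> d \<Longrightarrow> 0 < p \<Longrightarrow> p < 1 \<Longrightarrow> young_reduction d (2 * p * real d / (real d + 1 - p)) r \<theta> \<Longrightarrow>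
    young_reduction (Suc d) p r (\<theta> * ((real d + 1 - p) / real d))"

text \<open>The factor 2 in the new exponent makes up for the halved power of two, and
  \<open>e + s\<close> equals \<open>e * (e + 1 + p) / (e + 1 - p)\<close>.\<close>

lemma crit_exp_Suc:
  assumes "1 \<le> d" "0 < p" "p < 1"
  shows "crit_exp d (2 * p * real d / (real d + 1 - p)) = crit_exp (Suc d) p"
proof -
  define e where "e = real d"
  have e: "1 \<le> e" using assms by (simp add: e_def)
  have "e + 2 * p * e / (e + 1 - p) = e * (e + 1 + p) / (e + 1 - p)"
    using e assms by (simp add: field_simps)
  then have "2 ^ d * (2 * p * e / (e + 1 - p)) / (e + 2 * p * e / (e + 1 - p)) = 2 ^ Suc d * p / (e + 1 + p)"
    using e assms by simp
  then show ?thesis by (simp add: e_def add_ac)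
qed

text \<open>The equation for \<open>\<theta>\<close> is homogeneity: the Young functional has degree
  \<open>r + 1\<close> in \<open>g\<close>, and the \<open>p\<close>-th power integral of the cube
  integral must be compared with degree \<open>d + p\<close>.\<close>

lemma young_reduction_props:
  assumes "young_reduction d p r \<theta>"
  shows "1 \<le> r \<and> 1 \<le> \<theta> \<and> \<theta> * (r + 1) = d + p \<and> 0 < p"
  using assms
proof induction
  case (lt1 d p r \<theta>)
  define e where "e = real d"
  have e: "1 \<le> e" "0 < p" "p < 1" using lt1 by (auto simp: e_def)
  have IH: "1 \<le> r" "1 \<le> \<theta>" "\<theta> * (r + 1) = e + 2 * p * e / (e + 1 - p)"
    using lt1 by (auto simp: e_def)
  have "1 \<le> (e + 1 - p) / e" using e by (simp add: field_simps)
  then have "1 * 1 \<le> \<theta> * ((e + 1 - p) / e)" using IH by (intro mult_mono) auto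
  have "\<theta> * ((e + 1 - p) / e) * (r + 1) = (\<theta> * (r + 1)) * ((e + 1 - p) / e)" by simp
  moreover have "e + 2 * p * e / (e + 1 - p) = e * (e + 1 + p) / (e + 1 - p)"
    using e by (simp add: field_simps)
  ultimately have "\<theta> * ((e + 1 - p) / e) * (r + 1) = e + 1 + p"
    using e IH by simp
  with \<open>1 * 1 \<le> \<theta> * ((e + 1 - p) / e)\<close> show ?case
    using IH lt1 by (simp add: e_def add_ac)
qed auto

text \<open>The critical exponent is constant along the descent, and in dimension 1 it is
  \<open>2 * p / (1 + p)\<close>, so the descent meets an exponent of at least 1 no later than
  there. The value \<open>r = 1\<close> occurs only for \<open>d = p = 1\<close>, where the critical
  exponent is 1.\<close>

lemma young_reduction_exists:
  assumes "1 \<le> d" "0 < p" "1 \<le> crit_exp d p"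
  shows "\<exists>r \<theta>. young_reduction d p r \<theta> \<and> (1 < crit_exp d p \<longrightarrow> 1 < r)"
  using assms
proof (induction d arbitrary: p rule: nat_induct_at_least)
  case base
  then have "1 \<le> p" by (simp add: field_simps)
  then have "young_reduction 1 p (real 1 - 1 + p) 1" by (intro ge1) auto
  moreover have "1 < p" if "1 < crit_exp 1 p" using that base by (simp add: field_simps)
  ultimately show ?case by force
next
  case (Suc d)
  show ?case
  proof (cases "1 \<le> p")
    case True
    then have "young_reduction (Suc d) p (real (Suc d) - 1 + p) 1" by (intro ge1) auto
    moreover have "1 < real (Suc d) - 1 + p" using True Suc by simp
    ultimately show ?thesis by blast
  next
    case False
    define s where "s = 2 * p * real d / (real d + 1 - p)"
    have "crit_exp d s = crit_exp (Suc d) p"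
      unfolding s_def using False Suc by (intro crit_exp_Suc) auto
    moreover have "0 < s"
      unfolding s_def using False Suc by (intro divide_pos_pos mult_pos_pos) auto
    ultimately
    obtain r \<theta> where
      "young_reduction d s r \<theta>" "1 < crit_exp (Suc d) p \<longrightarrow> 1 < r"
      using Suc.IH[of s] Suc.prems by auto
    with lt1[of d p r \<theta>] False Suc show ?thesis by (auto simp: s_def)
  qed
qed

text \<open>Follows the derivation of \<open>young_reduction\<close>. The last coordinate is sliced
  but Young's inequality is not applied to it, so near-equality can later be read off from the Young
  functional.\<close>

lemma (in invariant_measure_group) cube_integral_le_young:
  fixes I :: "'i set"
  assumes "young_reduction d p r \<theta>" "finite I" "card I = d" "F \<in> borel_measurable M"
  shows "(\<integral>\<^sup>+h. enn_powr (cube_integral I F h) p \<partial>Pi\<^sub>M I (\<lambda>_. M))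
    \<le> enn_powr (young_integral r (\<lambda>x. enn_powr (F x) (crit_exp d p))) \<theta>"
  using assms
proof (induction arbitrary: I)
  case (ge1 d p)
  then obtain k where k: "k \<in> I" by fastforce
  then have I: "I = insert k (I - {k})" "finite (I - {k})" "card (I - {k}) = d - 1"
    using ge1 by auto
  have "(\<integral>\<^sup>+h. enn_powr (cube_integral (insert k (I - {k})) F h) p \<partial>Pi\<^sub>M (insert k (I - {k})) (\<lambda>_. M))
    \<le> young_integral (card (I - {k}) + p) (\<lambda>x. enn_powr (F x) (crit_exp (card (insert k (I - {k}))) p))"
    using ge1 I(2) by (intro cube_integral_le_young_step cube_integral_le_norm) auto
  then show ?case
    using ge1 I by (simp add: of_nat_diff insert_absorb k)
next
  case (lt1 d p r \<theta>)
  define s where "s = 2 * p * real d / (real d + 1 - p)"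
  define Z where "Z = young_integral r (\<lambda>x. enn_powr (F x) (crit_exp (Suc d) p))"
  have q: "crit_exp d s = crit_exp (Suc d) p"
    unfolding s_def using lt1 by (intro crit_exp_Suc) auto
  have "(\<integral>\<^sup>+h. enn_powr (cube_integral I F h) p \<partial>Pi\<^sub>M I (\<lambda>_. M))
    \<le> (\<Prod>i\<in>I. enn_powr (\<integral>\<^sup>+h. enn_powr (cube_integral (I - {i}) F h) s \<partial>Pi\<^sub>M (I - {i}) (\<lambda>_. M))
        ((real (card I) - p) / (real (card I) * (real (card I) - 1))))"
  proof (rule prod.nn_integral_powr_le_marginals)
    fix i and h :: "'i \<Rightarrow> 'a" assume i: "i \<in> I" and h: "h \<in> space (Pi\<^sub>M (I - {i}) (\<lambda>_. M))"
    have "(\<integral>\<^sup>+y. cube_integral (insert i (I - {i})) F (h(i := y)) \<partial>M) = (cube_integral (I - {i}) F h)\<^sup>2"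
      using lt1 h by (intro nn_integral_cube_integral) (auto simp: space_PiM space_eq)
    then show "(\<integral>\<^sup>+y. cube_integral I F (h(i := y)) \<partial>M) \<le> (cube_integral (I - {i}) F h)\<^sup>2"
      using i by (simp add: insert_absorb)
  qed (use lt1 in \<open>auto simp: s_def\<close>)
  also have "\<dots> \<le> (\<Prod>i\<in>I. enn_powr (enn_powr Z \<theta>) ((real (card I) - p) / (real (card I) * (real (card I) - 1))))"
    using lt1.IH[folded s_def, unfolded q] lt1 by (intro prod_mono_ennreal enn_powr_mono) (auto simp: Z_def)
  \<comment> \<open>All \<open>d + 1\<close> marginals have the same bound, so their exponents add
    up.\<close>
  also have "\<dots> = enn_powr Z (\<theta> * ((real d + 1 - p) / (real (Suc d) * real d)) * real (Suc d))"
    using lt1 by (simp only: prod_constant enn_powr_of_nat[symmetric] zero_less_Suc enn_powr_powr)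
      (simp add: add_ac)
  also have "\<theta> * ((real d + 1 - p) / (real (Suc d) * real d)) * real (Suc d) = \<theta> * ((real d + 1 - p) / real d)"
    by simp
  finally show ?case by (simp add: Z_def)
qed

section \<open>Stability of Young's inequality\<close>

lemma ennreal_abs_diff_le:
  assumes "0 \<le> a" "0 \<le> b" "ennreal a \<le> ennreal b + c" "ennreal b \<le> ennreal a + c"
  shows "ennreal \<bar>a - b\<bar> \<le> c"
  using assms by (cases c) (auto simp flip: ennreal_plus simp: abs_if)

context invariant_measure_group
begin

lemma measurable_shift:
  assumes "f \<in> M \<rightarrow>\<^sub>M N" "a \<in> carrier G"
  shows "(\<lambda>x. f (x \<otimes> a)) \<in> M \<rightarrow>\<^sub>M N" "(\<lambda>x. f (a \<otimes> x)) \<in> M \<rightarrow>\<^sub>M N"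
  using assms(2) by (auto intro!: measurable_compose[OF _ assms(1)] measurable_mult measurable_closed)

lemma l_coset_mem_iff:
  assumes "a \<in> carrier G" "x \<in> carrier G" "A \<subseteq> carrier G"
  shows "a \<otimes> x \<in> a <# A \<longleftrightarrow> x \<in> A"
  using assms by (auto simp: l_coset_def subset_eq)

lemma l_coset_sets [measurable (raw)]:
  assumes a: "a \<in> carrier G" and A: "A \<in> sets M"
  shows "a <# A \<in> sets M"
proof -
  have Ac: "A \<subseteq> carrier G" using sets.sets_into_space[OF A] by (simp add: space_eq)
  have "x \<in> a <# A \<longleftrightarrow> x \<in> carrier G \<and> inv a \<otimes> x \<in> A" for x
  proof
    assume "x \<in> a <# A"
    then show "x \<in> carrier G \<and> inv a \<otimes> x \<in> A"
      using a Ac by (auto simp: l_coset_def m_assoc[symmetric] subset_eq)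
  next
    assume "x \<in> carrier G \<and> inv a \<otimes> x \<in> A"
    then show "x \<in> a <# A"
      using a Ac l_coset_mem_iff[of a "inv a \<otimes> x" A] by (simp add: m_assoc[symmetric])
  qed
  then have "a <# A = {x\<in>space M. inv a \<otimes> x \<in> A}" by (auto simp: space_eq)
  moreover have "(\<lambda>x. inv a \<otimes> x) \<in> M \<rightarrow>\<^sub>M M"
    using a by (intro measurable_mult measurable_closed) auto
  ultimately show ?thesis using A by (auto intro: measurable_sets_Collect)
qed

text \<open>A length function on the group: it vanishes at the identity, is symmetric and
  subadditive, by invariance of the measure.\<close>

definition shift_dist :: "('a \<Rightarrow> real) \<Rightarrow> 'a \<Rightarrow> ennreal" where
  "shift_dist g y = (\<integral>\<^sup>+x. ennreal \<bar>g x - g (x \<otimes> y)\<bar> \<partial>M)"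

lemma shift_dist_measurable [measurable]:
  assumes [measurable]: "g \<in> borel_measurable M"
  shows "shift_dist g \<in> borel_measurable M"
  unfolding shift_dist_def by measurable

lemma shift_dist_mult:
  assumes y: "y \<in> carrier G" and z: "z \<in> carrier G" and g [measurable]: "g \<in> borel_measurable M"
  shows "shift_dist g (y \<otimes> z) \<le> shift_dist g y + shift_dist g z"
proof -
  note [measurable] = measurable_shift[OF g y] measurable_shift[OF g z]
    measurable_shift[OF g m_closed[OF y z]]
  have "shift_dist g (y \<otimes> z)
    \<le> (\<integral>\<^sup>+x. ennreal \<bar>g x - g (x \<otimes> y)\<bar> + ennreal \<bar>g (x \<otimes> y) - g (x \<otimes> (y \<otimes> z))\<bar> \<partial>M)"
    unfolding shift_dist_def
    by (intro nn_integral_mono) (auto simp flip: ennreal_plus intro!: ennreal_leI)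
  also have "\<dots> = shift_dist g y + (\<integral>\<^sup>+x. ennreal \<bar>g (x \<otimes> y) - g (x \<otimes> (y \<otimes> z))\<bar> \<partial>M)"
    unfolding shift_dist_def by (intro nn_integral_add) measurable
  also have "(\<integral>\<^sup>+x. ennreal \<bar>g (x \<otimes> y) - g (x \<otimes> (y \<otimes> z))\<bar> \<partial>M)
    = (\<integral>\<^sup>+x. ennreal \<bar>g (x \<otimes> y) - g (x \<otimes> y \<otimes> z)\<bar> \<partial>M)"
    using y z by (intro nn_integral_cong) (simp add: space_eq m_assoc)
  also have "\<dots> = shift_dist g z"
    unfolding shift_dist_def by (rule nn_integral_translate'[OF y, of "\<lambda>x. ennreal \<bar>g x - g (x \<otimes> z)\<bar>"]) measurable
  finally show ?thesis .
qed

lemma shift_dist_inv: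
  assumes y: "y \<in> carrier G" and g [measurable]: "g \<in> borel_measurable M"
  shows "shift_dist g (inv y) = shift_dist g y"
proof -
  have [measurable]: "(\<lambda>x. g (x \<otimes> inv y)) \<in> borel_measurable M"
    using y g by (intro measurable_shift) auto
  have "shift_dist g (inv y) = (\<integral>\<^sup>+x. ennreal \<bar>g (x \<otimes> y) - g (x \<otimes> y \<otimes> inv y)\<bar> \<partial>M)"
    unfolding shift_dist_def
    by (rule nn_integral_translate'[OF y, of "\<lambda>x. ennreal \<bar>g x - g (x \<otimes> inv y)\<bar>", symmetric]) measurable
  also have "\<dots> = shift_dist g y"
    unfolding shift_dist_def using y
    by (intro nn_integral_cong) (simp add: space_eq m_assoc abs_minus_commute)
  finally show ?thesis .
qed

lemma shift_dist_one [simp]: "shift_dist g \<one> = 0"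
proof -
  have "shift_dist g \<one> = (\<integral>\<^sup>+x. 0 \<partial>M)"
    unfolding shift_dist_def by (intro nn_integral_cong) (simp add: space_eq)
  then show ?thesis by simp
qed

text \<open>The dichotomy behind the construction: an almost invariant set \<open>S\<close> carries almost all of the
  mass of \<open>g\<close>, so a translate at distance below \<open>1 - 2 \<eta>\<close> makes \<open>S\<close> meet its shift, which forces
  the distance to be at most \<open>2 \<eta>\<close>. Hence the elements of distance at most \<open>2 \<eta>\<close> form a subgroup.\<close>

lemma almost_invariant_density:
  fixes g :: "'a \<Rightarrow> real"
  assumes g [measurable]: "g \<in> borel_measurable M" and g0: "\<And>x. 0 \<le> g x"
    and g1: "(\<integral>\<^sup>+x. ennreal (g x) \<partial>M) = 1"
    and small: "(\<integral>\<^sup>+y. ennreal (g y) * shift_dist g y \<partial>M) \<le> ennreal (\<eta>\<^sup>2)"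
    and \<eta>: "0 < \<eta>" "\<eta> < 1 / 6"
  shows "\<exists>H. subgroup H G \<and> H \<in> sets M \<and> emeasure M H \<noteq> 0 \<and> emeasure M H \<noteq> \<infinity> \<and>
    (\<integral>\<^sup>+x. ennreal \<bar>g x - indicator H x / measure M H\<bar> \<partial>M) \<le> ennreal (4 * \<eta>)"
proof -
  define D where "D = density M (\<lambda>x. ennreal (g x))"
  \<comment> \<open>With the hypothesis \<open>\<eta>\<^sup>2\<close>, Markov's inequality at
    threshold \<open>\<eta>\<close> leaves mass at most \<open>\<eta>\<close> outside
    \<open>S\<close>. The threshold \<open>2 * \<eta>\<close> of \<open>H\<close> is the length that
    a product of two elements of \<open>S\<close> can reach.\<close>
  define S where "S = {y\<in>space M. shift_dist g y \<le> ennreal \<eta>}"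
  define H where "H = {y\<in>space M. shift_dist g y \<le> ennreal (2 * \<eta>)}"
  have [measurable]: "S \<in> sets M" "H \<in> sets M"
    by (simp_all add: S_def H_def)
  have D: "emeasure D A = (\<integral>\<^sup>+x. ennreal (g x) * indicator A x \<partial>M)" if "A \<in> sets M" for A
    using that unfolding D_def by (intro emeasure_density) auto
  have D_space: "emeasure D (space M) = 1"
    using g1 by (simp add: D cong: nn_integral_cong)
  have D_compl: "emeasure D A + emeasure D (space M - A) = 1" if "A \<in> sets M" for A
    using that D_space sets.sets_into_space[OF that]
    by (subst plus_emeasure) (auto simp: D_def Un_absorb1)
  have DSc: "emeasure D (space M - S) \<le> ennreal \<eta>"
  proof -
    have "ennreal \<eta> * emeasure D (space M - S) = (\<integral>\<^sup>+x. ennreal \<eta> * (ennreal (g x) * indicator (space M - S) x) \<partial>M)"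
      by (simp add: D nn_integral_cmult)
    also have "\<dots> \<le> (\<integral>\<^sup>+x. ennreal (g x) * shift_dist g x \<partial>M)"
    proof (intro nn_integral_mono)
      fix x assume "x \<in> space M"
      then show "ennreal \<eta> * (ennreal (g x) * indicator (space M - S) x) \<le> ennreal (g x) * shift_dist g x"
        by (auto simp: indicator_def S_def mult.commute[of "ennreal \<eta>"] intro!: mult_left_mono)
    qed
    also have "\<dots> \<le> ennreal \<eta> * ennreal \<eta>"
      using small \<eta> by (simp add: power2_eq_square ennreal_mult)
    finally show ?thesis
      using \<eta> by (simp add: ennreal_mult_le_mult_iff)
  qed
  have DS: "ennreal (1 - \<eta>) \<le> emeasure D S"
  proof -
    have "ennreal (1 - \<eta>) + ennreal \<eta> \<le> emeasure D S + ennreal \<eta>"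
      using D_compl[of S] DSc \<eta> by (simp flip: ennreal_plus) (metis \<open>S \<in> sets M\<close> add_left_mono)
    then show ?thesis by (simp add: ennreal_add_left_cancel_le add.commute)
  qed
  have meets: "\<exists>x\<in>S. x \<otimes> y \<in> S" if y: "y \<in> carrier G" and lt: "shift_dist g y < ennreal (1 - 2 * \<eta>)" for y
  proof (rule ccontr)
    assume no: "\<not> (\<exists>x\<in>S. x \<otimes> y \<in> S)"
    note [measurable] = measurable_shift[OF g y]
    let ?f = "\<lambda>x. ennreal (g x) * indicator (space M - S) x"
    have [measurable]: "(\<lambda>x. ?f (x \<otimes> y)) \<in> borel_measurable M"
      using y by (intro measurable_shift[of ?f]) auto
    \<comment> \<open>If the shift by \<open>y\<close> moves all of \<open>S\<close> out of
      \<open>S\<close>, then on \<open>S\<close> the density is at most the pointwise difference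
      plus the density that sits outside \<open>S\<close> after the shift. So
      \<open>1 - \<eta>\<close> would be less than \<open>(1 - 2 * \<eta>) + \<eta>\<close>.\<close>
    have "emeasure D S \<le> (\<integral>\<^sup>+x. ennreal \<bar>g x - g (x \<otimes> y)\<bar> + ?f (x \<otimes> y) \<partial>M)"
      unfolding D[OF \<open>S \<in> sets M\<close>]
    proof (intro nn_integral_mono)
      fix x assume "x \<in> space M"
      then have "x \<otimes> y \<in> space M" using y by (simp add: space_eq)
      then show "ennreal (g x) * indicator S x \<le> ennreal \<bar>g x - g (x \<otimes> y)\<bar> + ?f (x \<otimes> y)"
        using no g0 by (auto simp: indicator_def simp flip: ennreal_plus intro!: ennreal_leI)
    qed
    also have "\<dots> = shift_dist g y + (\<integral>\<^sup>+x. ?f (x \<otimes> y) \<partial>M)"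
      unfolding shift_dist_def by (intro nn_integral_add) measurable
    also have "(\<integral>\<^sup>+x. ?f (x \<otimes> y) \<partial>M) = emeasure D (space M - S)"
      using y by (subst nn_integral_translate'[of _ ?f]) (auto simp: D)
    also have "shift_dist g y + emeasure D (space M - S) \<le> shift_dist g y + ennreal \<eta>"
      by (intro add_left_mono DSc)
    also have "\<dots> < ennreal (1 - 2 * \<eta>) + ennreal \<eta>"
      using lt by (simp add: ennreal_add_left_cancel_less add.commute)
    also have "\<dots> = ennreal (1 - \<eta>)" using \<eta> by (simp flip: ennreal_plus)
    finally show False using DS by simp
  qed
  have H_mult: "y \<otimes> z \<in> H" if "y \<in> H" "z \<in> H" for y z
  proof -
    have yz: "y \<in> carrier G" "z \<in> carrier G" using that by (auto simp: H_def space_eq)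
    have "shift_dist g (y \<otimes> z) \<le> shift_dist g y + shift_dist g z"
      using yz g by (rule shift_dist_mult)
    also have "\<dots> \<le> ennreal (2 * \<eta>) + ennreal (2 * \<eta>)"
      using that by (intro add_mono) (auto simp: H_def)
    \<comment> \<open>The inequality \<open>4 * \<eta> < 1 - 2 * \<eta>\<close> is the origin of the
      bound 1/6 on \<open>\<eta>\<close>.\<close>
    also have "\<dots> < ennreal (1 - 2 * \<eta>)"
      using \<eta> by (simp flip: ennreal_plus add: ennreal_less_iff)
    finally obtain x where x: "x \<in> S" "x \<otimes> (y \<otimes> z) \<in> S"
      using meets[of "y \<otimes> z"] yz by auto
    then have xc: "x \<in> carrier G" by (simp add: S_def space_eq)
    \<comment> \<open>The product is now a quotient of two elements of \<open>S\<close>, each of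
      length at most \<open>\<eta>\<close>, so its length drops from \<open>4 * \<eta>\<close> back
      to \<open>2 * \<eta>\<close>.\<close>
    have "y \<otimes> z = inv x \<otimes> (x \<otimes> (y \<otimes> z))"
      using xc yz by (simp add: m_assoc[symmetric])
    then have "shift_dist g (y \<otimes> z) \<le> shift_dist g (inv x) + shift_dist g (x \<otimes> (y \<otimes> z))"
      using shift_dist_mult[of "inv x" "x \<otimes> (y \<otimes> z)" g] xc yz g by simp
    also have "\<dots> \<le> ennreal \<eta> + ennreal \<eta>"
      using x xc by (intro add_mono) (auto simp: S_def shift_dist_inv)
    finally show ?thesis using yz \<eta> by (simp add: H_def space_eq flip: ennreal_plus)
  qed
  have sub: "subgroup H G"
    by (rule subgroupI) (use H_mult in \<open>auto simp: H_def space_eq shift_dist_inv intro!: exI[of _ \<one>]\<close>)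
  have DHc: "emeasure D (space M - H) \<le> ennreal \<eta>"
  proof -
    have "S \<subseteq> H" using \<eta> by (auto simp: S_def H_def intro: order_trans[OF _ ennreal_leI])
    then have "emeasure D (space M - H) \<le> emeasure D (space M - S)"
      by (intro emeasure_mono) (auto simp: D_def)
    with DSc show ?thesis by order
  qed
  have H_pos: "emeasure M H \<noteq> 0"
  proof
    assume "emeasure M H = 0"
    then have "emeasure D H = 0"
      unfolding D_def by (intro absolutely_continuousI_density[unfolded absolutely_continuous_def, THEN subsetD, THEN null_setsD1] null_setsI) auto
    then have "1 \<le> ennreal \<eta>"
      using D_compl[of H] DHc by simp
    then show False using \<eta> by (simp add: ennreal_le_1 flip: ennreal_1)
  qed
  \<comment> \<open>Take \<open>K\<close> of finite measure carrying more than half of the mass.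
    Translating \<open>g\<close> by an element of \<open>H\<close> costs at most
    \<open>2 * \<eta>\<close>, hence at most 1/3, so mass 1/6 stays on \<open>K\<close>. Integrating
    over \<open>H\<close> bounds a sixth of the measure of \<open>H\<close> by that of
    \<open>K\<close>.\<close>
  have H_fin: "emeasure M H \<noteq> \<infinity>"
  proof -
    obtain A :: "nat \<Rightarrow> 'a set" where A: "range A \<subseteq> sets M" "(\<Union>i. A i) = space M"
      "\<And>i. emeasure M (A i) \<noteq> \<infinity>" "incseq A"
      by (rule sigma_finite_incseq) blast
    have "(SUP i. emeasure D (A i)) = 1"
      using A D_space by (subst SUP_emeasure_incseq) (auto simp: D_def)
    moreover have "ennreal (1 / 2) < ennreal 1" by (rule ennreal_lessI) auto
    ultimately have "ennreal (1 / 2) < (SUP i. emeasure D (A i))" by simp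
    then obtain n where n: "ennreal (1 / 2) < emeasure D (A n)"
      by (auto simp: less_SUP_iff)
    define K where "K = A n"
    have K [measurable]: "K \<in> sets M" and Kfin: "emeasure M K \<noteq> \<infinity>" using A by (auto simp: K_def)
    have *: "ennreal (1 / 6) \<le> (\<integral>\<^sup>+x. ennreal (g (x \<otimes> y)) * indicator K x \<partial>M)" if y: "y \<in> H" for y
    proof -
      have yc: "y \<in> carrier G" using y by (simp add: H_def space_eq)
      note [measurable] = measurable_shift[OF g yc]
      have "ennreal (1 / 2) \<le> (\<integral>\<^sup>+x. ennreal (g x) * indicator K x \<partial>M)"
        using n by (simp add: K_def D[symmetric] K[unfolded K_def])
      also have "\<dots> \<le> (\<integral>\<^sup>+x. ennreal \<bar>g x - g (x \<otimes> y)\<bar> + ennreal (g (x \<otimes> y)) * indicator K x \<partial>M)"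
        using g0 by (intro nn_integral_mono) (auto simp: indicator_def simp flip: ennreal_plus intro!: ennreal_leI)
      also have "\<dots> = shift_dist g y + (\<integral>\<^sup>+x. ennreal (g (x \<otimes> y)) * indicator K x \<partial>M)"
        unfolding shift_dist_def by (intro nn_integral_add) measurable
      also have "\<dots> \<le> ennreal (1 / 3) + (\<integral>\<^sup>+x. ennreal (g (x \<otimes> y)) * indicator K x \<partial>M)"
        using y \<eta> by (intro add_right_mono) (auto simp: H_def intro: order_trans[OF _ ennreal_leI])
      finally have "ennreal (1 / 3) + ennreal (1 / 6) \<le> ennreal (1 / 3) + (\<integral>\<^sup>+x. ennreal (g (x \<otimes> y)) * indicator K x \<partial>M)"
        by (simp flip: ennreal_plus)
      then show ?thesis by (simp add: ennreal_add_left_cancel_le)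
    qed
    have "ennreal (1 / 6) * emeasure M H = (\<integral>\<^sup>+y. ennreal (1 / 6) * indicator H y \<partial>M)"
      by (simp add: nn_integral_cmult)
    also have "\<dots> \<le> (\<integral>\<^sup>+y. \<integral>\<^sup>+x. ennreal (g (x \<otimes> y)) * indicator K x \<partial>M \<partial>M)"
      using * by (intro nn_integral_mono) (auto simp: indicator_def)
    also have "\<dots> = (\<integral>\<^sup>+y. \<integral>\<^sup>+x. indicator K x * ennreal (g (x \<otimes> y)) \<partial>M \<partial>M)"
      by (simp add: mult.commute)
    also have "\<dots> = emeasure M K * 1"
      by (subst nn_integral_correlation[of "indicator K" "\<lambda>x. ennreal (g x)"]) (auto simp: g1)
    finally have "ennreal (1 / 6) * emeasure M H \<noteq> \<infinity>" using Kfin by (auto simp: top_unique)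
    then show ?thesis by (auto simp: ennreal_mult_eq_top_iff)
  qed
  define m where "m = measure M H"
  have m: "emeasure M H = ennreal m" "0 < m"
    using H_pos H_fin by (auto simp: m_def emeasure_eq_ennreal_measure zero_less_measure_iff top.not_eq_extremum)
  define J where "J = (\<lambda>x. \<integral>\<^sup>+y. ennreal \<bar>g x - g (x \<otimes> y)\<bar> * indicator H y \<partial>M)"
  have J [measurable]: "J \<in> borel_measurable M" unfolding J_def by measurable
  \<comment> \<open>For \<open>x\<close> in \<open>H\<close> the map
    \<open>y \<mapsto> x \<otimes> y\<close> preserves \<open>H\<close>, so the integral of
    \<open>g (x \<otimes> y)\<close> over \<open>y\<close> in \<open>H\<close> is the mass of
    \<open>H\<close>, within \<open>\<eta>\<close> of 1. Comparing it with \<open>m * g x\<close>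
    costs \<open>J x\<close>.\<close>
  have onH: "ennreal m * ennreal \<bar>g x - 1 / m\<bar> \<le> J x + ennreal \<eta>" if x: "x \<in> H" for x
  proof -
    have xc: "x \<in> carrier G" using x by (simp add: H_def space_eq)
    note [measurable] = measurable_shift[OF g xc]
    have xH: "x \<otimes> y \<in> H \<longleftrightarrow> y \<in> H" if "y \<in> carrier G" for y
    proof
      assume "x \<otimes> y \<in> H"
      then have "inv x \<otimes> (x \<otimes> y) \<in> H" using subgroup.m_inv_closed[OF sub x] H_mult by blast
      then show "y \<in> H" using xc that by (simp add: m_assoc[symmetric])
    qed (use x H_mult in auto)
    have mass: "(\<integral>\<^sup>+y. ennreal (g (x \<otimes> y)) * indicator H y \<partial>M) = emeasure D H"
    proof -
      have "(\<integral>\<^sup>+y. ennreal (g (x \<otimes> y)) * indicator H y \<partial>M) = (\<integral>\<^sup>+y. ennreal (g (x \<otimes> y)) * indicator H (x \<otimes> y) \<partial>M)"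
        using xH by (intro nn_integral_cong) (auto simp: indicator_def space_eq)
      also have "\<dots> = emeasure D H"
        using xc by (subst nn_integral_translate[of x "\<lambda>y. ennreal (g y) * indicator H y"]) (auto simp: D)
      finally show ?thesis .
    qed
    have const: "(\<integral>\<^sup>+y. ennreal (g x) * indicator H y \<partial>M) = ennreal (m * g x)"
      using m g0 by (simp add: nn_integral_cmult ennreal_mult mult.commute)
    have "ennreal (m * g x) \<le> (\<integral>\<^sup>+y. ennreal \<bar>g x - g (x \<otimes> y)\<bar> * indicator H y + ennreal (g (x \<otimes> y)) * indicator H y \<partial>M)"
      unfolding const[symmetric] using g0
      by (intro nn_integral_mono) (auto simp: indicator_def simp flip: ennreal_plus intro!: ennreal_leI)
    also have "\<dots> = J x + emeasure D H"
      unfolding J_def mass[symmetric] by (intro nn_integral_add) measurable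
    also have "\<dots> \<le> J x + (1 + ennreal \<eta>)"
      using D_compl[of H] by (intro add_left_mono) (simp, metis add_increasing2 le_iff_add order_trans zero_le)
    finally have 1: "ennreal (m * g x) \<le> ennreal 1 + (J x + ennreal \<eta>)" by (simp add: add_ac)
    have "emeasure D H \<le> (\<integral>\<^sup>+y. ennreal \<bar>g x - g (x \<otimes> y)\<bar> * indicator H y + ennreal (g x) * indicator H y \<partial>M)"
      unfolding mass[symmetric] using g0
      by (intro nn_integral_mono) (auto simp: indicator_def simp flip: ennreal_plus intro!: ennreal_leI)
    also have "\<dots> = J x + ennreal (m * g x)"
      unfolding J_def const[symmetric] by (intro nn_integral_add) measurable
    finally have "emeasure D H + emeasure D (space M - H) \<le> J x + ennreal (m * g x) + ennreal \<eta>"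
      using DHc by (intro add_mono)
    then have 2: "ennreal 1 \<le> ennreal (m * g x) + (J x + ennreal \<eta>)"
      using D_compl[of H] by (simp add: add_ac)
    have "ennreal \<bar>m * g x - 1\<bar> \<le> J x + ennreal \<eta>"
      using m g0 1 2 by (intro ennreal_abs_diff_le) auto
    also have "\<bar>m * g x - 1\<bar> = m * \<bar>g x - 1 / m\<bar>"
      using m by (simp add: abs_mult[of m, symmetric, unfolded abs_of_pos[OF m(2)]] right_diff_distrib)
    finally show ?thesis using m by (simp add: ennreal_mult)
  qed
  \<comment> \<open>After swapping integrals \<open>J\<close> contributes the integral of
    \<open>shift_dist g\<close> over \<open>H\<close>, at most \<open>2 * \<eta> * m\<close>.
    Together with \<open>\<eta> * m\<close> this gives \<open>3 * \<eta>\<close> on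
    \<open>H\<close>, and the mass outside \<open>H\<close> adds the fourth
    \<open>\<eta>\<close>.\<close>
  have "ennreal m * (\<integral>\<^sup>+x. ennreal \<bar>g x - 1 / m\<bar> * indicator H x \<partial>M)
    = (\<integral>\<^sup>+x. ennreal m * (ennreal \<bar>g x - 1 / m\<bar> * indicator H x) \<partial>M)"
    by (simp add: nn_integral_cmult)
  also have "\<dots> \<le> (\<integral>\<^sup>+x. J x + ennreal \<eta> * indicator H x \<partial>M)"
    using onH by (intro nn_integral_mono) (auto simp: indicator_def)
  also have "\<dots> = (\<integral>\<^sup>+x. J x \<partial>M) + ennreal \<eta> * ennreal m"
    using m by (simp add: nn_integral_add nn_integral_cmult)
  also have "(\<integral>\<^sup>+x. J x \<partial>M) = (\<integral>\<^sup>+y. \<integral>\<^sup>+x. ennreal \<bar>g x - g (x \<otimes> y)\<bar> * indicator H y \<partial>M \<partial>M)"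
    unfolding J_def by (intro nn_integral_swap[symmetric]) measurable
  also have "\<dots> = (\<integral>\<^sup>+y. shift_dist g y * indicator H y \<partial>M)"
    by (intro nn_integral_cong) (simp add: indicator_def shift_dist_def)
  also have "\<dots> \<le> (\<integral>\<^sup>+y. ennreal (2 * \<eta>) * indicator H y \<partial>M)"
    by (intro nn_integral_mono) (auto simp: indicator_def H_def)
  also have "\<dots> = ennreal (2 * \<eta>) * ennreal m"
    using m by (simp add: nn_integral_cmult)
  also have "ennreal (2 * \<eta>) * ennreal m + ennreal \<eta> * ennreal m = ennreal m * ennreal (3 * \<eta>)"
    using m \<eta> by (simp add: algebra_simps flip: ennreal_mult ennreal_plus)
  finally have inside: "(\<integral>\<^sup>+x. ennreal \<bar>g x - 1 / m\<bar> * indicator H x \<partial>M) \<le> ennreal (3 * \<eta>)"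
    using m by (simp add: ennreal_mult_le_mult_iff)
  have "(\<integral>\<^sup>+x. ennreal \<bar>g x - indicator H x / measure M H\<bar> \<partial>M)
    = (\<integral>\<^sup>+x. ennreal \<bar>g x - 1 / m\<bar> * indicator H x + ennreal (g x) * indicator (space M - H) x \<partial>M)"
    using g0 by (intro nn_integral_cong) (auto simp: indicator_def m_def)
  also have "\<dots> = (\<integral>\<^sup>+x. ennreal \<bar>g x - 1 / m\<bar> * indicator H x \<partial>M) + emeasure D (space M - H)"
    by (subst D) (auto intro!: nn_integral_add)
  also have "\<dots> \<le> ennreal (3 * \<eta>) + ennreal \<eta>"
    by (intro add_mono inside DHc)
  also have "\<dots> = ennreal (4 * \<eta>)" using \<eta> by (simp flip: ennreal_plus)
  finally show ?thesis using sub H_pos H_fin by (intro exI[of _ H]) auto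
qed

end

text \<open>With \<open>u = sqrt a\<close> and \<open>v = sqrt b\<close>, the difference is
  \<open>\<bar>u - v\<bar> * (u + v)\<close>, and AM-GM with parameter \<open>t\<close> splits the
  product. Integrated, this bounds the \<open>L\<^sup>1\<close> distance of two probability
  densities by \<open>(1 - b) / t + 2 * t\<close>, where \<open>b\<close> is their Bhattacharyya
  coefficient: a linearised comparison of total variation with Hellinger distance.\<close>

lemma abs_diff_le_sqrt_mult:
  fixes a b t :: real
  assumes "0 \<le> a" "0 \<le> b" "0 < t"
  shows "\<bar>a - b\<bar> + (1 / t) * sqrt (a * b) \<le> (1 / (2 * t) + t) * a + (1 / (2 * t) + t) * b"
proof -
  define u v where "u = sqrt a" "v = sqrt b"
  have uv: "0 \<le> u" "0 \<le> v" "a = u\<^sup>2" "b = v\<^sup>2" "sqrt (a * b) = u * v"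
    using assms by (auto simp: u_v_def real_sqrt_mult)
  have "2 * t * (z * w) \<le> z\<^sup>2 + t\<^sup>2 * w\<^sup>2" for z w :: real
    using zero_le_power2[of "z - t * w"] by (simp add: power2_eq_square algebra_simps)
  from this[of "\<bar>u - v\<bar>" "u + v"]
  have 1: "2 * t * (\<bar>u - v\<bar> * (u + v)) \<le> (u - v)\<^sup>2 + t\<^sup>2 * (u + v)\<^sup>2" by simp
  have "0 \<le> (u - v)\<^sup>2" by simp
  then have "(u + v)\<^sup>2 \<le> 2 * (u\<^sup>2 + v\<^sup>2)" by (simp add: power2_eq_square algebra_simps)
  then have "t\<^sup>2 * (u + v)\<^sup>2 \<le> t\<^sup>2 * (2 * (u\<^sup>2 + v\<^sup>2))" by (intro mult_left_mono) auto
  with 1 have "2 * t * (\<bar>u - v\<bar> * (u + v)) + 2 * (u * v) \<le> (1 + 2 * t\<^sup>2) * (a + b)"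
    by (simp add: uv(3,4) power2_eq_square algebra_simps)
  moreover have "\<bar>u - v\<bar> * (u + v) = \<bar>(u - v) * (u + v)\<bar>"
    using uv by (simp add: abs_mult)
  moreover have "(u - v) * (u + v) = a - b"
    by (simp add: uv(3,4) power2_eq_square algebra_simps)
  ultimately have "(2 * t * \<bar>a - b\<bar> + 2 * (u * v)) / (2 * t) \<le> (1 + 2 * t\<^sup>2) * (a + b) / (2 * t)"
    using assms(3) by (intro divide_right_mono) auto
  moreover have "(2 * t * \<bar>a - b\<bar> + 2 * (u * v)) / (2 * t) = \<bar>a - b\<bar> + (1 / t) * (u * v)"
    using assms(3) by (simp add: add_divide_distrib)
  moreover have "(1 + 2 * t\<^sup>2) * (a + b) / (2 * t) = (1 / (2 * t) + t) * a + (1 / (2 * t) + t) * b"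
    using assms(3) by (simp add: add_divide_distrib power2_eq_square algebra_simps)
  ultimately show ?thesis using uv(5) by simp
qed

text \<open>Converts a deficit of \<open>b powr s\<close>, as delivered by Young's inequality with
  \<open>s = r - 1\<close>, into a deficit of \<open>b\<close>. For \<open>s \<ge> 1\<close> use
  \<open>b powr s \<le> b\<close>; for \<open>s < 1\<close> use the tangent of the concave power at
  1, which costs \<open>1 / s\<close>.\<close>

lemma one_minus_le_powr:
  fixes b s :: real
  assumes "0 \<le> b" "b \<le> 1" "0 < s"
  shows "1 - b \<le> max 1 (1 / s) * (1 - b powr s)"
proof (cases "1 \<le> s")
  case True
  then have "b powr s \<le> b powr 1" using assms by (intro powr_mono') auto
  moreover have "max 1 (1 / s) = 1" using True by (simp add: max_def)
  ultimately show ?thesis using assms by simp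
next
  case False
  then have "b powr s \<le> s * b + (1 - s)"
    using Youngs_inequality_0[of s "1 - s" b 1] assms by (cases "b = 0") auto
  moreover have m: "max 1 (1 / s) = 1 / s" using False assms by (simp add: max_def)
  ultimately show ?thesis unfolding m using assms by (simp add: field_simps)
qed

context invariant_measure_group
begin

text \<open>The autocorrelation \<open>A\<close> is a probability density, and the average of
  \<open>b powr (r - 1)\<close> against it is at least \<open>1 - e\<close> although
  \<open>b \<le> 1\<close>. So \<open>b\<close> is nearly 1 on average, and the mean of
  \<open>shift_dist g\<close> against \<open>A\<close> is small. As \<open>A\<close> is itself an
  average of translates of \<open>g\<close>, some single translate satisfies the hypothesis of
  \<open>almost_invariant_density\<close>.\<close>

theorem young_stability:
  fixes g :: "'a \<Rightarrow> real"
  assumes r: "1 < r" and g [measurable]: "g \<in> borel_measurable M" and g0: "\<And>x. 0 \<le> g x"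
    and g1: "(\<integral>\<^sup>+x. ennreal (g x) \<partial>M) = 1" and e: "0 < e" "e \<le> 1"
    and Y: "ennreal (1 - e) \<le> young_integral r (\<lambda>x. ennreal (g x))"
    and \<eta>: "\<eta> = sqrt (6 * sqrt (max 1 (1 / (r - 1)) * e))" "\<eta> < 1 / 6"
  shows "\<exists>H x\<^sub>0. subgroup H G \<and> H \<in> sets M \<and> emeasure M H \<noteq> 0 \<and> emeasure M H \<noteq> \<infinity> \<and> x\<^sub>0 \<in> carrier G \<and>
    (\<integral>\<^sup>+x. ennreal \<bar>g x - indicator (x\<^sub>0 <# H) x / measure M H\<bar> \<partial>M) \<le> ennreal (4 * \<eta>)"
proof -
  define C where "C = max 1 (1 / (r - 1))"
  \<comment> \<open>Balances the two errors \<open>C * e / t\<close> and \<open>2 * t\<close>, whose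
    sum is then \<open>3 * t\<close>.\<close>
  define t where "t = sqrt (C * e)"
  have C: "1 \<le> C" by (simp add: C_def)
  have t: "0 < t" "t\<^sup>2 = C * e" using C e by (auto simp: t_def)
  have \<eta>t: "\<eta>\<^sup>2 = 6 * t" "0 < \<eta>" using t by (auto simp: \<eta> t_def C_def)
  define A where "A = (\<lambda>y. \<integral>\<^sup>+x. ennreal (g x) * ennreal (g (x \<otimes> y)) \<partial>M)"
  define b where "b = (\<lambda>y. \<integral>\<^sup>+x. enn_powr (ennreal (g x) * ennreal (g (x \<otimes> y))) (1 / 2) \<partial>M)"
  have [measurable]: "A \<in> borel_measurable M" "b \<in> borel_measurable M"
    unfolding A_def b_def by measurable
  have A1: "(\<integral>\<^sup>+y. A y \<partial>M) = 1"
    unfolding A_def using nn_integral_correlation[of "\<lambda>x. ennreal (g x)" "\<lambda>x. ennreal (g x)"] by (simp add: g1)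
  \<comment> \<open>Says that \<open>shift_dist g y\<close> is at most \<open>C / t\<close> times
    the deficit of the affinity power, plus \<open>2 * t\<close>. It is stated additively to avoid
    subtraction of extended reals.\<close>
  have pt: "shift_dist g y + ennreal (C / t) * enn_powr (b y) (r - 1) \<le> ennreal (C / t + 2 * t)"
    if y: "y \<in> carrier G" for y
  proof -
    note [measurable] = measurable_shift[OF g y]
    have sq: "enn_powr (ennreal (g x) * ennreal (g (x \<otimes> y))) (1 / 2) = ennreal (sqrt (g x * g (x \<otimes> y)))" for x
      using g0 by (simp add: enn_powr_ennreal powr_half_sqrt flip: ennreal_mult)
    have "b y \<le> 1"
      using affinity_le[OF y, of "\<lambda>x. ennreal (g x)"] by (simp add: b_def g1)
    then obtain b' where b': "b y = ennreal b'" "0 \<le> b'" "b' \<le> 1"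
      by (cases "b y") (auto simp: top_unique)
    have "shift_dist g y + ennreal (1 / t) * b y
      = (\<integral>\<^sup>+x. ennreal \<bar>g x - g (x \<otimes> y)\<bar> + ennreal (1 / t) * ennreal (sqrt (g x * g (x \<otimes> y))) \<partial>M)"
      unfolding shift_dist_def b_def sq by (simp add: nn_integral_add nn_integral_cmult)
    also have "\<dots> \<le> (\<integral>\<^sup>+x. ennreal (1 / (2 * t) + t) * ennreal (g x) + ennreal (1 / (2 * t) + t) * ennreal (g (x \<otimes> y)) \<partial>M)"
      using g0 t abs_diff_le_sqrt_mult[of "g x" "g (x \<otimes> y)" t for x]
      by (intro nn_integral_mono) (simp flip: ennreal_mult ennreal_plus)
    also have "\<dots> = ennreal (1 / (2 * t) + t) + ennreal (1 / (2 * t) + t)"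
      using nn_integral_translate'[OF y, of "\<lambda>x. ennreal (g x)"]
      by (simp add: nn_integral_add nn_integral_cmult g1)
    also have "\<dots> = ennreal (1 / t + 2 * t)"
      using t by (simp flip: ennreal_plus add: field_simps)
    finally have le: "shift_dist g y + ennreal (b' / t) \<le> ennreal (1 / t + 2 * t)"
      using t b' by (simp flip: ennreal_mult)
    then obtain \<phi> where \<phi>: "shift_dist g y = ennreal \<phi>" "0 \<le> \<phi>"
      by (cases "shift_dist g y") (auto simp: top_unique)
    from le have "\<phi> + b' / t \<le> 1 / t + 2 * t"
      using \<phi> b' t by (simp flip: ennreal_plus)
    moreover have "(1 - b') / t \<le> C * (1 - b' powr (r - 1)) / t"
      unfolding C_def using b' r t by (intro divide_right_mono one_minus_le_powr) auto
    ultimately have "\<phi> + C / t * b' powr (r - 1) \<le> C / t + 2 * t"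
      by (simp add: algebra_simps diff_divide_distrib)
    then show ?thesis
      using \<phi> b' C t by (simp add: enn_powr_ennreal flip: ennreal_mult ennreal_plus)
  qed
  have low: "ennreal (1 - e) \<le> (\<integral>\<^sup>+y. A y * enn_powr (b y) (r - 1) \<partial>M)"
    using Y young_integral_le_affinity[OF r, of "\<lambda>x. ennreal (g x)"] by (simp add: A_def b_def)
  have "(\<integral>\<^sup>+y. A y * shift_dist g y \<partial>M) + ennreal (C / t * (1 - e))
     \<le> (\<integral>\<^sup>+y. A y * shift_dist g y \<partial>M) + ennreal (C / t) * (\<integral>\<^sup>+y. A y * enn_powr (b y) (r - 1) \<partial>M)"
  proof (intro add_left_mono)
    have "ennreal (C / t * (1 - e)) = ennreal (C / t) * ennreal (1 - e)"
      using C t e by (intro ennreal_mult) auto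
    also have "\<dots> \<le> ennreal (C / t) * (\<integral>\<^sup>+y. A y * enn_powr (b y) (r - 1) \<partial>M)"
      by (intro mult_left_mono low) auto
    finally show "ennreal (C / t * (1 - e)) \<le> ennreal (C / t) * (\<integral>\<^sup>+y. A y * enn_powr (b y) (r - 1) \<partial>M)" .
  qed
  also have "\<dots> = (\<integral>\<^sup>+y. A y * shift_dist g y + ennreal (C / t) * (A y * enn_powr (b y) (r - 1)) \<partial>M)"
    by (simp add: nn_integral_add nn_integral_cmult)
  also have "\<dots> = (\<integral>\<^sup>+y. A y * (shift_dist g y + ennreal (C / t) * enn_powr (b y) (r - 1)) \<partial>M)"
    by (simp add: distrib_left mult_ac)
  also have "\<dots> \<le> (\<integral>\<^sup>+y. A y * ennreal (C / t + 2 * t) \<partial>M)"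
    using pt by (intro nn_integral_mono mult_left_mono) (auto simp: space_eq)
  also have "\<dots> = ennreal (C / t + 2 * t)"
    by (simp add: nn_integral_multc A1)
  also have "C / t + 2 * t = 3 * t + C / t * (1 - e)"
    using t by (simp add: field_simps power2_eq_square)
  also have "ennreal (3 * t + C / t * (1 - e)) = ennreal (3 * t) + ennreal (C / t * (1 - e))"
    using C t e by (intro ennreal_plus) auto
  finally have Aphi: "(\<integral>\<^sup>+y. A y * shift_dist g y \<partial>M) \<le> ennreal (3 * t)"
    by (simp add: ennreal_add_left_cancel_le add.commute[of _ "ennreal (C / t * (1 - e))"])
  define B where "B = (\<lambda>x. \<integral>\<^sup>+y. ennreal (g (x \<otimes> y)) * shift_dist g y \<partial>M)"
  have [measurable]: "B \<in> borel_measurable M" unfolding B_def by measurable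
  \<comment> \<open>Rewrites the mean against \<open>A\<close> as the mean, over \<open>x\<close>
    with density \<open>g\<close>, of the means against
    \<open>y \<mapsto> g (x \<otimes> y)\<close>.\<close>
  have AB: "(\<integral>\<^sup>+y. A y * shift_dist g y \<partial>M) = (\<integral>\<^sup>+x. ennreal (g x) * B x \<partial>M)"
  proof -
    have "(\<integral>\<^sup>+y. A y * shift_dist g y \<partial>M)
      = (\<integral>\<^sup>+y. \<integral>\<^sup>+x. ennreal (g x) * (ennreal (g (x \<otimes> y)) * shift_dist g y) \<partial>M \<partial>M)"
    proof (intro nn_integral_cong)
      fix y assume "y \<in> space M"
      then have [measurable]: "(\<lambda>x. g (x \<otimes> y)) \<in> borel_measurable M"
        using measurable_shift[OF g] by (simp add: space_eq)
      show "A y * shift_dist g y = (\<integral>\<^sup>+x. ennreal (g x) * (ennreal (g (x \<otimes> y)) * shift_dist g y) \<partial>M)"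
        unfolding A_def by (simp add: nn_integral_multc[symmetric] mult.assoc)
    qed
    also have "\<dots> = (\<integral>\<^sup>+x. \<integral>\<^sup>+y. ennreal (g x) * (ennreal (g (x \<otimes> y)) * shift_dist g y) \<partial>M \<partial>M)"
      by (intro nn_integral_swap) measurable
    also have "\<dots> = (\<integral>\<^sup>+x. ennreal (g x) * B x \<partial>M)"
    proof (intro nn_integral_cong)
      fix x assume "x \<in> space M"
      then have [measurable]: "(\<lambda>y. g (x \<otimes> y)) \<in> borel_measurable M"
        using measurable_shift[OF g] by (simp add: space_eq)
      show "(\<integral>\<^sup>+y. ennreal (g x) * (ennreal (g (x \<otimes> y)) * shift_dist g y) \<partial>M) = ennreal (g x) * B x"
        unfolding B_def by (intro nn_integral_cmult) measurable
    qed
    finally show ?thesis .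
  qed
  \<comment> \<open>The mean of \<open>B\<close> is at most \<open>3 * t\<close>. The factor 2 of
    slack makes weak inequalities enough for the contradiction, and it explains the 6 in
    \<open>\<eta>\<close>.\<close>
  have "\<exists>x\<in>space M. B x \<le> ennreal (6 * t)"
  proof (rule ccontr)
    assume no: "\<not> ?thesis"
    have "ennreal (6 * t) = (\<integral>\<^sup>+x. ennreal (g x) * ennreal (6 * t) \<partial>M)"
      by (simp add: nn_integral_multc g1)
    also have "\<dots> \<le> (\<integral>\<^sup>+x. ennreal (g x) * B x \<partial>M)"
      using no by (intro nn_integral_mono mult_left_mono) auto
    also have "\<dots> \<le> ennreal (3 * t)" using Aphi AB by simp
    finally show False using t by simp
  qed
  then obtain x\<^sub>0 where x0: "x\<^sub>0 \<in> carrier G" "B x\<^sub>0 \<le> ennreal (6 * t)" by (auto simp: space_eq)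
  define g' where "g' = (\<lambda>x. g (x\<^sub>0 \<otimes> x))"
  have g' [measurable]: "g' \<in> borel_measurable M"
    unfolding g'_def by (rule measurable_shift[OF g x0(1)])
  have sd: "shift_dist g' y = shift_dist g y" if y: "y \<in> carrier G" for y
  proof -
    note [measurable] = measurable_shift[OF g y]
    have "shift_dist g' y = (\<integral>\<^sup>+x. ennreal \<bar>g (x\<^sub>0 \<otimes> x) - g (x\<^sub>0 \<otimes> x \<otimes> y)\<bar> \<partial>M)"
      unfolding shift_dist_def g'_def using x0 y by (intro nn_integral_cong) (simp add: m_assoc space_eq)
    also have "\<dots> = shift_dist g y"
      unfolding shift_dist_def
      by (rule nn_integral_translate[OF x0(1), of "\<lambda>x. ennreal \<bar>g x - g (x \<otimes> y)\<bar>"]) measurable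
    finally show ?thesis .
  qed
  have "(\<integral>\<^sup>+y. ennreal (g' y) * shift_dist g' y \<partial>M) = B x\<^sub>0"
    unfolding B_def by (intro nn_integral_cong, subst sd) (simp_all add: space_eq g'_def)
  then have "(\<integral>\<^sup>+y. ennreal (g' y) * shift_dist g' y \<partial>M) \<le> ennreal (\<eta>\<^sup>2)"
    using x0 \<eta>t by simp
  moreover have "(\<integral>\<^sup>+y. ennreal (g' y) \<partial>M) = 1"
    unfolding g'_def using nn_integral_translate[OF x0(1), of "\<lambda>x. ennreal (g x)"] g1 by simp
  ultimately obtain H where H: "subgroup H G" "H \<in> sets M" "emeasure M H \<noteq> 0" "emeasure M H \<noteq> \<infinity>"
    "(\<integral>\<^sup>+x. ennreal \<bar>g' x - indicator H x / measure M H\<bar> \<partial>M) \<le> ennreal (4 * \<eta>)"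
    using almost_invariant_density[of g' \<eta>] g' g0 \<eta>t \<eta> by (auto simp: g'_def)
  have Hc: "H \<subseteq> carrier G" using H(1) by (rule subgroup.subset)
  note [measurable] = l_coset_sets[OF x0(1) H(2)]
  have "(\<integral>\<^sup>+x. ennreal \<bar>g x - indicator (x\<^sub>0 <# H) x / measure M H\<bar> \<partial>M)
    = (\<integral>\<^sup>+x. ennreal \<bar>g (x\<^sub>0 \<otimes> x) - indicator (x\<^sub>0 <# H) (x\<^sub>0 \<otimes> x) / measure M H\<bar> \<partial>M)"
    by (rule nn_integral_translate[OF x0(1), symmetric]) measurable
  also have "\<dots> = (\<integral>\<^sup>+x. ennreal \<bar>g' x - indicator H x / measure M H\<bar> \<partial>M)"
    using l_coset_mem_iff[OF x0(1) _ Hc] by (intro nn_integral_cong) (auto simp: g'_def indicator_def space_eq)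
  finally show ?thesis using H x0 by (intro exI[of _ H] exI[of _ x\<^sub>0]) auto
qed

end

section \<open>Haar measure\<close>

locale haar_group = lca_group G T for G (structure) and T +
  fixes M :: "'a measure"
  assumes second_countable: "second_countable T"
    and haar: "haar_measure G T M"

lemma sc_lca_haar_iff: "sc_lca_haar G T \<mu> \<longleftrightarrow> haar_group G T \<mu>"
  by (simp add: sc_lca_haar_def haar_group_def haar_group_axioms_def)

context haar_group
begin

lemma sets_eq: "sets M = sigma_sets (carrier G) {U. openin T U}"
proof -
  have "{U. openin T U} \<subseteq> Pow (topspace T)" by (auto dest: openin_subset)
  then show ?thesis using haar by (simp add: haar_measure_def topspace_eq)
qed

lemma carrier_eq: "space M = carrier G"
proof -
  have "{U. openin T U} \<subseteq> Pow (topspace T)" by (auto dest: openin_subset)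
  moreover have "sets M = sets (sigma (topspace T) {U. openin T U})"
    using haar by (simp add: haar_measure_def)
  ultimately show ?thesis by (metis sets_eq_imp_space_eq space_measure_of topspace_eq)
qed

lemma openin_sets: "openin T U \<Longrightarrow> U \<in> sets M"
  by (auto simp: sets_eq)

lemma compactin_sets: "compactin T K \<Longrightarrow> K \<in> sets M"
proof -
  assume "compactin T K"
  then have "closedin T K" using Hausdorff by (rule compactin_imp_closedin[rotated])
  then have "K = space M - (space M - K)" "openin T (space M - K)"
    by (auto simp: closedin_def topspace_eq carrier_eq)
  then show ?thesis using openin_sets by (metis sets.compl_sets)
qed

lemma compactin_finite: "compactin T K \<Longrightarrow> emeasure M K \<noteq> \<infinity>"
  using haar by (auto simp: haar_measure_def)

lemma outer_regular:
  "A \<in> sets M \<Longrightarrow> emeasure M A = (INF U\<in>{U. openin T U \<and> A \<subseteq> U}. emeasure M U)"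
  using haar by (auto simp: haar_measure_def)

lemma inner_regular:
  "openin T U \<Longrightarrow> emeasure M U = (SUP K\<in>{K. compactin T K \<and> K \<subseteq> U}. emeasure M K)"
  using haar by (auto simp: haar_measure_def)

text \<open>By local compactness the members of a countable base that lie in compact sets still
  cover the group, and each has finite measure.\<close>

lemma haar_sigma_finite: "sigma_finite_measure M"
proof -
  obtain \<B> where B: "countable \<B>" "\<And>V. V \<in> \<B> \<Longrightarrow> openin T V"
    "\<And>U x. openin T U \<Longrightarrow> x \<in> U \<Longrightarrow> \<exists>V\<in>\<B>. x \<in> V \<and> V \<subseteq> U"
    using second_countable unfolding second_countable_def by metis
  define \<C> where "\<C> = {V\<in>\<B>. \<exists>K. compactin T K \<and> V \<subseteq> K}"
  have "x \<in> \<Union>\<C>" if x: "x \<in> carrier G" for x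
  proof -
    obtain U K where UK: "openin T U" "compactin T K" "x \<in> U" "U \<subseteq> K"
      using locally_compact x by (auto simp: locally_compact_space_def topspace_eq)
    from B(3)[OF UK(1,3)] obtain V where "V \<in> \<B>" "x \<in> V" "V \<subseteq> U" by blast
    with UK show ?thesis by (auto simp: \<C>_def)
  qed
  moreover have "V \<subseteq> carrier G" if "V \<in> \<C>" for V
    using that B(2) openin_subset[of T V] by (auto simp: \<C>_def topspace_eq)
  ultimately have "\<Union>\<C> = space M" by (auto simp: carrier_eq)
  moreover have "emeasure M V \<noteq> \<infinity>" if V: "V \<in> \<C>" for V
  proof -
    obtain K where K: "compactin T K" "V \<subseteq> K" using V by (auto simp: \<C>_def)
    then have "emeasure M V \<le> emeasure M K" by (intro emeasure_mono compactin_sets)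
    with compactin_finite[OF K(1)] show ?thesis by (auto simp: top_unique)
  qed
  moreover have "\<C> \<subseteq> sets M" "countable \<C>"
    using B openin_sets by (auto simp: \<C>_def)
  ultimately show ?thesis by (intro sigma_finite_measure.intro) blast
qed

text \<open>Continuity alone gives Borel measurability for the product topology. Second countability
  makes each open set of that topology a countable union of open rectangles, hence measurable for
  the product sigma-algebra.\<close>

lemma haar_mult_measurable: "(\<lambda>(x, y). x \<otimes> y) \<in> M \<Otimes>\<^sub>M M \<rightarrow>\<^sub>M M"
proof (rule measurable_sigma_sets[OF sets_eq])
  show "{U. openin T U} \<subseteq> Pow (carrier G)" by (auto dest: openin_subset simp: topspace_eq[symmetric])
  show "(\<lambda>(x, y). x \<otimes> y) \<in> space (M \<Otimes>\<^sub>M M) \<rightarrow> carrier G"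
    by (auto simp: space_pair_measure carrier_eq)
  fix U assume "U \<in> {U. openin T U}"
  define W where "W = (\<lambda>(x, y). x \<otimes> y) -` U \<inter> space (M \<Otimes>\<^sub>M M)"
  have "openin (prod_topology T T) {p \<in> topspace (prod_topology T T). (\<lambda>(x, y). x \<otimes> y) p \<in> U}"
    using \<open>U \<in> _\<close> continuous_mult by (intro openin_continuous_map_preimage) auto
  also have "{p \<in> topspace (prod_topology T T). (\<lambda>(x, y). x \<otimes> y) p \<in> U} = W"
    by (auto simp: W_def space_pair_measure carrier_eq topspace_eq)
  finally have W: "openin (prod_topology T T) W" .
  obtain \<B> where B: "countable \<B>" "\<And>V. V \<in> \<B> \<Longrightarrow> openin T V"
    "\<And>U x. openin T U \<Longrightarrow> x \<in> U \<Longrightarrow> \<exists>V\<in>\<B>. x \<in> V \<and> V \<subseteq> U"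
    using second_countable unfolding second_countable_def by metis
  define \<R> where "\<R> = {P \<in> \<B> \<times> \<B>. fst P \<times> snd P \<subseteq> W}"
  have "W = (\<Union>P\<in>\<R>. fst P \<times> snd P)"
  proof (intro equalityI subsetI)
    fix p assume "p \<in> W"
    then obtain x y where p: "p = (x, y)" "(x, y) \<in> W" by (cases p) auto
    with W obtain U V where UV: "openin T U" "openin T V" "x \<in> U" "y \<in> V" "U \<times> V \<subseteq> W"
      unfolding openin_prod_topology_alt by metis
    from B(3)[OF UV(1,3)] B(3)[OF UV(2,4)] obtain U' V' where
      "U' \<in> \<B>" "x \<in> U'" "U' \<subseteq> U" "V' \<in> \<B>" "y \<in> V'" "V' \<subseteq> V" by blast
    with UV p show "p \<in> (\<Union>P\<in>\<R>. fst P \<times> snd P)"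
      by (intro UN_I[of "(U', V')"]) (auto simp: \<R>_def)
  qed (auto simp: \<R>_def)
  moreover have "(\<Union>P\<in>\<R>. fst P \<times> snd P) \<in> sets (M \<Otimes>\<^sub>M M)"
  proof (rule sets.countable_UN')
    have "\<R> \<subseteq> \<B> \<times> \<B>" by (auto simp: \<R>_def)
    then show "countable \<R>" using B(1) by (meson countable_SIGMA countable_subset)
  qed (use B(2) openin_sets in \<open>auto simp: \<R>_def\<close>)
  ultimately show "(\<lambda>(x, y). x \<otimes> y) -` U \<inter> space (M \<Otimes>\<^sub>M M) \<in> sets (M \<Otimes>\<^sub>M M)"
    by (simp add: W_def)
qed

end

sublocale haar_group \<subseteq> invariant_measure_group G M
proof unfold_locales
  show "emeasure M (x <# A) = emeasure M A" if "x \<in> carrier G" "A \<in> sets M" for x A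
    using haar that by (auto simp: haar_measure_def)
qed (use haar_sigma_finite haar_mult_measurable carrier_eq in \<open>auto simp: sigma_finite_measure_def\<close>)

context haar_group
begin

section \<open>Subgroups of positive finite measure are open and compact\<close>

lemma openin_translate:
  assumes a: "a \<in> carrier G" and U: "openin T U"
  shows "openin T {x\<in>carrier G. a \<otimes> x \<in> U}"
proof -
  have "continuous_map T (prod_topology T T) (\<lambda>x. (a, x))"
    using a by (intro continuous_map_pairedI) (auto simp: topspace_eq)
  from continuous_map_compose[OF this continuous_mult]
  have "continuous_map T T (\<lambda>x. a \<otimes> x)" by (simp add: o_def)
  from openin_continuous_map_preimage[OF this U] show ?thesis by (simp add: topspace_eq)
qed

text \<open>A form of Steinhaus' theorem: for \<open>v\<close> close to the identity, both \<open>H\<close> and most of \<open>v H\<close> lie in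
  an open set of measure less than \<open>3/2\<close> times the measure of \<open>H\<close>, so that they meet.\<close>

lemma subgroup_openin:
  assumes H: "subgroup H G" "H \<in> sets M" "emeasure M H \<noteq> 0" "emeasure M H \<noteq> \<infinity>"
  shows "openin T H"
proof -
  define h where "h = measure M H"
  have h: "emeasure M H = ennreal h" "0 < h"
    using H by (auto simp: h_def emeasure_eq_ennreal_measure zero_less_measure_iff top.not_eq_extremum)
  have Hc: "H \<subseteq> carrier G" by (rule subgroup.subset[OF H(1)])
  have "(INF U\<in>{U. openin T U \<and> H \<subseteq> U}. emeasure M U) < ennreal (3 / 2 * h)"
    using h unfolding outer_regular[OF H(2), symmetric] by (simp add: ennreal_less_iff)
  then obtain U where U: "openin T U" "H \<subseteq> U" "emeasure M U < ennreal (3 / 2 * h)"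
    by (auto simp: INF_less_iff)
  define u where "u = measure M U"
  have u: "emeasure M U = ennreal u" "0 \<le> u"
    using U(3) by (auto simp: u_def intro!: emeasure_eq_ennreal_measure)
  have Um: "U \<in> fmeasurable M" "H \<in> fmeasurable M"
    using U openin_sets H u h by (auto simp: fmeasurable_def)
  have hu: "h \<le> u" unfolding h_def u_def using U H Um by (intro measure_mono_fmeasurable)
  have u2: "u < 3 / 2 * h" using U u by (simp add: ennreal_less_iff)
  \<comment> \<open>The compact part \<open>K\<close> misses less than half the measure of
    \<open>H\<close>. It is needed because the tube lemma provides one neighbourhood
    \<open>V\<close> of the identity that shifts all of a compact set into \<open>U\<close>.\<close>
  have "ennreal (u - h / 2) < (SUP K\<in>{K. compactin T K \<and> K \<subseteq> U}. emeasure M K)"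
    using h hu u unfolding inner_regular[OF U(1), symmetric] by (simp add: ennreal_less_iff)
  then obtain K where K: "compactin T K" "K \<subseteq> U" "ennreal (u - h / 2) < emeasure M K"
    by (auto simp: less_SUP_iff)
  have Km: "K \<in> fmeasurable M"
    using K compactin_sets compactin_finite by (auto simp: fmeasurable_def top.not_eq_extremum)
  have k: "u - h / 2 < measure M K"
    using K(3) hu h emeasure_eq_measure2[OF Km] by (simp add: ennreal_less_iff)
  define W where "W = {p \<in> topspace (prod_topology T T). (\<lambda>(x, y). x \<otimes> y) p \<in> U}"
  have W: "openin (prod_topology T T) W"
    unfolding W_def using U(1) continuous_mult by (intro openin_continuous_map_preimage) auto
  have Kc: "K \<subseteq> carrier G" using compactin_subset_topspace[OF K(1)] by (simp add: topspace_eq)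
  have "K \<times> {\<one>} \<subseteq> W" using K Kc by (auto simp: W_def topspace_eq subset_eq)
  moreover have "compactin T {\<one>}" by (simp add: topspace_eq)
  ultimately obtain U' V where V: "openin T V" "\<one> \<in> V" "K \<subseteq> U'" "U' \<times> V \<subseteq> W"
    using Wallace_theorem_prod_topology[OF K(1) _ W] by (metis insert_subset)
  \<comment> \<open>Otherwise \<open>H\<close> and \<open>v <# (H \<inter> K)\<close> are disjoint
    inside \<open>U\<close>. But \<open>H \<inter> K\<close> has measure more than
    \<open>h / 2\<close>, so \<open>u\<close> would exceed \<open>3 / 2 * h\<close>.\<close>
  have VH: "v \<in> H" if v: "v \<in> V" for v
  proof (rule ccontr)
    assume vH: "v \<notin> H"
    have vc: "v \<in> carrier G" using v openin_subset[OF V(1)] by (auto simp: topspace_eq)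
    have disj: "H \<inter> (v <# (H \<inter> K)) = {}"
    proof (rule ccontr)
      assume "H \<inter> (v <# (H \<inter> K)) \<noteq> {}"
      then obtain x where x: "x \<in> H" "v \<otimes> x \<in> H" by (auto simp: l_coset_def)
      then have "v \<otimes> x \<otimes> inv x \<in> H" using subgroup.m_closed[OF H(1)] subgroup.m_inv_closed[OF H(1)] by blast
      then show False using vH vc x Hc by (auto simp: m_assoc)
    qed
    have sub: "v <# (H \<inter> K) \<subseteq> U"
    proof
      fix x assume "x \<in> v <# (H \<inter> K)"
      then obtain y where y: "y \<in> K" "x = v \<otimes> y" by (auto simp: l_coset_def)
      then have "(y, v) \<in> W" using V v by auto
      then have "y \<otimes> v \<in> U" by (auto simp: W_def)
      then show "x \<in> U" using y Kc vc by (auto simp: m_comm subset_eq)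
    qed
    have HK: "H \<inter> K \<in> sets M" using H Km by auto
    have eq: "emeasure M (v <# (H \<inter> K)) = emeasure M (H \<inter> K)" by (intro emeasure_coset vc HK)
    then have vm: "v <# (H \<inter> K) \<in> fmeasurable M" "measure M (v <# (H \<inter> K)) = measure M (H \<inter> K)"
      using l_coset_sets[OF vc HK] fmeasurable.Int[OF Um(2) Km] by (auto simp: fmeasurable_def measure_def)
    have "h + measure M (H \<inter> K) = measure M (H \<union> (v <# (H \<inter> K)))"
      using measure_Un3[OF Um(2) vm(1)] disj vm by (simp add: h_def)
    also have "\<dots> \<le> u" unfolding u_def
      using sub U Um vm H by (intro measure_mono_fmeasurable) auto
    finally have 1: "h + measure M (H \<inter> K) \<le> u" .
    have "measure M (H \<union> K) \<le> u"
      unfolding u_def using U K Um H Km by (intro measure_mono_fmeasurable) auto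
    then have "h + measure M K - measure M (H \<inter> K) \<le> u"
      using measure_Un3[OF Um(2) Km] by (simp add: h_def)
    with 1 k u2 show False by linarith
  qed
  have "\<exists>S. openin T S \<and> y \<in> S \<and> S \<subseteq> H" if y: "y \<in> H" for y
  proof (intro exI conjI)
    have yc: "y \<in> carrier G" using y Hc by auto
    show "openin T {x\<in>carrier G. inv y \<otimes> x \<in> V}" using yc V by (intro openin_translate) auto
    show "y \<in> {x\<in>carrier G. inv y \<otimes> x \<in> V}" using yc V by simp
    show "{x\<in>carrier G. inv y \<otimes> x \<in> V} \<subseteq> H"
    proof safe
      fix x assume x: "x \<in> carrier G" "inv y \<otimes> x \<in> V"
      then have "y \<otimes> (inv y \<otimes> x) \<in> H" using subgroup.m_closed[OF H(1) y VH] by blast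
      then show "x \<in> H" using x yc by (simp add: m_assoc[symmetric])
    qed
  qed
  then show ?thesis by (subst openin_subopen) blast
qed

text \<open>A compact \<open>K\<close> inside \<open>H\<close> with more than half its measure meets
  each translate \<open>x <# K\<close> with \<open>x\<close> in \<open>H\<close>. So
  \<open>H\<close> is the set of all quotients of elements of \<open>K\<close>, a continuous image
  of \<open>K \<times> K\<close>.\<close>

lemma subgroup_compactin:
  assumes H: "subgroup H G" "H \<in> sets M" "emeasure M H \<noteq> 0" "emeasure M H \<noteq> \<infinity>"
  shows "compactin T H"
proof -
  define h where "h = measure M H"
  have h: "emeasure M H = ennreal h" "0 < h"
    using H by (auto simp: h_def emeasure_eq_ennreal_measure zero_less_measure_iff top.not_eq_extremum)
  have Hc: "H \<subseteq> carrier G" by (rule subgroup.subset[OF H(1)])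
  have "ennreal (h / 2) < (SUP K\<in>{K. compactin T K \<and> K \<subseteq> H}. emeasure M K)"
    using h unfolding inner_regular[OF subgroup_openin[OF H], symmetric] by (simp add: ennreal_less_iff)
  then obtain K where K: "compactin T K" "K \<subseteq> H" "ennreal (h / 2) < emeasure M K"
    by (auto simp: less_SUP_iff)
  have Km: "K \<in> fmeasurable M" and Hm: "H \<in> fmeasurable M"
    using K H h compactin_sets compactin_finite by (auto simp: fmeasurable_def top.not_eq_extremum)
  have k: "h / 2 < measure M K"
    using K(3) h emeasure_eq_measure2[OF Km] by (simp add: ennreal_less_iff)
  let ?f = "\<lambda>(x, y). x \<otimes> inv y"
  have "continuous_map (prod_topology T T) (prod_topology T T) (\<lambda>p. (fst p, inv (snd p)))"
    using continuous_map_compose[OF continuous_map_snd continuous_inv]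
    by (intro continuous_map_pairedI continuous_map_fst) (auto simp: o_def)
  from continuous_map_compose[OF this continuous_mult]
  have "continuous_map (prod_topology T T) T ?f" by (simp add: o_def case_prod_unfold)
  then have "compactin T (?f ` (K \<times> K))"
    using K(1) by (intro image_compactin) (auto simp: compactin_Times)
  also have "?f ` (K \<times> K) = H"
  proof (intro equalityI subsetI)
    fix x assume "x \<in> ?f ` (K \<times> K)"
    then show "x \<in> H" using K(2) H(1) by (auto intro!: subgroup.m_closed subgroup.m_inv_closed)
  next
    fix x assume x: "x \<in> H"
    then have xc: "x \<in> carrier G" using Hc by auto
    have xm: "x <# K \<in> fmeasurable M" "measure M (x <# K) = measure M K"
      using emeasure_coset[OF xc, of K] l_coset_sets[OF xc, of K] Km by (auto simp: fmeasurable_def measure_def)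
    have "x <# K \<subseteq> H" using x K(2) H(1) by (auto simp: l_coset_def intro!: subgroup.m_closed)
    then have "measure M (K \<union> (x <# K)) \<le> h"
      unfolding h_def using K Km xm Hm by (intro measure_mono_fmeasurable) auto
    then have "K \<inter> (x <# K) \<noteq> {}"
      using measure_Un3[OF Km xm(1)] k xm(2) by auto
    then obtain y z where yz: "y \<in> K" "z \<in> K" "y = x \<otimes> z" by (auto simp: l_coset_def)
    then have "x = y \<otimes> inv z" using xc K(2) Hc by (auto simp: m_assoc subset_eq)
    with yz show "x \<in> ?f ` (K \<times> K)" by force
  qed
  finally show ?thesis .
qed

section \<open>The norm inequality and near-extremizers on a Haar group\<close>

lemma gowers_R_eq: "gowers_R G M d f = cube_integral {..<d} (\<lambda>x. ennreal (f x))"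
  by (simp add: fun_eq_iff gowers_R_def cube_integral_def)

lemma young_integral_cong:
  assumes "\<And>x. x \<in> carrier G \<Longrightarrow> g x = g' x"
  shows "young_integral r g = young_integral r g'"
  unfolding young_integral_def using assms
  by (intro nn_integral_cong arg_cong2[where f = enn_powr]) (auto simp: space_eq)

lemma young_integral_scale:
  assumes r: "1 \<le> r" and g [measurable]: "g \<in> borel_measurable M"
  shows "young_integral r (\<lambda>x. c * g x) = enn_powr c (r + 1) * young_integral r g"
proof -
  define s where "s = (r + 1) / (2 * r)"
  have s: "(s + s) * r = r + 1" using r by (simp add: s_def field_simps)
  have "young_integral r (\<lambda>x. c * g x)
    = (\<integral>\<^sup>+y. enn_powr (\<integral>\<^sup>+x. enn_powr c (s + s) * enn_powr (g x * g (x \<otimes> y)) s \<partial>M) r \<partial>M)"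
    unfolding young_integral_def s_def[symmetric] enn_powr_add enn_powr_mult by (simp add: mult_ac)
  also have "\<dots> = (\<integral>\<^sup>+y. enn_powr c (r + 1) * enn_powr (\<integral>\<^sup>+x. enn_powr (g x * g (x \<otimes> y)) s \<partial>M) r \<partial>M)"
  proof (intro nn_integral_cong)
    fix y assume "y \<in> space M"
    then have [measurable]: "(\<lambda>x. g (x \<otimes> y)) \<in> borel_measurable M"
      using measurable_shift[OF g] by (simp add: space_eq)
    show "enn_powr (\<integral>\<^sup>+x. enn_powr c (s + s) * enn_powr (g x * g (x \<otimes> y)) s \<partial>M) r
      = enn_powr c (r + 1) * enn_powr (\<integral>\<^sup>+x. enn_powr (g x * g (x \<otimes> y)) s \<partial>M) r"
      unfolding s[symmetric] enn_powr_powr[symmetric] enn_powr_mult[symmetric] by (simp add: nn_integral_cmult)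
  qed
  also have "\<dots> = enn_powr c (r + 1) * young_integral r g"
    unfolding young_integral_def s_def by (intro nn_integral_cmult) measurable
  finally show ?thesis .
qed

text \<open>The part of the chain shared by both results: followed by Young's inequality it gives
  the norm inequality, and applied to a near-extremizer it bounds the Young functional from
  below.\<close>

lemma U_norm_le_young:
  assumes red: "young_reduction d p r \<theta>" and [measurable]: "f \<in> borel_measurable M"
  shows "U_norm G M d p f \<le>
    enn_powr (young_integral r (\<lambda>x. enn_powr (ennreal (f x)) (crit_exp d p))) (\<theta> / (p * 2 ^ d))"
proof -
  have p: "0 < p" using young_reduction_props[OF red] by simp
  have "U_norm G M d p f
    = enn_powr (\<integral>\<^sup>+h. enn_powr (cube_integral {..<d} (\<lambda>x. ennreal (f x)) h) p \<partial>Pi\<^sub>M {..<d} (\<lambda>_. M)) (1 / p * (1 / 2 ^ d))"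
    unfolding U_norm_def Lp_enorm_def gowers_R_eq enn_powr_powr ..
  also have "\<dots> \<le> enn_powr (enn_powr (young_integral r (\<lambda>x. enn_powr (ennreal (f x)) (crit_exp d p))) \<theta>)
      (1 / p * (1 / 2 ^ d))"
    using red p by (intro enn_powr_mono cube_integral_le_young) auto
  finally show ?thesis by (simp add: enn_powr_powr)
qed

lemma Lp_norm_nonneg:
  assumes "\<And>x. x \<in> carrier G \<Longrightarrow> 0 \<le> f x"
  shows "Lp_norm M q f = enn_powr (\<integral>\<^sup>+x. enn_powr (ennreal (f x)) q \<partial>M) (1 / q)"
  unfolding Lp_norm_def Lp_enorm_def using assms
  by (intro arg_cong2[where f = enn_powr] nn_integral_cong) (auto simp: space_eq)

theorem U_norm_le_Lp_norm:
  assumes d: "1 \<le> d" and p: "0 < p" "1 \<le> crit_exp d p"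
    and [measurable]: "f \<in> borel_measurable M" and f0: "\<And>x. x \<in> carrier G \<Longrightarrow> 0 \<le> f x"
  shows "U_norm G M d p f \<le> Lp_norm M (crit_exp d p) f"
proof -
  from young_reduction_exists[OF d p] obtain r \<theta> where red: "young_reduction d p r \<theta>" by blast
  note props = young_reduction_props[OF red]
  let ?I = "\<integral>\<^sup>+x. enn_powr (ennreal (f x)) (crit_exp d p) \<partial>M"
  have "U_norm G M d p f \<le> enn_powr (enn_powr ?I (r + 1)) (\<theta> / (p * 2 ^ d))"
    using props by (intro order_trans[OF U_norm_le_young[OF red]] enn_powr_mono young_integral_le) auto
  also have "\<dots> = enn_powr ?I (1 / crit_exp d p)"
  proof -
    have "(r + 1) * (\<theta> / (p * 2 ^ d)) = (\<theta> * (r + 1)) / (p * 2 ^ d)" by simp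
    also have "\<dots> = 1 / crit_exp d p" using props by (simp add: mult.commute)
    finally show ?thesis by (simp add: enn_powr_powr)
  qed
  also have "\<dots> = Lp_norm M (crit_exp d p) f" using f0 by (simp add: Lp_norm_nonneg)
  finally show ?thesis .
qed

end

text \<open>How close to being almost invariant (in the sense of \<open>almost_invariant_density\<close>) an
  \<open>\<epsilon>\<close>-near-extremizer is, when \<open>m\<close> is the exponent relating the Gowers norm to the Young functional.\<close>

definition defect :: "real \<Rightarrow> real \<Rightarrow> real \<Rightarrow> real" where
  "defect r m \<epsilon> = sqrt (6 * sqrt (max 1 (1 / (r - 1)) * (1 - (1 - \<epsilon>) powr m)))"

text \<open>Superadditivity of the \<open>q\<close>-th power on nonnegative numbers. It turns
  \<open>L\<^sup>1\<close> closeness of \<open>q\<close>-th powers into \<open>L\<^sup>q\<close>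
  closeness of the functions.\<close>

lemma abs_diff_powr_le:
  fixes a b q :: real
  assumes "0 \<le> a" "0 \<le> b" "1 \<le> q"
  shows "\<bar>a - b\<bar> powr q \<le> \<bar>a powr q - b powr q\<bar>"
proof -
  have *: "(a - b) powr q \<le> a powr q - b powr q" if ab: "0 \<le> b" "b \<le> a" for a b :: real
  proof (cases "a = 0")
    case False
    then have a: "0 < a" using ab by simp
    have le: "x powr q \<le> x" if "0 \<le> x" "x \<le> 1" for x :: real
      using powr_mono'[of 1 q x] assms(3) that by auto
    have "((a - b) / a) powr q + (b / a) powr q \<le> (a - b) / a + b / a"
      using a ab by (intro add_mono le) auto
    also have "\<dots> = 1" using a by (simp add: field_simps)
    finally have "((a - b) powr q + b powr q) / a powr q \<le> 1"
      using a ab by (simp add: powr_divide add_divide_distrib)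
    then show ?thesis using a by (simp add: divide_le_eq)
  qed (use ab in auto)
  have "b powr q \<le> a powr q" if "b \<le> a" using that assms by (intro powr_mono2) auto
  moreover have "a powr q \<le> b powr q" if "a \<le> b" using that assms by (intro powr_mono2) auto
  ultimately show ?thesis
    using *[of b a] *[of a b] assms by (cases "b \<le> a") (auto simp: abs_if)
qed

text \<open>The normalised power \<open>g\<close> of \<open>f\<close> is a probability density whose
  Young functional is at least \<open>1 - e\<close>, so \<open>young_stability\<close> provides the
  coset. The multiple of its indicator is the one whose \<open>q\<close>-th power is
  \<open>c\<close> times the normalised indicator, so the pointwise bound
  \<open>abs_diff_powr_le\<close> finishes.\<close>

theorem (in haar_group) near_extremizer:
  fixes p :: real
  defines "q \<equiv> \<lambda>d. crit_exp d p"
  assumes red: "young_reduction d p r \<theta>" and r: "1 < r" and q: "1 \<le> q d"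
    and f [measurable]: "f \<in> borel_measurable M" and f0: "\<And>x. x \<in> carrier G \<Longrightarrow> 0 \<le> f x"
    and fin: "Lp_norm M (q d) f < \<infinity>" and nz: "\<not> (AE x in M. f x = 0)"
    and \<epsilon>: "0 < \<epsilon>" "\<epsilon> < 1" and near: "ennreal (1 - \<epsilon>) * Lp_norm M (q d) f \<le> U_norm G M d p f"
    and small: "defect r (p * 2 ^ d / \<theta>) \<epsilon> < 1 / 6"
  shows "\<exists>H x\<^sub>0. subgroup H G \<and> openin T H \<and> compactin T H \<and> x\<^sub>0 \<in> carrier G \<and>
    Lp_norm M (q d) (\<lambda>x. f x - enn2real (Lp_norm M (q d) f)
        / measure M H powr ((real d + p) / (2 ^ d * p)) * indicator (x\<^sub>0 <# H) x)
      \<le> ennreal ((4 * defect r (p * 2 ^ d / \<theta>) \<epsilon>) powr (1 / q d)) * Lp_norm M (q d) f"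
proof -
  define Q where "Q = q d"
  define m where "m = p * 2 ^ d / \<theta>"
  define e where "e = 1 - (1 - \<epsilon>) powr m"
  define \<eta> where "\<eta> = defect r m \<epsilon>"
  note props = young_reduction_props[OF red]
  have Q: "1 \<le> Q" "(real d + p) / (2 ^ d * p) = 1 / Q" "crit_exp d p = Q"
    using q by (auto simp: Q_def q_def)
  have m: "0 < m" using props by (simp add: m_def)
  \<comment> \<open>By this degree count the scaling factor \<open>c\<close> contributes exactly the
    norm \<open>N\<close> and cancels. The exponent \<open>m\<close> is the inverse of
    \<open>\<theta> / (p * 2 ^ d)\<close>, so the loss \<open>1 - \<epsilon>\<close> becomes
    \<open>1 - e\<close> for the Young functional.\<close>
  have rQ: "(r + 1) * (\<theta> / (p * 2 ^ d)) = 1 / Q"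
  proof -
    have "(r + 1) * (\<theta> / (p * 2 ^ d)) = (\<theta> * (r + 1)) / (p * 2 ^ d)" by simp
    also have "\<dots> = 1 / Q" using props Q(2) by (simp add: mult.commute)
    finally show ?thesis .
  qed
  let ?F = "\<lambda>x. enn_powr (ennreal (f x)) Q"
  have Lp: "Lp_norm M Q f = enn_powr (\<integral>\<^sup>+x. ?F x \<partial>M) (1 / Q)"
    using f0 by (rule Lp_norm_nonneg)
  have "(\<integral>\<^sup>+x. ?F x \<partial>M) \<noteq> \<infinity>"
    using fin Lp by (auto simp: Q_def)
  moreover have "(\<integral>\<^sup>+x. ?F x \<partial>M) \<noteq> 0"
  proof
    assume "(\<integral>\<^sup>+x. ?F x \<partial>M) = 0"
    then have "AE x in M. ?F x = 0" by (subst (asm) nn_integral_0_iff_AE) auto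
    then have "AE x in M. f x = 0"
      using AE_space by eventually_elim (use f0 in \<open>force simp: space_eq ennreal_eq_0_iff\<close>)
    with nz show False by simp
  qed
  ultimately obtain c where c: "(\<integral>\<^sup>+x. ?F x \<partial>M) = ennreal c" "0 < c"
    by (cases "\<integral>\<^sup>+x. ?F x \<partial>M") (auto simp: less_le)
  define N where "N = c powr (1 / Q)"
  have N: "Lp_norm M Q f = ennreal N" "0 < N" "N powr Q = c"
    using c Q by (auto simp: Lp N_def enn_powr_ennreal powr_powr)
  define g where "g = (\<lambda>x. \<bar>f x\<bar> powr Q / c)"
  have g [measurable]: "g \<in> borel_measurable M" unfolding g_def by measurable
  have g0: "0 \<le> g x" for x using c by (simp add: g_def)
  have Fg: "?F x = ennreal c * ennreal (g x)" if "x \<in> carrier G" for x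
    using f0[OF that] c by (simp add: g_def enn_powr_ennreal flip: ennreal_mult)
  have g1: "(\<integral>\<^sup>+x. ennreal (g x) \<partial>M) = 1"
  proof -
    have "(\<integral>\<^sup>+x. ?F x \<partial>M) = (\<integral>\<^sup>+x. ennreal c * ennreal (g x) \<partial>M)"
      by (intro nn_integral_cong) (use Fg in \<open>simp add: space_eq\<close>)
    also have "\<dots> = ennreal c * (\<integral>\<^sup>+x. ennreal (g x) \<partial>M)" by (intro nn_integral_cmult) measurable
    finally have "ennreal c * (\<integral>\<^sup>+x. ennreal (g x) \<partial>M) = ennreal c * 1" using c(1) by simp
    then show ?thesis using c(2) by (subst (asm) ennreal_mult_cancel_left) auto
  qed
  let ?Y = "young_integral r (\<lambda>x. ennreal (g x))"
  have "ennreal (1 - \<epsilon>) * ennreal N \<le> enn_powr (young_integral r ?F) (\<theta> / (p * 2 ^ d))"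
    using near U_norm_le_young[OF red f] N by (simp add: Q_def[symmetric] Q(3))
  also have "young_integral r ?F = enn_powr (ennreal c) (r + 1) * ?Y"
    using r Fg by (subst young_integral_scale[symmetric]) (auto intro: young_integral_cong)
  also have "enn_powr \<dots> (\<theta> / (p * 2 ^ d)) = enn_powr ?Y (\<theta> / (p * 2 ^ d)) * ennreal N"
    using c by (simp only: enn_powr_mult enn_powr_powr rQ) (simp add: enn_powr_ennreal N_def mult.commute)
  finally have "ennreal (1 - \<epsilon>) \<le> enn_powr ?Y (\<theta> / (p * 2 ^ d))"
    using N by (simp add: ennreal_mult_le_mult_iff mult.commute[of _ "ennreal N"])
  then have "enn_powr (ennreal (1 - \<epsilon>)) m \<le> enn_powr (enn_powr ?Y (\<theta> / (p * 2 ^ d))) m"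
    using m by (intro enn_powr_mono) auto
  also have "\<dots> = ?Y" using props by (simp add: enn_powr_powr m_def)
  finally have Y: "ennreal (1 - e) \<le> ?Y" using \<epsilon> by (simp add: enn_powr_ennreal e_def)
  have "(1 - \<epsilon>) powr m < 1 powr m" using \<epsilon> m by (intro powr_less_mono2) auto
  then have e: "0 < e" "e \<le> 1" by (auto simp: e_def)
  obtain H x\<^sub>0 where H: "subgroup H G" "H \<in> sets M" "emeasure M H \<noteq> 0" "emeasure M H \<noteq> \<infinity>"
    and x0: "x\<^sub>0 \<in> carrier G"
    and close: "(\<integral>\<^sup>+x. ennreal \<bar>g x - indicator (x\<^sub>0 <# H) x / measure M H\<bar> \<partial>M) \<le> ennreal (4 * \<eta>)"
    using young_stability[OF r g g0 g1 e Y, of \<eta>] small by (auto simp: \<eta>_def defect_def e_def m_def)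
  define h where "h = measure M H"
  have h: "0 < h"
    using H emeasure_eq_ennreal_measure[of M H] by (auto simp: h_def less_le)
  have \<eta>0: "0 \<le> \<eta>" using e by (simp add: \<eta>_def defect_def e_def[symmetric])
  note [measurable] = l_coset_sets[OF x0 H(2)]
  let ?D = "\<lambda>x. f x - N / h powr (1 / Q) * indicator (x\<^sub>0 <# H) x"
  have "(\<integral>\<^sup>+x. enn_powr (ennreal \<bar>?D x\<bar>) Q \<partial>M)
    \<le> (\<integral>\<^sup>+x. ennreal c * ennreal \<bar>g x - indicator (x\<^sub>0 <# H) x / h\<bar> \<partial>M)"
  proof (intro nn_integral_mono)
    fix x assume "x \<in> space M"
    then have x: "0 \<le> f x" using f0 by (simp add: space_eq)
    let ?b = "N / h powr (1 / Q) * indicator (x\<^sub>0 <# H) x"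
    have "\<bar>f x - ?b\<bar> powr Q \<le> \<bar>f x powr Q - ?b powr Q\<bar>"
      using x N h Q by (intro abs_diff_powr_le) auto
    also have "?b powr Q = c * (indicator (x\<^sub>0 <# H) x / h)"
      using N h Q by (auto simp: indicator_def powr_divide powr_powr)
    also have "f x powr Q = c * g x" using x c by (simp add: g_def)
    also have "\<bar>c * g x - c * (indicator (x\<^sub>0 <# H) x / h)\<bar> = c * \<bar>g x - indicator (x\<^sub>0 <# H) x / h\<bar>"
      unfolding right_diff_distrib[symmetric] abs_mult using c by simp
    finally show "enn_powr (ennreal \<bar>?D x\<bar>) Q \<le> ennreal c * ennreal \<bar>g x - indicator (x\<^sub>0 <# H) x / h\<bar>"
      using c by (simp add: enn_powr_ennreal flip: ennreal_mult)
  qed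
  also have "\<dots> = ennreal c * (\<integral>\<^sup>+x. ennreal \<bar>g x - indicator (x\<^sub>0 <# H) x / h\<bar> \<partial>M)"
    by (intro nn_integral_cmult) measurable
  also have "\<dots> \<le> ennreal c * ennreal (4 * \<eta>)"
    using close by (intro mult_left_mono) (auto simp: h_def)
  finally have "Lp_norm M Q ?D \<le> enn_powr (ennreal c * ennreal (4 * \<eta>)) (1 / Q)"
    unfolding Lp_norm_def Lp_enorm_def using Q by (intro enn_powr_mono) auto
  also have "\<dots> = ennreal ((4 * \<eta>) powr (1 / Q)) * ennreal N"
    using c \<eta>0 by (simp add: enn_powr_mult enn_powr_ennreal N_def mult.commute)
  finally have "Lp_norm M Q (\<lambda>x. f x - enn2real (Lp_norm M Q f) / measure M H powr (1 / Q) * indicator (x\<^sub>0 <# H) x)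
      \<le> ennreal ((4 * \<eta>) powr (1 / Q)) * Lp_norm M Q f"
    using N by (simp add: h_def)
  then show ?thesis
    using H x0 subgroup_openin[OF H] subgroup_compactin[OF H]
    unfolding Q_def[symmetric] Q(2) m_def[symmetric] \<eta>_def[symmetric] by blast
qed

lemma defect_tendsto: "((\<lambda>\<epsilon>. defect r m \<epsilon>) \<longlongrightarrow> 0) (at_right 0)"
proof -
  have "((\<lambda>\<epsilon>. defect r m \<epsilon>) \<longlongrightarrow> sqrt (6 * sqrt (max 1 (1 / (r - 1)) * (1 - (1 - 0) powr m)))) (at_right 0)"
    unfolding defect_def by (intro tendsto_intros) auto
  then show ?thesis by simp
qed

lemma crit_exp_gt_1_iff:
  assumes "1 \<le> d" "0 < p"
  shows "1 \<le> crit_exp d p \<longleftrightarrow> real d / (2 ^ d - 1) \<le> p" "1 < crit_exp d p \<longleftrightarrow> real d / (2 ^ d - 1) < p"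
proof -
  have "(2::real) ^ 1 \<le> 2 ^ d" using assms by (intro power_increasing) auto
  then have "0 < (2::real) ^ d - 1" by simp
  then show "1 \<le> crit_exp d p \<longleftrightarrow> real d / (2 ^ d - 1) \<le> p" "1 < crit_exp d p \<longleftrightarrow> real d / (2 ^ d - 1) < p"
    using assms by (auto simp: divide_le_eq divide_less_eq le_divide_eq less_divide_eq algebra_simps)
qed

lemma exponent_pos:
  assumes "1 \<le> d" "real d / (2 ^ d - 1) \<le> p"
  shows "0 < p"
proof -
  have "(2::real) ^ 1 \<le> 2 ^ d" using assms by (intro power_increasing) auto
  then have "0 < real d / (2 ^ d - 1)" using assms by simp
  with assms(2) show ?thesis by simp
qed

text \<open>The constants are built from \<open>r\<close> and \<open>\<theta>\<close>, chosen from
  \<open>d\<close> and \<open>p\<close> before any group is introduced; this gives the required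
  uniformity.\<close>

theorem stability_exists:
  fixes p :: real
  assumes d: "1 \<le> d" and p: "real d / (2 ^ d - 1) < p"
  shows "\<exists>\<epsilon>\<^sub>0>0. \<exists>\<psi>. (\<forall>\<epsilon>>0. 0 \<le> \<psi> \<epsilon>) \<and> (\<psi> \<longlongrightarrow> 0) (at_right 0) \<and> stability_on TYPE('a) d p \<epsilon>\<^sub>0 \<psi>"
proof -
  have p0: "0 < p" using d p by (intro exponent_pos) auto
  have q: "1 < crit_exp d p" using crit_exp_gt_1_iff[OF d p0] p by simp
  obtain r \<theta> where red: "young_reduction d p r \<theta>" and r: "1 < r"
    using young_reduction_exists[OF d p0] q by auto
  define \<eta> where "\<eta> = defect r (p * 2 ^ d / \<theta>)"
  define \<psi> where "\<psi> = (\<lambda>\<epsilon>. (4 * \<eta> \<epsilon>) powr (1 / crit_exp d p))"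
  have \<eta>: "(\<eta> \<longlongrightarrow> 0) (at_right 0)" unfolding \<eta>_def by (rule defect_tendsto)
  then have "\<forall>\<^sub>F \<epsilon> in at_right 0. \<eta> \<epsilon> < 1 / 6"
    by (rule order_tendstoD) simp
  then obtain \<delta> where \<delta>: "0 < \<delta>" "\<And>\<epsilon>. 0 < \<epsilon> \<Longrightarrow> \<epsilon> < \<delta> \<Longrightarrow> \<eta> \<epsilon> < 1 / 6"
    by (auto simp: eventually_at_right_field)
  \<comment> \<open>Half of \<open>\<delta>\<close> because \<open>\<eta> \<epsilon> < 1 / 6\<close>
    is known only for \<open>\<epsilon>\<close> strictly below \<open>\<delta>\<close>; the bound
    1/2 keeps \<open>1 - \<epsilon>\<close> positive.\<close>
  define \<epsilon>\<^sub>0 where "\<epsilon>\<^sub>0 = min (\<delta> / 2) (1 / 2)"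
  have "\<forall>\<^sub>F \<epsilon> in at_right (0::real). 0 < \<epsilon> \<and> \<epsilon> < 1"
    by (auto simp: eventually_at_right_field intro!: exI[of _ 1])
  \<comment> \<open>The base of the power tends to 0, where continuity of \<open>powr\<close> needs
    the base to be nonnegative near the limit.\<close>
  then have ev0: "\<forall>\<^sub>F \<epsilon> in at_right 0. 0 \<le> 4 * \<eta> \<epsilon>"
  proof eventually_elim
    case (elim \<epsilon>)
    then have "(1 - \<epsilon>) powr (p * 2 ^ d / \<theta>) \<le> 1"
      using young_reduction_props[OF red] by (intro powr_le1) auto
    then show ?case by (simp add: \<eta>_def defect_def)
  qed
  have "((\<lambda>\<epsilon>. (4 * \<eta> \<epsilon>) powr (1 / crit_exp d p)) \<longlongrightarrow> (4 * 0) powr (1 / crit_exp d p)) (at_right 0)"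
  proof (rule tendsto_powr')
    show "((\<lambda>\<epsilon>. 4 * \<eta> \<epsilon>) \<longlongrightarrow> 4 * 0) (at_right 0)" by (intro tendsto_intros \<eta>)
  qed (use ev0 p0 in \<open>auto intro!: divide_pos_pos mult_pos_pos add_nonneg_pos\<close>)
  then have "(\<psi> \<longlongrightarrow> 0) (at_right 0)" by (simp add: \<psi>_def)
  moreover have "stability_on TYPE('a) d p \<epsilon>\<^sub>0 \<psi>"
    unfolding stability_on_def
  proof (intro allI impI, elim conjE)
    fix \<epsilon> and G :: "'a monoid" and T \<mu> f
    assume \<epsilon>: "0 < \<epsilon>" "\<epsilon> \<le> \<epsilon>\<^sub>0" and "sc_lca_haar G T \<mu>"
      and *: "f \<in> borel_measurable \<mu>" "\<forall>x\<in>carrier G. 0 \<le> f x" "Lp_norm \<mu> (crit_exp d p) f < \<infinity>"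
        "\<not> (AE x in \<mu>. f x = 0)" "ennreal (1 - \<epsilon>) * Lp_norm \<mu> (crit_exp d p) f \<le> U_norm G \<mu> d p f"
    then interpret haar_group G T \<mu> by (simp add: sc_lca_haar_iff)
    have "\<epsilon> < 1" "\<eta> \<epsilon> < 1 / 6" using \<epsilon> \<delta> by (auto simp: \<epsilon>\<^sub>0_def)
    then show "\<exists>H x\<^sub>0. subgroup H G \<and> openin T H \<and> compactin T H \<and> x\<^sub>0 \<in> carrier G \<and>
           Lp_norm \<mu> (crit_exp d p)
             (\<lambda>x. f x - enn2real (Lp_norm \<mu> (crit_exp d p) f)
                        / measure \<mu> H powr ((real d + p) / (2 ^ d * p))
                        * indicator (x\<^sub>0 <#\<^bsub>G\<^esub> H) x)
           \<le> ennreal (\<psi> \<epsilon>) * Lp_norm \<mu> (crit_exp d p) f"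
      unfolding \<psi>_def \<eta>_def using * \<epsilon> q by (intro near_extremizer[OF red r]) auto
  qed
  moreover have "0 < \<epsilon>\<^sub>0" using \<delta> by (simp add: \<epsilon>\<^sub>0_def)
  moreover have "\<forall>\<epsilon>>0. 0 \<le> \<psi> \<epsilon>" by (simp add: \<psi>_def)
  ultimately show ?thesis by blast
qed

section \<open>Transport to groups of real numbers\<close>

text \<open>A point is determined by the set of indices of the base members containing it, by the
  Hausdorff property; sets of naturals embed into the reals.\<close>

lemma (in haar_group) exists_real_injection: "\<exists>j :: 'a \<Rightarrow> real. inj_on j (carrier G)"
proof -
  obtain \<B> where B: "countable \<B>" "\<And>V. V \<in> \<B> \<Longrightarrow> openin T V"
    "\<And>U x. openin T U \<Longrightarrow> x \<in> U \<Longrightarrow> \<exists>V\<in>\<B>. x \<in> V \<and> V \<subseteq> U"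
    using second_countable unfolding second_countable_def by metis
  define c where "c = (\<lambda>x. to_nat_on \<B> ` {V\<in>\<B>. x \<in> V})"
  have "inj_on c (carrier G)"
  proof (intro inj_onI, rule ccontr)
    fix x y assume xy: "x \<in> carrier G" "y \<in> carrier G" "c x = c y" "x \<noteq> y"
    then obtain U where U: "openin T U" "x \<in> U" "y \<notin> U"
      using Hausdorff unfolding Hausdorff_space_def topspace_eq disjnt_iff by metis
    with B(3) obtain V where V: "V \<in> \<B>" "x \<in> V" "V \<subseteq> U" by blast
    then have "to_nat_on \<B> V \<in> c y" using xy by (auto simp: c_def)
    then obtain V' where "V' \<in> \<B>" "y \<in> V'" "to_nat_on \<B> V = to_nat_on \<B> V'" by (auto simp: c_def)
    then show False using V U inj_on_to_nat_on[OF B(1)] by (auto dest: inj_onD)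
  qed
  moreover obtain k :: "nat set \<Rightarrow> real" where "inj k"
    using nat_sets_eqpoll_reals by (auto simp: eqpoll_def bij_betw_def)
  ultimately have "inj_on (k \<circ> c) (carrier G)"
    by (intro comp_inj_on) (auto intro: inj_on_subset)
  then show ?thesis by blast
qed

text \<open>Moves group, topology and measure along an injection of the carrier into another type,
  making \<open>j\<close> an isomorphism of all three structures. The facts below check that each
  ingredient of the stability statement is invariant under it.\<close>

locale haar_transport = haar_group G T M for G :: "'a monoid" (structure) and T M +
  fixes j :: "'a \<Rightarrow> 'b"
  assumes inj: "inj_on j (carrier G)"
begin

definition pull :: "'b \<Rightarrow> 'a" where
  "pull = the_inv_into (carrier G) j"

definition G' :: "'b monoid" where
  "G' = \<lparr>carrier = j ` carrier G, mult = (\<lambda>a b. j (pull a \<otimes> pull b)), one = j \<one>\<rparr>"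

definition T' :: "'b topology" where
  "T' = pullback_topology (j ` carrier G) pull T"

definition M' :: "'b measure" where
  "M' = distr M (sigma (topspace T') {U. openin T' U}) j"

lemma pull_j [simp]: "x \<in> carrier G \<Longrightarrow> pull (j x) = x"
  unfolding pull_def using inj by (rule the_inv_into_f_f)

lemma carrier_G': "carrier G' = j ` carrier G"
  by (simp add: G'_def)

lemma mult_G' [simp]: "x \<in> carrier G \<Longrightarrow> y \<in> carrier G \<Longrightarrow> j x \<otimes>\<^bsub>G'\<^esub> j y = j (x \<otimes> y)"
  by (simp add: G'_def)

lemma one_G': "\<one>\<^bsub>G'\<^esub> = j \<one>"
  by (simp add: G'_def)

lemma comm_group_G': "comm_group G'"
proof (rule comm_groupI)
  fix x assume "x \<in> carrier G'"
  then obtain a where "a \<in> carrier G" "x = j a" by (auto simp: carrier_G')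
  then show "\<exists>y\<in>carrier G'. y \<otimes>\<^bsub>G'\<^esub> x = \<one>\<^bsub>G'\<^esub>"
    by (intro bexI[of _ "j (inv a)"]) (auto simp: carrier_G' one_G')
qed (auto simp: carrier_G' one_G' m_ac)

lemma inv_G' [simp]: "x \<in> carrier G \<Longrightarrow> inv\<^bsub>G'\<^esub> (j x) = j (inv x)"
proof -
  interpret G': comm_group G' by (rule comm_group_G')
  assume "x \<in> carrier G"
  then show ?thesis by (intro G'.inv_equality) (auto simp: carrier_G' one_G')
qed

lemma pow_G': "x \<in> carrier G \<Longrightarrow> j x [^]\<^bsub>G'\<^esub> (n::nat) = j (x [^] n)"
proof (induction n)
  case 0
  interpret G': comm_group G' by (rule comm_group_G')
  show ?case by (simp add: one_G')
next
  case (Suc n)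
  interpret G': comm_group G' by (rule comm_group_G')
  from Suc show ?case by simp
qed

lemma finprod_G':
  assumes "finite I" "\<And>i. i \<in> I \<Longrightarrow> g i \<in> carrier G"
  shows "(\<Otimes>\<^bsub>G'\<^esub>i\<in>I. j (g i)) = j (\<Otimes>i\<in>I. g i)"
  using assms
proof (induction I rule: finite_induct)
  case empty
  interpret G': comm_group G' by (rule comm_group_G')
  show ?case by (simp add: one_G')
next
  case (insert k I)
  interpret G': comm_group G' by (rule comm_group_G')
  have "(\<Otimes>\<^bsub>G'\<^esub>i\<in>insert k I. j (g i)) = j (g k) \<otimes>\<^bsub>G'\<^esub> (\<Otimes>\<^bsub>G'\<^esub>i\<in>I. j (g i))"
    using insert by (intro G'.finprod_insert) (auto simp: carrier_G')
  also have "\<dots> = j (g k \<otimes> (\<Otimes>i\<in>I. g i))"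
    using insert by (simp add: finprod_closed)
  also have "g k \<otimes> (\<Otimes>i\<in>I. g i) = (\<Otimes>i\<in>insert k I. g i)"
    using insert by (intro finprod_insert[symmetric]) auto
  finally show ?case .
qed

lemma topspace_T': "topspace T' = j ` carrier G"
  by (auto simp: T'_def topspace_pullback_topology topspace_eq)

lemma openin_T': "openin T' S \<longleftrightarrow> (\<exists>U. openin T U \<and> S = j ` U)"
proof -
  have "pull -` U \<inter> j ` carrier G = j ` U" if "openin T U" for U
    using openin_subset[OF that] by (auto simp: topspace_eq image_iff subset_eq)
  then show ?thesis unfolding T'_def openin_pullback_topology by metis
qed

lemma continuous_pull: "continuous_map T' T pull"
  unfolding T'_def using continuous_map_pullback[OF continuous_map_id[of T], of "j ` carrier G" pull] by simp

lemma continuous_j: "continuous_map T T' j"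
  unfolding T'_def
proof (rule continuous_map_pullback')
  show "continuous_map T T (pull \<circ> j)"
    by (rule continuous_map_eq[OF continuous_map_id]) (auto simp: topspace_eq)
qed (auto simp: topspace_eq)

lemma homeo: "homeomorphic_maps T T' j pull"
  using continuous_pull continuous_j by (auto simp: homeomorphic_maps_def topspace_eq topspace_T')

lemma compactin_T': "compactin T' S \<longleftrightarrow> (\<exists>K. compactin T K \<and> S = j ` K)"
proof safe
  assume S: "compactin T' S"
  have "S \<subseteq> j ` carrier G" using compactin_subset_topspace[OF S] by (simp add: topspace_T')
  then have "S = j ` pull ` S" by (force simp: image_image subset_eq)
  then show "\<exists>K. compactin T K \<and> S = j ` K" using image_compactin[OF S continuous_pull] by blast
qed (use image_compactin[OF _ continuous_j] in blast)

lemma lca_group_G': "lca_group G' T'"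
proof -
  interpret G': comm_group G' by (rule comm_group_G')
  show ?thesis
  proof unfold_locales
    show "topspace T' = carrier G'" by (simp add: topspace_T' carrier_G')
    have "continuous_map (prod_topology T' T') (prod_topology T T) (\<lambda>p. (pull (fst p), pull (snd p)))"
      using continuous_map_compose[OF continuous_map_fst continuous_pull]
        continuous_map_compose[OF continuous_map_snd continuous_pull]
      by (intro continuous_map_pairedI) (auto simp: o_def)
    from continuous_map_compose[OF continuous_map_compose[OF this continuous_mult] continuous_j]
    have "continuous_map (prod_topology T' T') T' (\<lambda>p. j (pull (fst p) \<otimes> pull (snd p)))"
      by (simp add: o_def case_prod_unfold)
    then show "continuous_map (prod_topology T' T') T' (\<lambda>(x, y). x \<otimes>\<^bsub>G'\<^esub> y)"
      by (simp add: G'_def case_prod_unfold)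
    from continuous_map_compose[OF continuous_map_compose[OF continuous_pull continuous_inv] continuous_j]
    have "continuous_map T' T' (\<lambda>x. j (inv (pull x)))" by (simp add: o_def)
    then show "continuous_map T' T' (\<lambda>x. inv\<^bsub>G'\<^esub> x)"
      by (rule continuous_map_eq) (auto simp: topspace_T')
    have hom: "T homeomorphic_space T'" using homeo by (auto simp: homeomorphic_space_def)
    show "Hausdorff_space T'"
      using Hausdorff homeomorphic_Hausdorff_space[OF hom] by simp
    show "locally_compact_space T'"
      using locally_compact homeomorphic_locally_compact_space[OF hom] by simp
  qed
qed

lemma second_countable_T': "second_countable T'"
proof -
  have "T homeomorphic_space T'" using homeo by (auto simp: homeomorphic_space_def)
  then show ?thesis using second_countable homeomorphic_space_second_countability by blast
qed

lemma sets_M': "sets M' = sigma_sets (j ` carrier G) {U. openin T' U}"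
proof -
  have "{U. openin T' U} \<subseteq> Pow (topspace T')" by (auto dest: openin_subset)
  then show ?thesis by (simp add: M'_def topspace_T')
qed

lemma space_M': "space M' = j ` carrier G"
proof -
  have "{U. openin T' U} \<subseteq> Pow (topspace T')" by (auto dest: openin_subset)
  then show ?thesis by (simp add: M'_def topspace_T')
qed

lemma vimage_j: "S \<subseteq> carrier G \<Longrightarrow> j -` (j ` S) \<inter> carrier G = S"
  using inj by (auto dest: inj_onD)

lemma j_measurable_sigma: "j \<in> M \<rightarrow>\<^sub>M sigma (topspace T') {U. openin T' U}"
proof (rule measurable_measure_of)
  show "{U. openin T' U} \<subseteq> Pow (topspace T')" by (auto dest: openin_subset)
  show "j \<in> space M \<rightarrow> topspace T'" by (auto simp: topspace_T' carrier_eq)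
  fix S assume "S \<in> {U. openin T' U}"
  then obtain U where "openin T U" "S = j ` U" by (auto simp: openin_T')
  moreover from this have "U \<subseteq> carrier G" using openin_subset[of T U] by (simp add: topspace_eq)
  ultimately show "j -` S \<inter> space M \<in> sets M" by (simp add: carrier_eq vimage_j openin_sets)
qed

lemma j_measurable: "j \<in> M \<rightarrow>\<^sub>M M'"
  using j_measurable_sigma by (simp add: M'_def)

lemma pull_measurable: "pull \<in> M' \<rightarrow>\<^sub>M M"
proof (rule measurable_sigma_sets[OF sets_eq])
  show "{U. openin T U} \<subseteq> Pow (carrier G)" by (auto dest: openin_subset simp: topspace_eq[symmetric])
  show "pull \<in> space M' \<rightarrow> carrier G" by (auto simp: space_M')
  fix U assume "U \<in> {U. openin T U}"
  then have "openin T U" by simp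
  moreover have "pull -` U \<inter> space M' = j ` U"
    using openin_subset[OF \<open>openin T U\<close>] by (auto simp: topspace_eq space_M' image_iff subset_eq)
  ultimately show "pull -` U \<inter> space M' \<in> sets M'"
    using openin_T' by (auto simp: sets_M')
qed

lemma emeasure_M': "A \<in> sets M' \<Longrightarrow> emeasure M' A = emeasure M (j -` A \<inter> carrier G)"
  unfolding M'_def by (subst emeasure_distr[OF j_measurable_sigma]) (auto simp: carrier_eq)

lemma sets_M'_iff: "S \<in> sets M' \<longleftrightarrow> (\<exists>A\<in>sets M. S = j ` A)"
proof safe
  assume S: "S \<in> sets M'"
  then have "S \<subseteq> j ` carrier G" using sets.sets_into_space[OF S] by (simp add: space_M')
  then have "S = j ` (j -` S \<inter> carrier G)" by auto
  moreover have "j -` S \<inter> carrier G \<in> sets M"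
    using measurable_sets[OF j_measurable S] by (simp add: carrier_eq)
  ultimately show "\<exists>A\<in>sets M. S = j ` A" by blast
next
  fix A assume A: "A \<in> sets M"
  have "pull -` A \<inter> space M' = j ` A"
    using sets.sets_into_space[OF A] by (auto simp: carrier_eq space_M' image_iff subset_eq)
  then show "j ` A \<in> sets M'" using measurable_sets[OF pull_measurable A] by simp
qed

lemma emeasure_M'_image: "A \<in> sets M \<Longrightarrow> emeasure M' (j ` A) = emeasure M A"
  using sets.sets_into_space[of A M] sets_M'_iff
  by (subst emeasure_M') (auto simp: carrier_eq vimage_j)

lemma coset_G':
  assumes "x \<in> carrier G" "A \<subseteq> carrier G"
  shows "j x <#\<^bsub>G'\<^esub> (j ` A) = j ` (x <# A)"
  using assms by (force simp: l_coset_def image_iff subset_eq)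

text \<open>Reindexes the infimum of outer regularity along \<open>j\<close>; its compact
  counterpart below does the same for the supremum of inner regularity.\<close>

lemma openin_T'_superset:
  assumes "A \<subseteq> carrier G"
  shows "{U. openin T' U \<and> j ` A \<subseteq> U} = (\<lambda>U. j ` U) ` {U. openin T U \<and> A \<subseteq> U}"
proof -
  have "A \<subseteq> U" if "openin T U" "j ` A \<subseteq> j ` U" for U
    using that openin_subset[of T U] assms inj_on_image_subset_iff[OF inj, of A U] by (simp add: topspace_eq)
  then show ?thesis by (fastforce simp: openin_T')
qed

lemma compactin_T'_subset:
  assumes "U \<subseteq> carrier G"
  shows "{K. compactin T' K \<and> K \<subseteq> j ` U} = (\<lambda>K. j ` K) ` {K. compactin T K \<and> K \<subseteq> U}"
proof -
  have "K \<subseteq> U" if "compactin T K" "j ` K \<subseteq> j ` U" for K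
    using that compactin_subset_topspace[of T K] assms inj_on_image_subset_iff[OF inj, of K U]
    by (simp add: topspace_eq)
  then show ?thesis by (fastforce simp: compactin_T')
qed

lemma haar_measure_M': "haar_measure G' T' M'"
  unfolding haar_measure_def
proof (intro conjI ballI allI impI)
  show "sets M' = sets (sigma (topspace T') {U. openin T' U})" by (simp add: M'_def)
  have "emeasure M' (j ` space M) = emeasure M (space M)" by (rule emeasure_M'_image) simp
  moreover have "emeasure M (space M) \<noteq> 0" using haar by (simp add: haar_measure_def)
  ultimately show "emeasure M' (space M') \<noteq> 0" by (simp add: space_M' carrier_eq)
next
  fix x A assume "x \<in> carrier G'" "A \<in> sets M'"
  then obtain a B where "x = j a" "a \<in> carrier G" "A = j ` B" "B \<in> sets M"
    by (auto simp: carrier_G' sets_M'_iff)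
  moreover from this have "B \<subseteq> carrier G" using sets.sets_into_space carrier_eq by blast
  ultimately show "emeasure M' (x <#\<^bsub>G'\<^esub> A) = emeasure M' A"
    using l_coset_sets emeasure_coset by (simp add: coset_G' emeasure_M'_image)
next
  fix K assume "compactin T' K"
  then obtain L where L: "compactin T L" "K = j ` L" by (auto simp: compactin_T')
  then show "emeasure M' K < \<infinity>"
    using compactin_finite[OF L(1)] by (simp add: emeasure_M'_image compactin_sets less_top)
next
  fix A assume "A \<in> sets M'"
  then obtain B where B: "B \<in> sets M" "A = j ` B" by (auto simp: sets_M'_iff)
  then have "B \<subseteq> carrier G" using sets.sets_into_space carrier_eq by blast
  then show "emeasure M' A = (INF U\<in>{U. openin T' U \<and> A \<subseteq> U}. emeasure M' U)"
    unfolding B(2) openin_T'_superset[OF \<open>B \<subseteq> carrier G\<close>] image_image emeasure_M'_image[OF B(1)]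
      outer_regular[OF B(1)]
    by (intro INF_cong) (auto simp: emeasure_M'_image openin_sets)
next
  fix S assume "openin T' S"
  then obtain U where U: "openin T U" "S = j ` U" by (auto simp: openin_T')
  then have "U \<subseteq> carrier G" using openin_subset[OF U(1)] by (simp add: topspace_eq)
  then show "emeasure M' S = (SUP K\<in>{K. compactin T' K \<and> K \<subseteq> S}. emeasure M' K)"
    unfolding U(2) compactin_T'_subset[OF \<open>U \<subseteq> carrier G\<close>] image_image
      emeasure_M'_image[OF openin_sets[OF U(1)]] inner_regular[OF U(1)]
    by (intro SUP_cong) (auto simp: emeasure_M'_image compactin_sets)
qed

end

sublocale haar_transport \<subseteq> iso: haar_group G' T' M'
  by (intro haar_group.intro haar_group_axioms.intro lca_group_G' second_countable_T' haar_measure_M')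

section \<open>Invariance of the norms and transfer of stability\<close>

context haar_transport
begin

lemma nn_integral_M': "F \<in> borel_measurable M' \<Longrightarrow> (\<integral>\<^sup>+x. F x \<partial>M') = (\<integral>\<^sup>+x. F (j x) \<partial>M)"
  unfolding M'_def using j_measurable_sigma by (subst nn_integral_distr) (auto simp: M'_def)

lemma Lp_norm_M':
  assumes [measurable]: "F \<in> borel_measurable M'" and "\<And>x. x \<in> carrier G \<Longrightarrow> F (j x) = f x"
  shows "Lp_norm M' q F = Lp_norm M q f"
  unfolding Lp_norm_def Lp_enorm_def using assms(2)
  by (subst nn_integral_M') (auto intro!: arg_cong2[where f = enn_powr] nn_integral_cong simp: carrier_eq)

text \<open>A product measure is determined by its values on boxes, and the preimage of a box under
  the coordinatewise map is again a box.\<close>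

lemma PiM_M':
  assumes I: "finite I"
  shows "distr (Pi\<^sub>M I (\<lambda>_. M)) (Pi\<^sub>M I (\<lambda>_. M')) (\<lambda>h. \<lambda>k\<in>I. j (h k)) = Pi\<^sub>M I (\<lambda>_. M')"
    (is "?D = _")
proof (rule iso.prod.PiM_eqI[OF I])
  have m: "(\<lambda>h. \<lambda>k\<in>I. j (h k)) \<in> Pi\<^sub>M I (\<lambda>_. M) \<rightarrow>\<^sub>M Pi\<^sub>M I (\<lambda>_. M')"
    using j_measurable by measurable
  fix A assume A: "\<And>k. k \<in> I \<Longrightarrow> A k \<in> sets M'"
  have vim: "j -` A k \<inter> carrier G \<in> sets M" if "k \<in> I" for k
    using measurable_sets[OF j_measurable A[OF that]] by (simp add: carrier_eq)
  have "(\<lambda>h. \<lambda>k\<in>I. j (h k)) -` Pi\<^sub>E I A \<inter> space (Pi\<^sub>M I (\<lambda>_. M)) = (\<Pi>\<^sub>E k\<in>I. j -` A k \<inter> carrier G)"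
    by (auto simp: space_PiM carrier_eq PiE_iff)
  moreover have "Pi\<^sub>E I A \<in> sets (Pi\<^sub>M I (\<lambda>_. M'))"
    using I A by (intro sets_PiM_I_finite) auto
  ultimately have "emeasure ?D (Pi\<^sub>E I A) = emeasure (Pi\<^sub>M I (\<lambda>_. M)) (\<Pi>\<^sub>E k\<in>I. j -` A k \<inter> carrier G)"
    by (simp add: emeasure_distr[OF m])
  also have "\<dots> = (\<Prod>k\<in>I. emeasure M (j -` A k \<inter> carrier G))"
    using I vim by (intro prod.emeasure_PiM) auto
  also have "\<dots> = (\<Prod>k\<in>I. emeasure M' (A k))"
    using A by (intro prod.cong) (auto simp: emeasure_M')
  finally show "emeasure ?D (Pi\<^sub>E I A) = (\<Prod>k\<in>I. emeasure M' (A k))" .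
qed simp

text \<open>Two changes of variables: one in \<open>x\<close> inside the cube integral, and one in
  the tuple \<open>h\<close> through \<open>PiM_M'\<close>. The tuple is restricted to
  \<open>{..<d}\<close> because product spaces consist of extensional functions.\<close>

lemma U_norm_G':
  assumes F [measurable]: "F \<in> borel_measurable M'" and Ff: "\<And>x. x \<in> carrier G \<Longrightarrow> F (j x) = f x"
  shows "U_norm G' M' d p F = U_norm G M d p f"
proof -
  let ?I = "{..<d}"
  have m: "(\<lambda>h. \<lambda>k\<in>?I. j (h k)) \<in> Pi\<^sub>M ?I (\<lambda>_. M) \<rightarrow>\<^sub>M Pi\<^sub>M ?I (\<lambda>_. M')"
    using j_measurable by measurable
  have R: "gowers_R G' M' d F (\<lambda>k\<in>?I. j (h k)) = gowers_R G M d f h" if h: "h \<in> space (Pi\<^sub>M ?I (\<lambda>_. M))" for h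
  proof -
    have hc: "h k \<in> carrier G" if "k \<in> ?I" for k
      using h that by (auto simp: space_PiM carrier_eq)
    define c where "c = (\<lambda>\<omega>::nat \<Rightarrow> nat. \<Otimes>i\<in>?I. h i [^] \<omega> i)"
    have c: "c \<omega> \<in> carrier G" for \<omega>
      unfolding c_def using hc by (intro finprod_closed) auto
    have prod: "(\<Otimes>\<^bsub>G'\<^esub>i\<in>?I. (\<lambda>k\<in>?I. j (h k)) i [^]\<^bsub>G'\<^esub> \<omega> i) = j (c \<omega>)" for \<omega> :: "nat \<Rightarrow> nat"
    proof -
      have "(\<Otimes>\<^bsub>G'\<^esub>i\<in>?I. (\<lambda>k\<in>?I. j (h k)) i [^]\<^bsub>G'\<^esub> \<omega> i) = (\<Otimes>\<^bsub>G'\<^esub>i\<in>?I. j (h i [^] \<omega> i))"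
        using hc by (intro iso.finprod_cong') (auto simp: pow_G' carrier_G')
      also have "\<dots> = j (c \<omega>)"
        unfolding c_def using hc by (intro finprod_G') auto
      finally show ?thesis .
    qed
    have [measurable]: "(\<lambda>x. F (x \<otimes>\<^bsub>G'\<^esub> j (c \<omega>))) \<in> borel_measurable M'" for \<omega>
      using c by (intro iso.measurable_shift F) (auto simp: carrier_G')
    have "gowers_R G' M' d F (\<lambda>k\<in>?I. j (h k))
      = (\<integral>\<^sup>+x. (\<Prod>\<omega>\<in>?I \<rightarrow>\<^sub>E {0, 1}. ennreal (F (x \<otimes>\<^bsub>G'\<^esub> j (c \<omega>)))) \<partial>M')"
      unfolding gowers_R_def prod ..
    also have "\<dots> = (\<integral>\<^sup>+x. (\<Prod>\<omega>\<in>?I \<rightarrow>\<^sub>E {0, 1}. ennreal (F (j x \<otimes>\<^bsub>G'\<^esub> j (c \<omega>)))) \<partial>M)"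
      by (intro nn_integral_M') measurable
    also have "\<dots> = gowers_R G M d f h"
      unfolding gowers_R_def using c
      by (intro nn_integral_cong prod.cong) (auto simp: carrier_eq Ff c_def)
    finally show ?thesis .
  qed
  have [measurable]: "gowers_R G' M' d F \<in> borel_measurable (Pi\<^sub>M ?I (\<lambda>_. M'))"
    unfolding iso.gowers_R_eq by measurable
  have "(\<integral>\<^sup>+h. enn_powr (gowers_R G' M' d F h) p \<partial>Pi\<^sub>M ?I (\<lambda>_. M'))
    = (\<integral>\<^sup>+h. enn_powr (gowers_R G' M' d F h) p \<partial>distr (Pi\<^sub>M ?I (\<lambda>_. M)) (Pi\<^sub>M ?I (\<lambda>_. M')) (\<lambda>h. \<lambda>k\<in>?I. j (h k)))"
    by (simp add: PiM_M')
  also have "\<dots> = (\<integral>\<^sup>+h. enn_powr (gowers_R G' M' d F (\<lambda>k\<in>?I. j (h k))) p \<partial>Pi\<^sub>M ?I (\<lambda>_. M))"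
    using m by (intro nn_integral_distr) auto
  also have "\<dots> = (\<integral>\<^sup>+h. enn_powr (gowers_R G M d f h) p \<partial>Pi\<^sub>M ?I (\<lambda>_. M))"
    using R by (intro nn_integral_cong) simp
  finally show ?thesis by (simp add: U_norm_def Lp_enorm_def)
qed

end

text \<open>Each group over \<open>'a\<close> has an isomorphic copy with real carrier, on which the
  assumed statement yields a coset for the transported function. Pulling this coset back changes
  neither norms nor measures, so the same \<open>\<epsilon>\<^sub>0\<close> and
  \<open>\<psi>\<close> serve.\<close>

theorem stability_transfer:
  assumes stab: "stability_on TYPE(real) d p \<epsilon>\<^sub>0 \<psi>"
  shows "stability_on TYPE('a) d p \<epsilon>\<^sub>0 \<psi>"
  unfolding stability_on_def
proof (intro allI impI, elim conjE)
  fix \<epsilon> and G :: "'a monoid" and T M f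
  let ?q = "crit_exp d p"
  assume \<epsilon>: "0 < \<epsilon>" "\<epsilon> \<le> \<epsilon>\<^sub>0" and haar: "sc_lca_haar G T M"
    and f: "f \<in> borel_measurable M" "\<forall>x\<in>carrier G. 0 \<le> f x" "Lp_norm M ?q f < \<infinity>"
      "\<not> (AE x in M. f x = 0)" "ennreal (1 - \<epsilon>) * Lp_norm M ?q f \<le> U_norm G M d p f"
  interpret haar_group G T M using haar by (simp add: sc_lca_haar_iff)
  obtain j :: "'a \<Rightarrow> real" where "inj_on j (carrier G)" using exists_real_injection by blast
  then interpret haar_transport G T M j by unfold_locales
  define F where "F = (\<lambda>x. f (pull x))"
  have F [measurable]: "F \<in> borel_measurable M'"
    unfolding F_def using pull_measurable f(1) by (rule measurable_compose)
  have Ff: "F (j x) = f x" if "x \<in> carrier G" for x using that by (simp add: F_def)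
  have Lp: "Lp_norm M' ?q F = Lp_norm M ?q f" using F Ff by (rule Lp_norm_M')
  have "\<not> (AE x in M'. F x = 0)"
  proof
    assume "AE x in M'. F x = 0"
    then have "AE x in M. F (j x) = 0"
      unfolding M'_def by (subst (asm) AE_distr_iff[OF j_measurable_sigma]) (use F in \<open>auto simp: M'_def\<close>)
    then have "AE x in M. f x = 0" using AE_space by eventually_elim (simp add: carrier_eq Ff)
    with f(4) show False by simp
  qed
  moreover have "\<forall>x\<in>carrier G'. 0 \<le> F x" using f(2) Ff by (auto simp: carrier_G')
  moreover have "U_norm G' M' d p F = U_norm G M d p f" using F Ff by (rule U_norm_G')
  moreover have "sc_lca_haar G' T' M'" by (simp add: sc_lca_haar_iff iso.haar_group_axioms)
  ultimately have "\<exists>H' y. subgroup H' G' \<and> openin T' H' \<and> compactin T' H' \<and> y \<in> carrier G' \<and>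
      Lp_norm M' ?q (\<lambda>x. F x - enn2real (Lp_norm M' ?q F)
        / measure M' H' powr ((real d + p) / (2 ^ d * p)) * indicator (y <#\<^bsub>G'\<^esub> H') x)
      \<le> ennreal (\<psi> \<epsilon>) * Lp_norm M' ?q F"
    by (intro stab[unfolded stability_on_def, rule_format]) (use \<epsilon> f F Lp in auto)
  then obtain H' y where H': "subgroup H' G'" "openin T' H'" "compactin T' H'" and y: "y \<in> carrier G'"
    and le: "Lp_norm M' ?q (\<lambda>x. F x - enn2real (Lp_norm M' ?q F)
        / measure M' H' powr ((real d + p) / (2 ^ d * p)) * indicator (y <#\<^bsub>G'\<^esub> H') x)
      \<le> ennreal (\<psi> \<epsilon>) * Lp_norm M' ?q F"
    by blast
  obtain x\<^sub>0 where x0: "x\<^sub>0 \<in> carrier G" "y = j x\<^sub>0" using y by (auto simp: carrier_G')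
  obtain H where H: "openin T H" "H' = j ` H" using H'(2) by (auto simp: openin_T')
  have Hc: "H \<subseteq> carrier G" using openin_subset[OF H(1)] by (simp add: topspace_eq)
  have mem: "j x \<in> j ` A \<longleftrightarrow> x \<in> A" if "x \<in> carrier G" "A \<subseteq> carrier G" for x A
    using that inj by (auto dest: inj_onD)
  have "subgroup H G"
  proof (rule subgroupI)
    show "H \<noteq> {}" using subgroup.one_closed[OF H'(1)] H(2) by auto
    show "inv\<^bsub>G\<^esub> a \<in> H" if "a \<in> H" for a
      using subgroup.m_inv_closed[OF H'(1), of "j a"] that Hc mem[of "inv\<^bsub>G\<^esub> a" H] H(2) by auto
    show "a \<otimes>\<^bsub>G\<^esub> b \<in> H" if "a \<in> H" "b \<in> H" for a b
      using subgroup.m_closed[OF H'(1), of "j a" "j b"] that Hc mem[of "a \<otimes>\<^bsub>G\<^esub> b" H] H(2)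
      by (auto simp: subset_eq)
  qed (rule Hc)
  moreover have "compactin T H"
  proof -
    obtain K where K: "compactin T K" "j ` H = j ` K" using H'(3) H(2) by (auto simp: compactin_T')
    then have "H = K" using compactin_subset_topspace[OF K(1)] Hc
      by (auto simp: topspace_eq inj_on_image_eq_iff[OF inj])
    with K show ?thesis by simp
  qed
  moreover have "Lp_norm M ?q (\<lambda>x. f x - enn2real (Lp_norm M ?q f)
        / measure M H powr ((real d + p) / (2 ^ d * p)) * indicator (x\<^sub>0 <#\<^bsub>G\<^esub> H) x)
      \<le> ennreal (\<psi> \<epsilon>) * Lp_norm M ?q f"
  proof -
    have meas: "measure M' H' = measure M H"
      using H emeasure_M'_image[OF openin_sets[OF H(1)]] by (simp add: measure_def)
    have coset: "y <#\<^bsub>G'\<^esub> H' = j ` (x\<^sub>0 <#\<^bsub>G\<^esub> H)" using x0 H(2) Hc by (simp add: coset_G')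
    have "H' \<in> sets M'" using H openin_sets by (auto simp: sets_M'_iff)
    then have [measurable]: "y <#\<^bsub>G'\<^esub> H' \<in> sets M'" using y by (intro iso.l_coset_sets)
    have sub: "x\<^sub>0 <#\<^bsub>G\<^esub> H \<subseteq> carrier G" using x0(1) Hc by (rule l_coset_subset_G[rotated])
    have "Lp_norm M' ?q (\<lambda>x. F x - enn2real (Lp_norm M' ?q F)
        / measure M' H' powr ((real d + p) / (2 ^ d * p)) * indicator (y <#\<^bsub>G'\<^esub> H') x)
      = Lp_norm M ?q (\<lambda>x. f x - enn2real (Lp_norm M ?q f)
        / measure M H powr ((real d + p) / (2 ^ d * p)) * indicator (x\<^sub>0 <#\<^bsub>G\<^esub> H) x)"
      unfolding Lp meas
    proof (rule Lp_norm_M')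
      fix x assume "x \<in> carrier G"
      then show "F (j x) - enn2real (Lp_norm M ?q f)
            / measure M H powr ((real d + p) / (2 ^ d * p)) * indicator (y <#\<^bsub>G'\<^esub> H') (j x)
          = f x - enn2real (Lp_norm M ?q f)
            / measure M H powr ((real d + p) / (2 ^ d * p)) * indicator (x\<^sub>0 <#\<^bsub>G\<^esub> H) x"
        using mem sub by (simp add: Ff coset indicator_def)
    qed measurable
    with le Lp show ?thesis by simp
  qed
  ultimately show "\<exists>H x\<^sub>0. subgroup H G \<and> openin T H \<and> compactin T H \<and> x\<^sub>0 \<in> carrier G \<and>
      Lp_norm M ?q (\<lambda>x. f x - enn2real (Lp_norm M ?q f)
        / measure M H powr ((real d + p) / (2 ^ d * p)) * indicator (x\<^sub>0 <#\<^bsub>G\<^esub> H) x)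
      \<le> ennreal (\<psi> \<epsilon>) * Lp_norm M ?q f"
    using H(1) x0(1) by blast
qed

theorem theorem1p2:
  fixes d :: nat and p :: real
  assumes "d \<ge> 2"
  shows "(real d / (2 ^ d - 1) \<le> p \<longrightarrow>
           (\<forall>(G :: 'a monoid) T \<mu> f.
              sc_lca_haar G T \<mu> \<and> f \<in> borel_measurable \<mu> \<and> (\<forall>x\<in>carrier G. 0 \<le> f x) \<longrightarrow>
              U_norm G \<mu> d p f \<le> Lp_norm \<mu> (crit_exp d p) f)) \<and>
         (real d / (2 ^ d - 1) < p \<longrightarrow>
           (\<exists>\<epsilon>\<^sub>0 > 0. \<exists>\<psi>. (\<forall>\<epsilon> > 0. 0 \<le> \<psi> \<epsilon>) \<and> (\<psi> \<longlongrightarrow> 0) (at_right 0) \<and>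
              stability_on TYPE(real) d p \<epsilon>\<^sub>0 \<psi>) \<and>
           (\<forall>\<epsilon>\<^sub>0 \<psi>. stability_on TYPE(real) d p \<epsilon>\<^sub>0 \<psi> \<longrightarrow> stability_on TYPE('a) d p \<epsilon>\<^sub>0 \<psi>))"
proof (intro conjI allI impI; (elim conjE)?)
  fix G :: "'a monoid" and T \<mu> and f :: "'a \<Rightarrow> real"
  assume p: "real d / (2 ^ d - 1) \<le> p" and "sc_lca_haar G T \<mu>" and f: "f \<in> borel_measurable \<mu>" "\<forall>x\<in>carrier G. 0 \<le> f x"
  then interpret haar_group G T \<mu> by (simp add: sc_lca_haar_iff)
  have d: "1 \<le> d" using assms by simp
  have p0: "0 < p" using d p by (rule exponent_pos)
  show "U_norm G \<mu> d p f \<le> Lp_norm \<mu> (crit_exp d p) f"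
    using d p0 f p by (intro U_norm_le_Lp_norm) (auto simp: crit_exp_gt_1_iff[OF d p0])
qed (use assms in \<open>auto intro!: stability_exists stability_transfer\<close>)

end
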